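(* Let $H$ be an ultraspherical hypergroup associated to a locally compact group $G$ and a spherical projector $\pi:C_c(G)\to C_c(G)$. Then $H$ is discrete if and only if there exists a minimal idempotent $u\in A(H)$ such that $u(\dot a)\neq 0$ for some $\dot a\in G(H)$. In this case $u=\mathbf 1_{\dot a}$, where $\mathbf 1_{\dot a}$ denotes the characteristic function of $\{\dot a\}$ on $H$.
   Context: Ultraspherical hypergroups: let $G$ be a locally compact group with left Haar measure $dx$. A linear map $\pi:C_c(G)\to C_c(G)$ is a spherical projector if for all $f,g\in C_c(G)$: (1) $\pi^2=\pi$ and $\pi(f)\ge 0$ whenever $f\ge 0$; (2) $\pi(\pi(f)g)=\pi(f)\pi(g)$; (3) $\int_G \pi(f)g\,dx=\int_G f\pi(g)\,dx$; (4) $\pi(\pi(f)*\pi(g))=\pi(f)*\pi(g)$; (5) writing $\pi^*(\delta_x)$ for the measure $f\mapsto \pi(f)(x)$ and $O_x$ for its support, for all $x,y\in G$: (i) either $O_x\cap O_y=\emptyset$ or $O_x=O_y$; (ii) $y\in O_x$ implies $O_{y^{-1}}=O_{x^{-1}}$; (iii) $O_{xy}=O_e$ implies $O_y=O_{x^{-1}}$; (iv) $x\mapsto O_x$ is continuous from $G$ into the space of nonempty compact subsets of $G$ with the Michael topology. Let $H=\{O_x:x\in G\}$ with the quotient topology from $p:G\to H$, $p(x)=O_x=:\dot x$. Then $H$ is a locally compact hypergroup with convolution $\int_H f\,d(\delta_{\dot x}*\delta_{\dot y})=\int_G\int_G f(p(st))\,d\pi^*(\delta_x)(s)\,d\pi^*(\delta_y)(t)$,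 identity $\dot e=p(e)$ and involution $\check{\dot x}=p(x^{-1})$. It is called ultraspherical if the modular function $\Delta$ of $G$ is $\pi$-radial, i.e. $\Delta(x)=\int_G\Delta\,d\pi^*(\delta_x)$ for all $x$. A left Haar measure on $H$ is given by $\int_H f(\dot x)\,d\dot x=\int_G f(p(x))\,dx$. Write $f(\dot x*\dot y)=\int_H f\,d(\delta_{\dot x}*\delta_{\dot y})$. The left regular representation of $H$ on $L^2(H)$ is $\lambda(\dot x)(f)(\dot y)=f(\check{\dot x}*\dot y)$. $VN(H)$ is the von Neumann algebra generated by $\{\lambda(\dot x):\dot x\in H\}$ in $B(L^2(H))$. The Fourier algebra $A(H)$ is the predual of $VN(H)$, each element $u$ being regarded as the function $u(\dot x)=\langle\lambda(\dot x),u\rangle$ on $H$; it is a commutative Banach algebra under pointwise multiplication, with $A(H)^*=VN(H)$. The maximum subgroup of $H$ is $G(H)=\{\dot x\in H:\delta_{\dot x}*\delta_{\check{\dot x}}=\delta_{\dot e}=\delta_{\check{\dot x}}*\delta_{\dot x}\}$. In a commutative Banach algebra $\mathcal A$, a non-zero element $e$ with $e^2=e$ and $e\mathcal A=\mathbb C e$ is called a minimal idempotent. *)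

theory Defs
  imports "HOL-Analysis.Analysis"
begin

section \<open>Locally compact groups\<close>

text \<open>
  A locally compact group is a type of class \<open>topological_group_add\<close> and \<open>t2_space\<close> whose
  topology is locally compact. The class \<open>group_add\<close> is not commutative; so the group operation
  \<open>x y\<close> is written \<open>x + y\<close>, the inverse \<open>- x\<close> and the identity \<open>0\<close>.
\<close>

text \<open>
  Compactly supported continuous functions. The notion is only used on Hausdorff spaces, where
  vanishing outside some compact set is the same as having compact support. Values outside
  \<open>topspace X\<close> are irrelevant.
\<close>

definition Cc :: "'a topology \<Rightarrow> ('a \<Rightarrow> complex) set" where
  "Cc X = {f. continuous_map X euclidean f \<and>
              (\<exists>K. compactin X K \<and> (\<forall>x \<in> topspace X - K. f x = 0))}"

definition radon_measure :: "'a::t2_space measure \<Rightarrow> bool" where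
  "radon_measure \<mu> \<longleftrightarrow>
     sets \<mu> = sets borel \<and>
     (\<forall>K. compact K \<longrightarrow> emeasure \<mu> K < \<infinity>) \<and>
     (\<forall>A \<in> sets borel. emeasure \<mu> A = (INF U \<in> {U. open U \<and> A \<subseteq> U}. emeasure \<mu> U)) \<and>
     (\<forall>U. open U \<longrightarrow> emeasure \<mu> U = (SUP K \<in> {K. compact K \<and> K \<subseteq> U}. emeasure \<mu> K))"

definition left_haar_measure :: "'a::{topological_group_add,t2_space} measure \<Rightarrow> bool" where
  "left_haar_measure \<mu> \<longleftrightarrow>
     radon_measure \<mu> \<and> emeasure \<mu> UNIV \<noteq> 0 \<and>
     (\<forall>x. \<forall>A \<in> sets borel. emeasure \<mu> ((+) x ` A) = emeasure \<mu> A)"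

text \<open>
  With the opposite convention one obtains the reciprocal of this function. The condition of
  radiality below does not depend on the choice: it says that the function is constant on orbits.
\<close>

definition modular_function :: "'a::{topological_group_add,t2_space} measure \<Rightarrow> 'a \<Rightarrow> real" where
  "modular_function \<mu> x =
     (THE c. c > 0 \<and>
        (\<forall>A \<in> sets borel. emeasure \<mu> ((\<lambda>y. y + x) ` A) = ennreal c * emeasure \<mu> A))"

definition convolution ::
    "'a::{topological_group_add,t2_space} measure \<Rightarrow> ('a \<Rightarrow> complex) \<Rightarrow> ('a \<Rightarrow> complex) \<Rightarrow> 'a \<Rightarrow> complex"
  where
  "convolution \<mu> f g x = (\<integral>y. f y * g (- y + x) \<partial>\<mu>)"


section \<open>Radon measures as positive functionals\<close>

text \<open>
  The measures \<open>\<pi>\<^sup>*(\<delta>\<^sub>x)\<close> and the convolutions \<open>\<delta>\<^sub>h * \<delta>\<^sub>k\<close> are Radon measures in the sense of positive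
  functionals \<open>\<nu>\<close> on the compactly supported continuous functions; \<open>\<nu> f\<close> is the integral of \<open>f\<close>.
\<close>

definition radon_support :: "(('a::topological_space \<Rightarrow> complex) \<Rightarrow> complex) \<Rightarrow> 'a set" where
  "radon_support \<nu> =
     - \<Union>{U. open U \<and> (\<forall>f \<in> Cc euclidean. closure {x. f x \<noteq> 0} \<subseteq> U \<longrightarrow> \<nu> f = 0)}"

text \<open>
  The integral of an arbitrary continuous function against a compactly supported measure is
  computed by cutting the function off outside the support; it does not depend on the cutoff.
\<close>

definition radon_integral ::
    "(('a::topological_space \<Rightarrow> complex) \<Rightarrow> complex) \<Rightarrow> ('a \<Rightarrow> complex) \<Rightarrow> complex" where
  "radon_integral \<nu> f =
     (THE c. \<forall>k \<in> Cc euclidean. (\<forall>x \<in> radon_support \<nu>. k x = 1) \<longrightarrow> \<nu> (\<lambda>x. k x * f x) = c)"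


section \<open>Spherical projectors\<close>

definition pi_star :: "(('a \<Rightarrow> complex) \<Rightarrow> 'a \<Rightarrow> complex) \<Rightarrow> 'a \<Rightarrow> ('a \<Rightarrow> complex) \<Rightarrow> complex" where
  "pi_star \<pi> x f = \<pi> f x"

definition orbit :: "(('a::topological_space \<Rightarrow> complex) \<Rightarrow> 'a \<Rightarrow> complex) \<Rightarrow> 'a \<Rightarrow> 'a set" where
  "orbit \<pi> x = radon_support (pi_star \<pi> x)"

definition michael_topology :: "'a::topological_space set topology" where
  "michael_topology =
     topology_generated_by
       {{K. compact K \<and> K \<noteq> {} \<and> K \<inter> U \<noteq> {} \<and> K \<subseteq> V} | U V. open U \<and> open V}"

locale spherical_projector =
  fixes \<mu> :: "'a::{topological_group_add,t2_space} measure"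
    and \<pi> :: "('a \<Rightarrow> complex) \<Rightarrow> 'a \<Rightarrow> complex"
  assumes maps_Cc: "\<And>f. f \<in> Cc euclidean \<Longrightarrow> \<pi> f \<in> Cc euclidean"
    and linear: "\<And>f g a b. f \<in> Cc euclidean \<Longrightarrow> g \<in> Cc euclidean \<Longrightarrow>
          \<pi> (\<lambda>x. a * f x + b * g x) = (\<lambda>x. a * \<pi> f x + b * \<pi> g x)"
    and idem: "\<And>f. f \<in> Cc euclidean \<Longrightarrow> \<pi> (\<pi> f) = \<pi> f"
    and pos: "\<And>f x. f \<in> Cc euclidean \<Longrightarrow> (\<And>y. f y \<in> \<real>\<^sub>\<ge>\<^sub>0) \<Longrightarrow> \<pi> f x \<in> \<real>\<^sub>\<ge>\<^sub>0"
    and averaging: "\<And>f g. f \<in> Cc euclidean \<Longrightarrow> g \<in> Cc euclidean \<Longrightarrow>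
          \<pi> (\<lambda>x. \<pi> f x * g x) = (\<lambda>x. \<pi> f x * \<pi> g x)"
    and symmetric: "\<And>f g. f \<in> Cc euclidean \<Longrightarrow> g \<in> Cc euclidean \<Longrightarrow>
          (\<integral>x. \<pi> f x * g x \<partial>\<mu>) = (\<integral>x. f x * \<pi> g x \<partial>\<mu>)"
    and conv_radial: "\<And>f g. f \<in> Cc euclidean \<Longrightarrow> g \<in> Cc euclidean \<Longrightarrow>
          \<pi> (convolution \<mu> (\<pi> f) (\<pi> g)) = convolution \<mu> (\<pi> f) (\<pi> g)"
    and orbit_partition: "\<And>x y. orbit \<pi> x \<inter> orbit \<pi> y = {} \<or> orbit \<pi> x = orbit \<pi> y"
    and orbit_uminus: "\<And>x y. y \<in> orbit \<pi> x \<Longrightarrow> orbit \<pi> (- y) = orbit \<pi> (- x)"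
    and orbit_add: "\<And>x y. orbit \<pi> (x + y) = orbit \<pi> 0 \<Longrightarrow> orbit \<pi> y = orbit \<pi> (- x)"
    and orbit_cont: "continuous_map euclidean michael_topology (orbit \<pi>)"


section \<open>The hypergroup of orbits\<close>

definition hyp_space :: "(('a::topological_space \<Rightarrow> complex) \<Rightarrow> 'a \<Rightarrow> complex) \<Rightarrow> 'a set set" where
  "hyp_space \<pi> = range (orbit \<pi>)"

definition hyp_topology ::
    "(('a::topological_space \<Rightarrow> complex) \<Rightarrow> 'a \<Rightarrow> complex) \<Rightarrow> 'a set topology" where
  "hyp_topology \<pi> = topology (\<lambda>U. U \<subseteq> hyp_space \<pi> \<and> open (orbit \<pi> -` U))"

lemma openin_hyp_topology:
  "openin (hyp_topology \<pi>) U \<longleftrightarrow> U \<subseteq> hyp_space \<pi> \<and> open (orbit \<pi> -` U)"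
proof -
  have "istopology (\<lambda>U. U \<subseteq> hyp_space \<pi> \<and> open (orbit \<pi> -` U))"
    by (auto simp: istopology_def vimage_Union)
  then show ?thesis
    by (simp add: hyp_topology_def)
qed

lemma topspace_hyp_topology: "topspace (hyp_topology \<pi>) = hyp_space \<pi>"
proof -
  have "orbit \<pi> -` hyp_space \<pi> = UNIV"
    by (auto simp: hyp_space_def)
  then show ?thesis
    by (auto simp: topspace_def openin_hyp_topology)
qed

lemma quotient_map_orbit: "quotient_map euclidean (hyp_topology \<pi>) (orbit \<pi>)"
  by (auto simp: quotient_map_def topspace_hyp_topology openin_hyp_topology hyp_space_def vimage_def)

definition hyp_rep :: "(('a::topological_space \<Rightarrow> complex) \<Rightarrow> 'a \<Rightarrow> complex) \<Rightarrow> 'a set \<Rightarrow> 'a" where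
  "hyp_rep \<pi> h = (SOME x. orbit \<pi> x = h)"

definition hyp_one ::
    "(('a::{topological_group_add,t2_space} \<Rightarrow> complex) \<Rightarrow> 'a \<Rightarrow> complex) \<Rightarrow> 'a set" where
  "hyp_one \<pi> = orbit \<pi> 0"

definition hyp_inv ::
    "(('a::{topological_group_add,t2_space} \<Rightarrow> complex) \<Rightarrow> 'a \<Rightarrow> complex) \<Rightarrow> 'a set \<Rightarrow> 'a set" where
  "hyp_inv \<pi> h = orbit \<pi> (- hyp_rep \<pi> h)"

text \<open>
  The measure \<open>\<delta>\<^sub>h * \<delta>\<^sub>k\<close> as a functional of \<open>f \<in> Cc (hyp_topology \<pi>)\<close>. Since orbits are compact and
  depend continuously on the point, both integrands are compactly supported continuous functions.
  The measures \<open>\<pi>\<^sup>*(\<delta>\<^sub>x)\<close> only depend on the orbit of \<open>x\<close>, so the choice of representatives is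
  immaterial. The notation \<open>f (h * k)\<close> stands for \<open>hyp_conv \<pi> h k f\<close>.
\<close>

definition hyp_conv ::
    "(('a::{topological_group_add,t2_space} \<Rightarrow> complex) \<Rightarrow> 'a \<Rightarrow> complex) \<Rightarrow>
     'a set \<Rightarrow> 'a set \<Rightarrow> ('a set \<Rightarrow> complex) \<Rightarrow> complex" where
  "hyp_conv \<pi> h k f =
     pi_star \<pi> (hyp_rep \<pi> k) (\<lambda>t. pi_star \<pi> (hyp_rep \<pi> h) (\<lambda>s. f (orbit \<pi> (s + t))))"

text \<open>Equality with the Dirac measure at the identity is equality of Radon measures, that is, of
  the functionals on the compactly supported continuous functions.\<close>

definition max_subgroup ::
    "(('a::{topological_group_add,t2_space} \<Rightarrow> complex) \<Rightarrow> 'a \<Rightarrow> complex) \<Rightarrow> 'a set set" where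
  "max_subgroup \<pi> =
     {h \<in> hyp_space \<pi>. \<forall>f \<in> Cc (hyp_topology \<pi>).
        hyp_conv \<pi> h (hyp_inv \<pi> h) f = f (hyp_one \<pi>) \<and>
        hyp_conv \<pi> (hyp_inv \<pi> h) h f = f (hyp_one \<pi>)}"

definition hyp_haar ::
    "'a::{topological_group_add,t2_space} measure \<Rightarrow> (('a \<Rightarrow> complex) \<Rightarrow> 'a \<Rightarrow> complex) \<Rightarrow>
     'a set measure" where
  "hyp_haar \<mu> \<pi> = distr \<mu> (sigma (hyp_space \<pi>) {U. openin (hyp_topology \<pi>) U}) (orbit \<pi>)"

locale ultraspherical_projector = spherical_projector \<mu> \<pi>
  for \<mu> :: "'a::{topological_group_add,t2_space} measure"
    and \<pi> :: "('a \<Rightarrow> complex) \<Rightarrow> 'a \<Rightarrow> complex" +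
  assumes modular_radial: "\<And>x. complex_of_real (modular_function \<mu> x) =
            radon_integral (pi_star \<pi> x) (\<lambda>y. complex_of_real (modular_function \<mu> y))"


section \<open>Von Neumann algebras on an \<open>L\<^sup>2\<close> space\<close>

text \<open>
  Elements of \<open>L\<^sup>2\<close> are represented by square-integrable functions, two of which represent the same
  element iff they agree almost everywhere. Bounded operators are accordingly maps on
  representatives which are linear up to null sets and bounded; they automatically respect
  equality almost everywhere. Values on functions that are not square-integrable are irrelevant.
\<close>

definition L2 :: "'b measure \<Rightarrow> ('b \<Rightarrow> complex) set" where
  "L2 M = {f \<in> borel_measurable M. integrable M (\<lambda>x. (cmod (f x))\<^sup>2)}"

definition L2_inner :: "'b measure \<Rightarrow> ('b \<Rightarrow> complex) \<Rightarrow> ('b \<Rightarrow> complex) \<Rightarrow> complex" where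
  "L2_inner M f g = (\<integral>x. f x * cnj (g x) \<partial>M)"

definition L2_norm :: "'b measure \<Rightarrow> ('b \<Rightarrow> complex) \<Rightarrow> real" where
  "L2_norm M f = sqrt (\<integral>x. (cmod (f x))\<^sup>2 \<partial>M)"

type_synonym 'b operator = "('b \<Rightarrow> complex) \<Rightarrow> 'b \<Rightarrow> complex"

definition L2_operators :: "'b measure \<Rightarrow> 'b operator set" where
  "L2_operators M =
     {T. (\<forall>f \<in> L2 M. T f \<in> L2 M) \<and>
         (\<forall>f \<in> L2 M. \<forall>g \<in> L2 M. \<forall>a b.
            AE x in M. T (\<lambda>y. a * f y + b * g y) x = a * T f x + b * T g x) \<and>
         (\<exists>C. \<forall>f \<in> L2 M. L2_norm M (T f) \<le> C * L2_norm M f)}"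

definition weak_operator_topology :: "'b measure \<Rightarrow> 'b operator topology" where
  "weak_operator_topology M =
     topology_generated_by
       {{T \<in> L2_operators M. L2_inner M (T \<xi>) \<eta> \<in> U} | \<xi> \<eta> U.
          \<xi> \<in> L2 M \<and> \<eta> \<in> L2 M \<and> open U}"

definition ultraweak_topology :: "'b measure \<Rightarrow> 'b operator topology" where
  "ultraweak_topology M =
     topology_generated_by
       {{T \<in> L2_operators M. (\<Sum>n. L2_inner M (T (\<xi> n)) (\<eta> n)) \<in> U} | \<xi> \<eta> U.
          (\<forall>n::nat. \<xi> n \<in> L2 M \<and> \<eta> n \<in> L2 M) \<and>
          summable (\<lambda>n. (L2_norm M (\<xi> n))\<^sup>2) \<and> summable (\<lambda>n. (L2_norm M (\<eta> n))\<^sup>2) \<and> open U}"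

text \<open>
  Operators that agree almost everywhere have the same matrix coefficients, so a weakly closed set
  is a union of classes of operators agreeing almost everywhere.
\<close>

definition von_neumann_algebra :: "'b measure \<Rightarrow> 'b operator set \<Rightarrow> bool" where
  "von_neumann_algebra M N \<longleftrightarrow>
     N \<subseteq> L2_operators M \<and>
     (\<lambda>f. f) \<in> N \<and>
     (\<forall>T \<in> N. \<forall>S \<in> N. \<forall>a b. (\<lambda>f x. a * T f x + b * S f x) \<in> N) \<and>
     (\<forall>T \<in> N. \<forall>S \<in> N. (\<lambda>f. T (S f)) \<in> N) \<and>
     (\<forall>T \<in> N. \<forall>S \<in> L2_operators M.
        (\<forall>f \<in> L2 M. \<forall>g \<in> L2 M. L2_inner M (T f) g = L2_inner M f (S g)) \<longrightarrow> S \<in> N) \<and>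
     closedin (weak_operator_topology M) N"

definition generated_von_neumann_algebra :: "'b measure \<Rightarrow> 'b operator set \<Rightarrow> 'b operator set" where
  "generated_von_neumann_algebra M S = \<Inter>{N. von_neumann_algebra M N \<and> S \<subseteq> N}"

text \<open>The predual consists of the ultraweakly continuous linear functionals.\<close>

definition predual :: "'b measure \<Rightarrow> 'b operator set \<Rightarrow> ('b operator \<Rightarrow> complex) set" where
  "predual M N =
     {\<phi>. (\<forall>T \<in> N. \<forall>S \<in> N. \<forall>a b. \<phi> (\<lambda>f x. a * T f x + b * S f x) = a * \<phi> T + b * \<phi> S) \<and>
         continuous_map (subtopology (ultraweak_topology M) N) euclidean \<phi>}"


section \<open>The Fourier algebra\<close>

text \<open>
  The operator \<open>\<lambda>(h)\<close> is the bounded extension of \<open>f \<mapsto> (k \<mapsto> f (h\<^sup>- * k))\<close> from the dense subspace of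
  compactly supported continuous functions; it is unique up to equality almost everywhere.
\<close>

definition left_regular ::
    "'a::{topological_group_add,t2_space} measure \<Rightarrow> (('a \<Rightarrow> complex) \<Rightarrow> 'a \<Rightarrow> complex) \<Rightarrow>
     'a set \<Rightarrow> 'a set operator" where
  "left_regular \<mu> \<pi> h =
     (SOME T. T \<in> L2_operators (hyp_haar \<mu> \<pi>) \<and>
        (\<forall>f \<in> Cc (hyp_topology \<pi>).
           AE k in hyp_haar \<mu> \<pi>. T f k = hyp_conv \<pi> (hyp_inv \<pi> h) k f))"

definition VN ::
    "'a::{topological_group_add,t2_space} measure \<Rightarrow> (('a \<Rightarrow> complex) \<Rightarrow> 'a \<Rightarrow> complex) \<Rightarrow>
     'a set operator set" where
  "VN \<mu> \<pi> = generated_von_neumann_algebra (hyp_haar \<mu> \<pi>) (left_regular \<mu> \<pi> ` hyp_space \<pi>)"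

text \<open>Functions on the hypergroup are extended by zero to the whole type.\<close>

definition fourier_algebra ::
    "'a::{topological_group_add,t2_space} measure \<Rightarrow> (('a \<Rightarrow> complex) \<Rightarrow> 'a \<Rightarrow> complex) \<Rightarrow>
     ('a set \<Rightarrow> complex) set" where
  "fourier_algebra \<mu> \<pi> =
     {(\<lambda>h. if h \<in> hyp_space \<pi> then \<phi> (left_regular \<mu> \<pi> h) else 0) | \<phi>.
        \<phi> \<in> predual (hyp_haar \<mu> \<pi>) (VN \<mu> \<pi>)}"

text \<open>Minimal idempotents of an algebra of functions with pointwise operations.\<close>

definition minimal_idempotent :: "('b \<Rightarrow> complex) set \<Rightarrow> ('b \<Rightarrow> complex) \<Rightarrow> bool" where
  "minimal_idempotent A e \<longleftrightarrow>
     e \<in> A \<and> e \<noteq> (\<lambda>x. 0) \<and> (\<lambda>x. e x * e x) = e \<and>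
     {(\<lambda>x. e x * v x) | v. v \<in> A} = {(\<lambda>x. c * e x) | c. True}"

end

theory Submission
  imports Defs
begin

text \<open>
  Write \<open>O\<^sub>x\<close> for the orbit of \<open>x\<close>, \<open>H\<close> for the space of orbits, \<open>A(H)\<close> for its Fourier algebra and \<open>K = O\<^sub>0\<close>.

  If \<open>H\<close> is discrete, then \<open>K\<close> is open and compact, the function \<open>1\<^sub>K\<close> descends to the indicator of the
  identity of \<open>H\<close>, and the matrix coefficient of the left regular representation at this vector is a
  positive multiple of the same indicator (\<open>idempotent_at_identity\<close>). So the indicator of the identity
  belongs to \<open>A(H)\<close>, and the indicator of a point in an algebra of functions is a minimal idempotent.

  Conversely an idempotent \<open>u\<close> of \<open>A(H)\<close> is the indicator of a set \<open>E\<close>, and minimality says that every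
  element of \<open>A(H)\<close> is constant on \<open>E\<close>. Since \<open>A(H)\<close> separates points (\<open>fourier_algebra_separates\<close>), \<open>E\<close> is a
  single point \<open>O\<^sub>x\<close>; since \<open>u\<close> is continuous (\<open>fourier_algebra_continuous\<close>), \<open>O\<^sub>x\<close> is open in the group. If
  \<open>O\<^sub>x\<close> lies in the maximum subgroup, then \<open>s + t \<in> K\<close> for all \<open>s \<in> O\<^sub>x\<close> and \<open>t \<in> O\<^bsub>-x\<^esub>\<close>, so \<open>O\<^sub>x - x\<close> is an open
  neighbourhood of \<open>0\<close> inside \<open>K\<close>. All orbits are invariant under right translation by \<open>K\<close>; hence all
  orbits are open, which is discreteness of \<open>H\<close> (\<open>open_orbits\<close>).

  The analytic core is that the operators \<open>\<lambda>(h)\<close> exist as contractions of \<open>L\<^sup>2(H)\<close> with continuous matrix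
  coefficients. Pulled back along the orbit map, functions on \<open>H\<close> become radial functions on the group,
  and \<open>\<lambda>(O\<^sub>x)\<close> becomes the map sending \<open>f\<close> to \<open>\<pi> (orbit_average (- x) f)\<close>, where the average runs over left
  translates of \<open>f\<close>. Such an average is a uniform limit of convex combinations of translates
  (\<open>convex_approximation\<close>), so it does not increase the \<open>L\<^sup>2\<close> norm; neither does \<open>\<pi>\<close>, being a symmetric
  idempotent (\<open>pi_contractive\<close>). Compactly supported functions on \<open>H\<close> are dense in \<open>L\<^sup>2(H)\<close>
  (\<open>Cc_hyp_dense\<close>), and \<open>\<lambda>(h)\<close> extends to the whole space (\<open>left_regular_props\<close>). The measures
  \<open>\<pi>\<^sup>*(\<delta>\<^sub>x)\<close> are treated throughout as positive functionals, by means of order bounds.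
\<close>

section \<open>Square-integrable functions\<close>

lemma L2_measurable: "f \<in> L2 M \<Longrightarrow> f \<in> borel_measurable M"
  by (simp add: L2_def)

lemma L2_integrable: "f \<in> L2 M \<Longrightarrow> integrable M (\<lambda>x. (cmod (f x))\<^sup>2)"
  by (simp add: L2_def)

lemma L2_lincomb:
  assumes "f \<in> L2 M" "g \<in> L2 M"
  shows "(\<lambda>x. a * f x + b * g x) \<in> L2 M"
proof -
  note [measurable] = L2_measurable[OF assms(1)] L2_measurable[OF assms(2)]
  have "integrable M (\<lambda>x. 2 * (cmod a)\<^sup>2 * (cmod (f x))\<^sup>2 + 2 * (cmod b)\<^sup>2 * (cmod (g x))\<^sup>2)"
    using assms by (intro Bochner_Integration.integrable_add integrable_mult_right L2_integrable)
  then have "integrable M (\<lambda>x. (cmod (a * f x + b * g x))\<^sup>2)"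
  proof (rule Bochner_Integration.integrable_bound, measurable, intro AE_I2)
    fix x
    have "(cmod (a * f x + b * g x))\<^sup>2 \<le> (cmod (a * f x) + cmod (b * g x))\<^sup>2"
      by (intro power_mono norm_triangle_ineq) simp
    also have "\<dots> \<le> 2 * (cmod (a * f x))\<^sup>2 + 2 * (cmod (b * g x))\<^sup>2"
      using sum_squares_bound[of "cmod (a * f x)" "cmod (b * g x)"] by (simp add: power2_sum)
    finally show "norm ((cmod (a * f x + b * g x))\<^sup>2)
        \<le> norm (2 * (cmod a)\<^sup>2 * (cmod (f x))\<^sup>2 + 2 * (cmod b)\<^sup>2 * (cmod (g x))\<^sup>2)"
      by (simp add: norm_mult power_mult_distrib)
  qed
  then show ?thesis
    by (simp add: L2_def)
qed

lemma L2_add: "f \<in> L2 M \<Longrightarrow> g \<in> L2 M \<Longrightarrow> (\<lambda>x. f x + g x) \<in> L2 M"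
  using L2_lincomb[of f M g 1 1] by simp

lemma L2_diff: "f \<in> L2 M \<Longrightarrow> g \<in> L2 M \<Longrightarrow> (\<lambda>x. f x - g x) \<in> L2 M"
  using L2_lincomb[of f M g 1 "-1"] by simp

lemma L2_cmult: "f \<in> L2 M \<Longrightarrow> (\<lambda>x. a * f x) \<in> L2 M"
  using L2_lincomb[of f M f a 0] by simp

lemma L2_zero: "(\<lambda>x. 0) \<in> L2 M"
  by (simp add: L2_def)

lemma L2_sum: "finite I \<Longrightarrow> (\<And>i. i \<in> I \<Longrightarrow> f i \<in> L2 M) \<Longrightarrow> (\<lambda>x. \<Sum>i\<in>I. f i x) \<in> L2 M"
  by (induction I rule: finite_induct) (auto intro: L2_zero L2_add)

lemma borel_measurable_cnj [measurable (raw)]: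
  "f \<in> borel_measurable M \<Longrightarrow> (\<lambda>x. cnj (f x)) \<in> borel_measurable M"
  by (rule borel_measurable_continuous_on[where f = cnj]) (intro continuous_intros)

lemma L2_integrable_mult:
  assumes "f \<in> L2 M" "g \<in> L2 M"
  shows "integrable M (\<lambda>x. f x * cnj (g x))"
proof -
  note [measurable] = L2_measurable[OF assms(1)] L2_measurable[OF assms(2)]
  have "integrable M (\<lambda>x. (cmod (f x))\<^sup>2 + (cmod (g x))\<^sup>2)"
    using assms by (intro Bochner_Integration.integrable_add L2_integrable)
  then show ?thesis
  proof (rule Bochner_Integration.integrable_bound, measurable, intro AE_I2)
    fix x
    have "0 \<le> (cmod (f x) - cmod (g x))\<^sup>2" "0 \<le> cmod (f x) * cmod (g x)"
      by auto
    then have "cmod (f x) * cmod (g x) \<le> (cmod (f x))\<^sup>2 + (cmod (g x))\<^sup>2"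
      unfolding power2_diff by linarith
    then show "norm (f x * cnj (g x)) \<le> norm ((cmod (f x))\<^sup>2 + (cmod (g x))\<^sup>2)"
      by (simp add: norm_mult)
  qed
qed

lemma L2_inner_lincomb_left:
  assumes "f \<in> L2 M" "g \<in> L2 M" "h \<in> L2 M"
  shows "L2_inner M (\<lambda>x. a * f x + b * g x) h = a * L2_inner M f h + b * L2_inner M g h"
proof -
  have "L2_inner M (\<lambda>x. a * f x + b * g x) h = (\<integral>x. a * (f x * cnj (h x)) + b * (g x * cnj (h x)) \<partial>M)"
    by (simp add: L2_inner_def algebra_simps)
  also have "\<dots> = a * L2_inner M f h + b * L2_inner M g h"
    using assms by (simp add: L2_integrable_mult L2_inner_def)
  finally show ?thesis .
qed

lemma L2_inner_diff_left:
  assumes "f \<in> L2 M" "g \<in> L2 M" "h \<in> L2 M"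
  shows "L2_inner M (\<lambda>x. f x - g x) h = L2_inner M f h - L2_inner M g h"
  using L2_inner_lincomb_left[OF assms, of 1 "-1"] by simp

lemma L2_inner_commute: "L2_inner M f g = cnj (L2_inner M g f)"
proof -
  have "L2_inner M f g = (\<integral>x. cnj (g x * cnj (f x)) \<partial>M)"
    by (simp add: L2_inner_def mult.commute)
  then show ?thesis
    by (simp only: L2_inner_def Bochner_Integration.integral_cnj[symmetric])
qed

lemma L2_inner_diff_right:
  assumes "f \<in> L2 M" "g \<in> L2 M" "h \<in> L2 M"
  shows "L2_inner M h (\<lambda>x. f x - g x) = L2_inner M h f - L2_inner M h g"
  using L2_inner_diff_left[OF assms] L2_inner_commute[of M h] by simp

lemma L2_norm_nonneg [simp]: "0 \<le> L2_norm M f"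
  by (simp add: L2_norm_def)

lemma L2_norm_power2: "(L2_norm M f)\<^sup>2 = (\<integral>x. (cmod (f x))\<^sup>2 \<partial>M)"
  by (simp add: L2_norm_def)

lemma L2_norm_zero [simp]: "L2_norm M (\<lambda>x. 0) = 0"
  by (simp add: L2_norm_def)

lemma L2_inner_self: "L2_inner M f f = complex_of_real ((L2_norm M f)\<^sup>2)"
proof -
  have "L2_inner M f f = (\<integral>x. complex_of_real ((cmod (f x))\<^sup>2) \<partial>M)"
    by (simp only: L2_inner_def complex_norm_square)
  then show ?thesis
    by (simp only: L2_norm_power2 integral_complex_of_real)
qed

lemma L2_norm_cmult: "L2_norm M (\<lambda>x. a * f x) = cmod a * L2_norm M f"
  by (simp add: L2_norm_def norm_mult power_mult_distrib real_sqrt_mult)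

lemma L2_norm_minus_commute: "L2_norm M (\<lambda>x. f x - g x) = L2_norm M (\<lambda>x. g x - f x)"
  by (simp add: L2_norm_def norm_minus_commute)

lemma L2_Cauchy_Schwarz_abs:
  assumes "f \<in> L2 M" "g \<in> L2 M"
  shows "(\<integral>x. cmod (f x) * cmod (g x) \<partial>M) \<le> L2_norm M f * L2_norm M g"
proof -
  note [measurable] = L2_measurable[OF assms(1)] L2_measurable[OF assms(2)]
  have int: "integrable M (\<lambda>x. cmod (f x) * cmod (g x))"
    using integrable_norm[OF L2_integrable_mult[OF assms]] by (simp add: norm_mult)
  define I where "I = (\<integral>x. cmod (f x) * cmod (g x) \<partial>M)"
  have "0 \<le> I"
    by (simp add: I_def)
  have "(\<integral>\<^sup>+x. ennreal (cmod (f x)) * ennreal (cmod (g x)) \<partial>M)\<^sup>2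
      \<le> (\<integral>\<^sup>+x. (ennreal (cmod (f x)))\<^sup>2 \<partial>M) * (\<integral>\<^sup>+x. (ennreal (cmod (g x)))\<^sup>2 \<partial>M)"
    by (rule Cauchy_Schwarz_nn_integral) auto
  also have "(\<integral>\<^sup>+x. ennreal (cmod (f x)) * ennreal (cmod (g x)) \<partial>M) = ennreal I"
    unfolding I_def by (subst nn_integral_eq_integral[OF int, symmetric]) (auto simp: ennreal_mult)
  also have "(\<integral>\<^sup>+x. (ennreal (cmod (f x)))\<^sup>2 \<partial>M) = ennreal ((L2_norm M f)\<^sup>2)"
    unfolding L2_norm_power2 by (subst nn_integral_eq_integral[OF L2_integrable[OF assms(1)], symmetric])
      (auto simp: ennreal_power)
  also have "(\<integral>\<^sup>+x. (ennreal (cmod (g x)))\<^sup>2 \<partial>M) = ennreal ((L2_norm M g)\<^sup>2)"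
    unfolding L2_norm_power2 by (subst nn_integral_eq_integral[OF L2_integrable[OF assms(2)], symmetric])
      (auto simp: ennreal_power)
  finally have "I\<^sup>2 \<le> (L2_norm M f)\<^sup>2 * (L2_norm M g)\<^sup>2"
    using \<open>0 \<le> I\<close> by (simp add: ennreal_power flip: ennreal_mult)
  then have "I\<^sup>2 \<le> (L2_norm M f * L2_norm M g)\<^sup>2"
    by (simp add: power_mult_distrib)
  then show ?thesis
    unfolding I_def[symmetric] by (rule power2_le_imp_le) simp
qed

lemma L2_Cauchy_Schwarz:
  assumes "f \<in> L2 M" "g \<in> L2 M"
  shows "cmod (L2_inner M f g) \<le> L2_norm M f * L2_norm M g"
proof -
  have "cmod (L2_inner M f g) \<le> (\<integral>x. cmod (f x * cnj (g x)) \<partial>M)"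
    unfolding L2_inner_def by (rule integral_norm_bound)
  also have "\<dots> = (\<integral>x. cmod (f x) * cmod (g x) \<partial>M)"
    by (simp add: norm_mult)
  finally show ?thesis
    using L2_Cauchy_Schwarz_abs[OF assms] by linarith
qed

lemma L2_norm_triangle:
  assumes "f \<in> L2 M" "g \<in> L2 M"
  shows "L2_norm M (\<lambda>x. f x + g x) \<le> L2_norm M f + L2_norm M g"
proof -
  let ?s = "\<lambda>x. f x + g x"
  have s: "?s \<in> L2 M"
    by (rule L2_add[OF assms])
  have "complex_of_real ((L2_norm M ?s)\<^sup>2) = L2_inner M f ?s + L2_inner M g ?s"
    using L2_inner_lincomb_left[OF assms s, of 1 1] by (simp add: L2_inner_self)
  then have "(L2_norm M ?s)\<^sup>2 = cmod (L2_inner M f ?s + L2_inner M g ?s)"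
    by (metis abs_of_nonneg norm_of_real zero_le_power2)
  also have "\<dots> \<le> L2_norm M f * L2_norm M ?s + L2_norm M g * L2_norm M ?s"
    by (intro norm_triangle_le add_mono L2_Cauchy_Schwarz assms s)
  finally have "L2_norm M ?s * L2_norm M ?s \<le> (L2_norm M f + L2_norm M g) * L2_norm M ?s"
    by (simp add: power2_eq_square algebra_simps)
  then show ?thesis
    by (cases "L2_norm M ?s = 0") (auto simp: mult_le_cancel_right order.strict_iff_order)
qed

lemma L2_norm_triangle_diff:
  assumes "f \<in> L2 M" "g \<in> L2 M" "h \<in> L2 M"
  shows "L2_norm M (\<lambda>x. f x - h x) \<le> L2_norm M (\<lambda>x. f x - g x) + L2_norm M (\<lambda>x. g x - h x)"
  using L2_norm_triangle[OF L2_diff[OF assms(1,2)] L2_diff[OF assms(2,3)]] by simp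

lemma L2_norm_le_add_diff:
  assumes "f \<in> L2 M" "g \<in> L2 M"
  shows "L2_norm M f \<le> L2_norm M g + L2_norm M (\<lambda>x. f x - g x)"
  using L2_norm_triangle[OF assms(2) L2_diff[OF assms]] by simp

lemma L2_norm_sum_le:
  assumes "finite I" "\<And>i. i \<in> I \<Longrightarrow> f i \<in> L2 M"
  shows "L2_norm M (\<lambda>x. \<Sum>i\<in>I. f i x) \<le> (\<Sum>i\<in>I. L2_norm M (f i))"
  using assms
proof (induction I rule: finite_induct)
  case (insert i I)
  then have "L2_norm M (\<lambda>x. f i x + (\<Sum>i\<in>I. f i x)) \<le> L2_norm M (f i) + L2_norm M (\<lambda>x. \<Sum>i\<in>I. f i x)"
    by (intro L2_norm_triangle L2_sum) auto
  with insert show ?case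
    by fastforce
qed simp

lemma L2_norm_eq_0_iff:
  assumes "f \<in> L2 M"
  shows "L2_norm M f = 0 \<longleftrightarrow> (AE x in M. f x = 0)"
  using integral_nonneg_eq_0_iff_AE[OF L2_integrable[OF assms]] by (simp add: L2_norm_def)

lemma L2_AE_eqI:
  assumes "f \<in> L2 M" "g \<in> L2 M" "L2_norm M (\<lambda>x. f x - g x) = 0"
  shows "AE x in M. f x = g x"
  using L2_norm_eq_0_iff[OF L2_diff[OF assms(1,2)]] assms(3) by simp

lemma L2_norm_cong_AE:
  assumes "f \<in> borel_measurable M" "g \<in> borel_measurable M" "AE x in M. f x = g x"
  shows "L2_norm M f = L2_norm M g"
  unfolding L2_norm_def
  by (intro arg_cong[where f = sqrt] integral_cong_AE) (use assms in auto)

lemma L2_inner_cong_AE: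
  assumes "f \<in> borel_measurable M" "f' \<in> borel_measurable M" "g \<in> borel_measurable M"
    "AE x in M. f x = f' x"
  shows "L2_inner M f g = L2_inner M f' g"
  unfolding L2_inner_def
  by (intro integral_cong_AE) (use assms in auto)

text \<open>
  The map \<open>z \<mapsto> \<bar>z\<bar> z\<close> is a homeomorphism of the plane which carries Cauchy sequences in \<open>L\<^sup>2\<close> to
  Cauchy sequences in \<open>L\<^sup>1\<close>; so almost everywhere convergent subsequences are inherited from \<open>L\<^sup>1\<close>.
\<close>

lemma convergent_cancel_square:
  fixes z :: "nat \<Rightarrow> complex"
  assumes "Cauchy (\<lambda>i. complex_of_real (cmod (z i)) * z i)"
  shows "convergent z"
proof -
  define \<phi> where "\<phi> w = w / complex_of_real (sqrt (cmod w))" for w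
  have \<phi>: "\<phi> (complex_of_real (cmod w) * w) = w" for w
    by (simp add: \<phi>_def norm_mult)
  have "isCont \<phi> w" for w
  proof (cases "w = 0")
    case True
    have "((\<lambda>w. sqrt (cmod w)) \<longlongrightarrow> sqrt (cmod 0)) (at (0::complex))"
      by (intro tendsto_intros)
    then have "((\<lambda>w. cmod (\<phi> w)) \<longlongrightarrow> 0) (at (0::complex))"
      by (simp add: \<phi>_def norm_divide real_div_sqrt)
    then show ?thesis
      using True \<phi>[of 0] by (simp add: isCont_def tendsto_norm_zero_iff)
  next
    case False
    then show ?thesis
      unfolding \<phi>_def by (intro continuous_intros) auto
  qed
  moreover obtain w where "(\<lambda>i. complex_of_real (cmod (z i)) * z i) \<longlonglongrightarrow> w"
    using assms by (auto simp: Cauchy_convergent_iff convergent_def)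
  ultimately have "(\<lambda>i. \<phi> (complex_of_real (cmod (z i)) * z i)) \<longlonglongrightarrow> \<phi> w"
    by (rule isCont_tendsto_compose)
  then show ?thesis
    by (auto simp: \<phi> convergent_def)
qed

lemma L2_Cauchy_imp_AE_convergent_subseq:
  fixes s :: "nat \<Rightarrow> 'b \<Rightarrow> complex"
  assumes s: "\<And>n. s n \<in> L2 M"
    and Cauchy: "\<And>e. e > 0 \<Longrightarrow> \<exists>N. \<forall>i\<ge>N. \<forall>j\<ge>N. L2_norm M (\<lambda>x. s i x - s j x) < e"
  obtains r where "strict_mono r" "AE x in M. convergent (\<lambda>i. s (r i) x)"
proof -
  note [measurable] = L2_measurable[OF s]
  define S where "S n x = complex_of_real (cmod (s n x)) * s n x" for n x
  have int: "integrable M (S n)" for n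
    by (rule Bochner_Integration.integrable_bound[OF L2_integrable[OF s[of n]]])
      (auto simp: S_def[abs_def] norm_mult power2_eq_square)
  obtain N1 :: nat where N1: "\<And>i j. i \<ge> N1 \<Longrightarrow> j \<ge> N1 \<Longrightarrow> L2_norm M (\<lambda>x. s i x - s j x) < 1"
    using Cauchy[of 1] by auto
  define B where "B = L2_norm M (s N1) + 1"
  have "B > 0"
    unfolding B_def by (rule add_nonneg_pos) simp_all
  have B: "L2_norm M (s i) \<le> B" if "i \<ge> N1" for i
    using L2_norm_le_add_diff[OF s[of i] s[of N1]] N1[OF that, of N1] by (simp add: B_def)
  have "\<exists>N. \<forall>i\<ge>N. \<forall>j\<ge>N. (LINT x|M. norm (S i x - S j x)) < e" if "e > 0" for e
  proof -
    obtain N :: nat where N: "\<And>i j. i \<ge> N \<Longrightarrow> j \<ge> N \<Longrightarrow> L2_norm M (\<lambda>x. s i x - s j x) < e / (2 * B)"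
      using Cauchy[of "e / (2 * B)"] \<open>e > 0\<close> \<open>B > 0\<close> by auto
    have "(LINT x|M. norm (S i x - S j x)) < e" if "i \<ge> N + N1" "j \<ge> N + N1" for i j
    proof -
      let ?d = "\<lambda>x. s i x - s j x"
      have d: "?d \<in> L2 M"
        by (intro L2_diff s)
      have i1: "integrable M (\<lambda>x. cmod (s k x) * cmod (?d x))" for k
        using integrable_norm[OF L2_integrable_mult[OF s[of k] d]]
        by (simp only: norm_mult complex_mod_cnj)
      have "(LINT x|M. norm (S i x - S j x)) \<le>
          (LINT x|M. cmod (s i x) * cmod (?d x) + cmod (s j x) * cmod (?d x))"
      proof (rule integral_mono)
        show "integrable M (\<lambda>x. norm (S i x - S j x))"
          by (intro integrable_norm Bochner_Integration.integrable_diff int)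
        fix x
        have eq: "S i x - S j x = complex_of_real (cmod (s i x)) * ?d x
            + complex_of_real (cmod (s i x) - cmod (s j x)) * s j x"
          by (simp add: S_def algebra_simps)
        \<comment> \<open>the map \<open>z \<mapsto> \<bar>z\<bar> z\<close> is locally Lipschitz with constant \<open>\<bar>z\<bar> + \<bar>w\<bar>\<close>, which Cauchy-Schwarz turns into an \<open>L\<^sup>1\<close> bound\<close>
        have "norm (S i x - S j x) \<le> cmod (s i x) * cmod (?d x)
            + \<bar>cmod (s i x) - cmod (s j x)\<bar> * cmod (s j x)"
          unfolding eq
          by (rule order_trans[OF norm_triangle_ineq]) (simp only: norm_mult norm_of_real abs_norm_cancel order_refl)
        also have "\<dots> \<le> cmod (s i x) * cmod (?d x) + cmod (?d x) * cmod (s j x)"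
          by (intro add_left_mono mult_right_mono norm_triangle_ineq3) simp
        finally show "norm (S i x - S j x) \<le> cmod (s i x) * cmod (?d x) + cmod (s j x) * cmod (?d x)"
          by (simp add: mult.commute)
      qed (intro Bochner_Integration.integrable_add i1)
      also have "\<dots> = (LINT x|M. cmod (s i x) * cmod (?d x)) + (LINT x|M. cmod (s j x) * cmod (?d x))"
        by (intro Bochner_Integration.integral_add i1)
      also have "\<dots> \<le> L2_norm M (s i) * L2_norm M ?d + L2_norm M (s j) * L2_norm M ?d"
        by (intro add_mono L2_Cauchy_Schwarz_abs s d)
      also have "\<dots> \<le> B * L2_norm M ?d + B * L2_norm M ?d"
        using that by (intro add_mono mult_right_mono B) simp_all
      also have "\<dots> < e"
        using N[of i j] that \<open>B > 0\<close> by (simp add: pos_less_divide_eq mult.commute)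
      finally show ?thesis .
    qed
    then show ?thesis
      by blast
  qed
  then obtain r where r: "strict_mono r" "AE x in M. Cauchy (\<lambda>i. S (r i) x)"
    by (rule cauchy_L1_AE_cauchy_subseq[of M S, OF int])
  from r(2) have "AE x in M. convergent (\<lambda>i. s (r i) x)"
    by (rule AE_mp) (auto simp: S_def intro!: AE_I2 convergent_cancel_square)
  with r(1) show ?thesis
    by (rule that)
qed

text \<open>
  The limit along an almost everywhere convergent subsequence is also the limit in norm, by Fatou's
  lemma applied to \<open>\<bar>s n - s (r i)\<bar>\<^sup>2\<close> as \<open>i\<close> tends to infinity.
\<close>

lemma L2_complete:
  fixes s :: "nat \<Rightarrow> 'b \<Rightarrow> complex"
  assumes s: "\<And>n. s n \<in> L2 M"
    and Cauchy: "\<And>e. e > 0 \<Longrightarrow> \<exists>N. \<forall>i\<ge>N. \<forall>j\<ge>N. L2_norm M (\<lambda>x. s i x - s j x) < e"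
  obtains f where "f \<in> L2 M" "(\<lambda>n. L2_norm M (\<lambda>x. s n x - f x)) \<longlonglongrightarrow> 0"
proof -
  note [measurable] = L2_measurable[OF s]
  obtain r where r: "strict_mono r" and conv: "AE x in M. convergent (\<lambda>i. s (r i) x)"
    by (rule L2_Cauchy_imp_AE_convergent_subseq[of s M, OF s Cauchy])
  define f where "f x = lim (\<lambda>i. s (r i) x)" for x
  have [measurable]: "f \<in> borel_measurable M"
    unfolding f_def by measurable
  have Fatou: "integrable M (\<lambda>x. (cmod (s n x - f x))\<^sup>2) \<and> L2_norm M (\<lambda>x. s n x - f x) \<le> e"
    if "e > 0" and N: "\<And>j. j \<ge> N \<Longrightarrow> L2_norm M (\<lambda>x. s n x - s j x) < e" for n N e
  proof -
    have "(\<integral>\<^sup>+x. ennreal ((cmod (s n x - f x))\<^sup>2) \<partial>M)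
        = (\<integral>\<^sup>+x. liminf (\<lambda>i. ennreal ((cmod (s n x - s (r i) x))\<^sup>2)) \<partial>M)"
    proof (rule nn_integral_cong_AE, rule AE_mp[OF conv], intro AE_I2 impI)
      fix x assume "convergent (\<lambda>i. s (r i) x)"
      then have "(\<lambda>i. s (r i) x) \<longlonglongrightarrow> f x"
        by (simp add: convergent_LIMSEQ_iff f_def)
      then have "(\<lambda>i. ennreal ((cmod (s n x - s (r i) x))\<^sup>2)) \<longlonglongrightarrow> ennreal ((cmod (s n x - f x))\<^sup>2)"
        by (intro tendsto_intros)
      then show "ennreal ((cmod (s n x - f x))\<^sup>2) = liminf (\<lambda>i. ennreal ((cmod (s n x - s (r i) x))\<^sup>2))"
        by (rule lim_imp_Liminf[OF trivial_limit_sequentially, symmetric])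
    qed
    also have "\<dots> \<le> liminf (\<lambda>i. \<integral>\<^sup>+x. ennreal ((cmod (s n x - s (r i) x))\<^sup>2) \<partial>M)"
      by (rule nn_integral_liminf) measurable
    also have "\<dots> \<le> ennreal (e\<^sup>2)"
    proof (rule Liminf_le)
      show "eventually (\<lambda>i. (\<integral>\<^sup>+x. ennreal ((cmod (s n x - s (r i) x))\<^sup>2) \<partial>M) \<le> ennreal (e\<^sup>2)) sequentially"
        using eventually_ge_at_top[of N]
      proof eventually_elim
        case (elim i)
        then have "L2_norm M (\<lambda>x. s n x - s (r i) x) < e"
          using N seq_suble[OF r, of i] le_trans by blast
        then have "(L2_norm M (\<lambda>x. s n x - s (r i) x))\<^sup>2 \<le> e\<^sup>2"
          by (intro power_mono) auto
        then show ?case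
          by (subst nn_integral_eq_integral[OF L2_integrable[OF L2_diff[OF s s]]])
            (auto simp: L2_norm_power2 ennreal_leI)
      qed
    qed simp
    finally have le: "(\<integral>\<^sup>+x. ennreal ((cmod (s n x - f x))\<^sup>2) \<partial>M) \<le> ennreal (e\<^sup>2)" .
    have int: "integrable M (\<lambda>x. (cmod (s n x - f x))\<^sup>2)"
      using order_le_less_trans[OF le ennreal_less_top] by (intro integrableI_bounded) simp_all
    have "(L2_norm M (\<lambda>x. s n x - f x))\<^sup>2 \<le> e\<^sup>2"
      using le nn_integral_eq_integral[OF int] unfolding L2_norm_power2 by simp
    then have "L2_norm M (\<lambda>x. s n x - f x) \<le> e"
      by (rule power2_le_imp_le) (use \<open>e > 0\<close> in simp)
    with int show ?thesis
      by blast
  qed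
  have "\<exists>N. L2_norm M (\<lambda>x. s N x - f x) \<le> 1 \<and> integrable M (\<lambda>x. (cmod (s N x - f x))\<^sup>2)"
  proof -
    obtain N :: nat where N: "\<And>i j. i \<ge> N \<Longrightarrow> j \<ge> N \<Longrightarrow> L2_norm M (\<lambda>x. s i x - s j x) < 1"
      using Cauchy[of 1] by auto
    show ?thesis
      using Fatou[of 1 N N, OF _ N] by auto
  qed
  then obtain N where "integrable M (\<lambda>x. (cmod (s N x - f x))\<^sup>2)"
    by blast
  then have "(\<lambda>x. s N x - f x) \<in> L2 M"
    by (simp add: L2_def)
  from L2_diff[OF s[of N] this] have f: "f \<in> L2 M"
    by simp
  have "(\<lambda>n. L2_norm M (\<lambda>x. s n x - f x)) \<longlonglongrightarrow> 0"
  proof (rule LIMSEQ_I)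
    fix e :: real assume "e > 0"
    then obtain N :: nat where N: "\<And>i j. i \<ge> N \<Longrightarrow> j \<ge> N \<Longrightarrow> L2_norm M (\<lambda>x. s i x - s j x) < e / 2"
      using Cauchy[of "e / 2"] by auto
    have "norm (L2_norm M (\<lambda>x. s n x - f x) - 0) < e" if "n \<ge> N" for n
      using Fatou[of "e / 2" N n] N[OF that] \<open>e > 0\<close> by fastforce
    then show "\<exists>N. \<forall>n\<ge>N. norm (L2_norm M (\<lambda>x. s n x - f x) - 0) < e"
      by blast
  qed
  with f show ?thesis
    by (rule that)
qed

definition L2_dense :: "'b measure \<Rightarrow> ('b \<Rightarrow> complex) set \<Rightarrow> bool" where
  "L2_dense M D \<longleftrightarrow> D \<subseteq> L2 M \<and> (\<forall>f \<in> L2 M. \<forall>e>0. \<exists>g \<in> D. L2_norm M (\<lambda>x. g x - f x) < e)"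

lemma L2_denseD:
  assumes "L2_dense M D" "f \<in> L2 M" "e > 0"
  obtains g where "g \<in> D" "g \<in> L2 M" "L2_norm M (\<lambda>x. g x - f x) < e"
  using assms unfolding L2_dense_def by blast

lemma L2_dense_sequence:
  assumes "L2_dense M D" "f \<in> L2 M"
  obtains s where "\<And>n. s n \<in> D" "(\<lambda>n. L2_norm M (\<lambda>x. s n x - f x)) \<longlonglongrightarrow> 0"
proof -
  have "\<exists>g \<in> D. L2_norm M (\<lambda>x. g x - f x) < 1 / Suc n" for n
    using assms unfolding L2_dense_def by simp
  then obtain s where s: "\<And>n. s n \<in> D" "\<And>n. L2_norm M (\<lambda>x. s n x - f x) < 1 / Suc n"
    by metis
  have "(\<lambda>n. L2_norm M (\<lambda>x. s n x - f x)) \<longlonglongrightarrow> 0"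
    by (rule tendsto_sandwich[OF _ _ tendsto_const LIMSEQ_Suc[OF lim_1_over_n]])
      (auto intro!: always_eventually less_imp_le[OF s(2)] simp del: of_nat_Suc)
  with s(1) show ?thesis
    by (rule that)
qed

text \<open>
  Every \<open>f\<close> in \<open>L\<^sup>2\<close> is a pointwise limit of simple functions dominated by \<open>2 \<bar>f\<bar>\<close>, hence a limit in norm by
  dominated convergence; the level sets of these functions off \<open>0\<close> have finite measure. So it is
  enough to approximate indicators.
\<close>

lemma L2_dense_indicatorI:
  fixes M :: "'b measure"
  assumes D: "D \<subseteq> L2 M"
    and lincomb: "\<And>f g a b. f \<in> D \<Longrightarrow> g \<in> D \<Longrightarrow> (\<lambda>x. a * f x + b * g x) \<in> D"
    and zero: "(\<lambda>x. 0) \<in> D"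
    and ind: "\<And>A e. A \<in> sets M \<Longrightarrow> emeasure M A < \<infinity> \<Longrightarrow> e > 0 \<Longrightarrow>
        \<exists>g \<in> D. L2_norm M (\<lambda>x. g x - indicator A x) < e"
  shows "L2_dense M D"
  unfolding L2_dense_def
proof (intro conjI ballI allI impI D)
  define P where "P f \<longleftrightarrow> f \<in> L2 M \<and> (\<forall>e>0. \<exists>g \<in> D. L2_norm M (\<lambda>x. g x - f x) < e)" for f
  have P_ind: "P (indicator A)" if "A \<in> sets M" "emeasure M A < \<infinity>" for A
  proof -
    have "(\<lambda>x. (cmod (indicator A x))\<^sup>2) = (\<lambda>x. indicator A x :: real)"
      by (auto simp: indicator_def)
    moreover have "(indicator A :: 'b \<Rightarrow> complex) \<in> borel_measurable M"
      using that by (intro borel_measurable_indicator)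
    ultimately have "(indicator A :: 'b \<Rightarrow> complex) \<in> L2 M"
      using that by (simp add: L2_def)
    then show ?thesis
      using ind[OF that] by (simp add: P_def)
  qed
  have P_lincomb: "P (\<lambda>x. a * f x + f' x)" if Pf: "P f" and Pf': "P f'" for f f' and a :: complex
    unfolding P_def
  proof (intro conjI allI impI)
    show "(\<lambda>x. a * f x + f' x) \<in> L2 M"
      using Pf Pf' L2_lincomb[of f M f' a 1] by (simp add: P_def)
    fix e :: real assume "e > 0"
    then have e: "e / (2 * (cmod a + 1)) > 0"
      by (simp add: add_nonneg_pos)
    obtain g where g: "g \<in> D" "L2_norm M (\<lambda>x. g x - f x) < e / (2 * (cmod a + 1))"
      using Pf e unfolding P_def by blast
    obtain g' where g': "g' \<in> D" "L2_norm M (\<lambda>x. g' x - f' x) < e / 2"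
      using Pf' half_gt_zero[OF \<open>e > 0\<close>] unfolding P_def by blast
    have "(\<lambda>x. (a * g x + g' x) - (a * f x + f' x)) = (\<lambda>x. a * (g x - f x) + (g' x - f' x))"
      by (auto simp: algebra_simps)
    then have "L2_norm M (\<lambda>x. (a * g x + g' x) - (a * f x + f' x))
        \<le> L2_norm M (\<lambda>x. a * (g x - f x)) + L2_norm M (\<lambda>x. g' x - f' x)"
      using L2_norm_triangle[OF L2_cmult[OF L2_diff] L2_diff, of g M f g' f' a] Pf Pf' g(1) g'(1) D
      by (auto simp: P_def)
    also have "\<dots> < e"
    proof -
      have "cmod a * L2_norm M (\<lambda>x. g x - f x) \<le> (cmod a + 1) * (e / (2 * (cmod a + 1)))"
        using g(2) by (intro mult_mono) auto
      also have "\<dots> = e / 2"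
        by (simp add: field_simps add_nonneg_eq_0_iff)
      finally show ?thesis
        using g'(2) by (simp add: L2_norm_cmult)
    qed
    finally show "\<exists>g\<in>D. L2_norm M (\<lambda>x. g x - (a * f x + f' x)) < e"
      using lincomb[OF g(1) g'(1), of a 1] by (intro bexI[of _ "\<lambda>x. a * g x + g' x"]) auto
  qed
  have P_0: "P (\<lambda>x. 0)"
    using zero by (auto simp: P_def L2_zero intro!: bexI[of _ "\<lambda>x. 0"])
  have P_sum: "P (\<lambda>x. \<Sum>y\<in>Y. y * indicator (A y) x)"
    if "finite Y" "\<And>y. y \<in> Y \<Longrightarrow> A y \<in> sets M \<and> emeasure M (A y) < \<infinity>" for Y and A :: "complex \<Rightarrow> 'b set"
    using that
  proof (induction Y rule: finite_induct)
    case (insert y Y)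
    have "P (\<lambda>x. \<Sum>y\<in>Y. y * indicator (A y) x)"
      using insert by blast
    moreover have "P (indicator (A y))"
      using insert.prems[of y] by (intro P_ind) auto
    ultimately have "P (\<lambda>x. y * indicator (A y) x + (\<Sum>y\<in>Y. y * indicator (A y) x))"
      by (rule P_lincomb[rotated])
    with insert.hyps show ?case
      by (simp only: sum.insert not_False_eq_True)
  qed (simp add: P_0)
  fix f and e :: real assume f: "f \<in> L2 M" and "e > 0"
  note [measurable] = L2_measurable[OF f]
  obtain F where F: "\<And>i. simple_function M (F i)" "\<And>x. x \<in> space M \<Longrightarrow> (\<lambda>i. F i x) \<longlonglongrightarrow> f x"
    "\<And>i x. x \<in> space M \<Longrightarrow> cmod (F i x) \<le> 2 * cmod (f x)"
    using borel_measurable_implies_sequence_metric[OF L2_measurable[OF f], of 0]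
    by (simp add: dist_norm) metis
  note [measurable] = borel_measurable_simple_function[OF F(1)]
  have Fsq: "(cmod (F i x))\<^sup>2 \<le> 4 * (cmod (f x))\<^sup>2" if "x \<in> space M" for i x
    using power_mono[OF F(3)[OF that, of i], of 2] by (simp add: power_mult_distrib)
  have PF: "P (F i)" for i
  proof -
    let ?Y = "F i ` space M - {0}" and ?A = "\<lambda>y. F i -` {y} \<inter> space M"
    have "finite ?Y"
      using simple_functionD(1)[OF F(1)] by simp
    moreover have A: "?A y \<in> sets M" for y
      using simple_functionD(2)[OF F(1)] by blast
    moreover have "emeasure M (?A y) < \<infinity>" if "y \<in> ?Y" for y
    proof -
      have "integrable M (\<lambda>x. 4 / (cmod y)\<^sup>2 * (cmod (f x))\<^sup>2)"
        by (intro integrable_mult_right L2_integrable f)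
      then have "integrable M (indicator (?A y) :: 'b \<Rightarrow> real)"
      proof (rule Bochner_Integration.integrable_bound)
        show "(indicator (?A y) :: 'b \<Rightarrow> real) \<in> borel_measurable M"
          using A by simp
        show "AE x in M. norm (indicator (?A y) x :: real) \<le> norm (4 / (cmod y)\<^sup>2 * (cmod (f x))\<^sup>2)"
        proof (intro AE_I2)
          fix x assume "x \<in> space M"
          with that Fsq[of x i] show "norm (indicator (?A y) x :: real) \<le> norm (4 / (cmod y)\<^sup>2 * (cmod (f x))\<^sup>2)"
            by (auto simp: indicator_def field_simps)
        qed
      qed
      then show ?thesis
        using A[of y] by (simp add: integrable_indicator_iff Int_absorb2)
    qed
    ultimately have "P (\<lambda>x. \<Sum>y\<in>?Y. y * indicator (?A y) x)"
      by (intro P_sum) auto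
    moreover have "(\<Sum>y\<in>?Y. y * indicator (?A y) x) = F i x" if "x \<in> space M" for x
    proof -
      have "(\<Sum>y\<in>?Y. y * indicator (?A y) x) = (\<Sum>y\<in>?Y. if F i x = y then y else 0)"
        using that by (intro sum.cong) (auto simp: indicator_def)
      then show ?thesis
        using that \<open>finite ?Y\<close> by (auto simp: sum.delta')
    qed
    ultimately show ?thesis
      unfolding P_def L2_def L2_norm_def
      by (simp cong: measurable_cong Bochner_Integration.integrable_cong Bochner_Integration.integral_cong)
  qed
  have "(\<lambda>i. \<integral>x. (cmod (F i x - f x))\<^sup>2 \<partial>M) \<longlonglongrightarrow> (\<integral>x. 0 \<partial>M)"
  proof (rule integral_dominated_convergence)
    show "integrable M (\<lambda>x. 9 * (cmod (f x))\<^sup>2)"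
      by (intro integrable_mult_right L2_integrable f)
    show "AE x in M. (\<lambda>i. (cmod (F i x - f x))\<^sup>2) \<longlonglongrightarrow> 0"
    proof (intro AE_I2)
      fix x assume "x \<in> space M"
      then have "(\<lambda>i. (cmod (F i x - f x))\<^sup>2) \<longlonglongrightarrow> (cmod (f x - f x))\<^sup>2"
        by (intro tendsto_intros F)
      then show "(\<lambda>i. (cmod (F i x - f x))\<^sup>2) \<longlonglongrightarrow> 0"
        by simp
    qed
    show "AE x in M. norm ((cmod (F i x - f x))\<^sup>2) \<le> 9 * (cmod (f x))\<^sup>2" for i
    proof (intro AE_I2)
      fix x assume "x \<in> space M"
      then have "cmod (F i x - f x) \<le> 3 * cmod (f x)"
        using F(3)[of x i] norm_triangle_ineq4[of "F i x" "f x"] by linarith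
      from power_mono[OF this, of 2] show "norm ((cmod (F i x - f x))\<^sup>2) \<le> 9 * (cmod (f x))\<^sup>2"
        by (simp add: power_mult_distrib)
    qed
  qed auto
  then have "(\<lambda>i. L2_norm M (\<lambda>x. F i x - f x)) \<longlonglongrightarrow> 0"
    unfolding L2_norm_def using tendsto_real_sqrt[of _ 0] by fastforce
  then have "\<forall>\<^sub>F i in sequentially. L2_norm M (\<lambda>x. F i x - f x) < e / 2"
    using \<open>e > 0\<close> by (intro order_tendstoD(2)[of _ 0]) auto
  then obtain i where i: "L2_norm M (\<lambda>x. F i x - f x) < e / 2"
    by (auto dest: eventually_happens)
  obtain g where g: "g \<in> D" "L2_norm M (\<lambda>x. g x - F i x) < e / 2"
    using PF[of i] half_gt_zero[OF \<open>e > 0\<close>] unfolding P_def by blast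
  have "L2_norm M (\<lambda>x. g x - f x) \<le> L2_norm M (\<lambda>x. g x - F i x) + L2_norm M (\<lambda>x. F i x - f x)"
    using g D PF f by (intro L2_norm_triangle_diff) (auto simp: P_def)
  then show "\<exists>g\<in>D. L2_norm M (\<lambda>x. g x - f x) < e"
    using g i by (intro bexI[of _ g]) auto
qed


text \<open>
  Extension by continuity, for operators that act on representatives: the value at \<open>f\<close> is some
  representative of the limit of \<open>T0 (s n)\<close>, for any sequence \<open>s\<close> in \<open>D\<close> tending to \<open>f\<close>. Choosing a
  representative for each \<open>f\<close> is why linearity holds only almost everywhere.
\<close>

lemma L2_bounded_extension:
  assumes dense: "L2_dense M D"
    and lincomb: "\<And>f g a b. f \<in> D \<Longrightarrow> g \<in> D \<Longrightarrow> (\<lambda>x. a * f x + b * g x) \<in> D"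
    and T0_L2: "\<And>f. f \<in> D \<Longrightarrow> T0 f \<in> L2 M"
    and T0_lin: "\<And>f g a b. f \<in> D \<Longrightarrow> g \<in> D \<Longrightarrow>
        AE x in M. T0 (\<lambda>x. a * f x + b * g x) x = a * T0 f x + b * T0 g x"
    and T0_bound: "\<And>f. f \<in> D \<Longrightarrow> L2_norm M (T0 f) \<le> L2_norm M f"
  obtains T where "T \<in> L2_operators M" "\<And>f. f \<in> D \<Longrightarrow> AE x in M. T f x = T0 f x"
proof -
  have D: "f \<in> L2 M" if "f \<in> D" for f
    using dense that by (auto simp: L2_dense_def)
  have T0_lin_norm: "L2_norm M (\<lambda>x. T0 (\<lambda>x. a * f x + b * g x) x - h x)
      = L2_norm M (\<lambda>x. a * T0 f x + b * T0 g x - h x)"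
    if "f \<in> D" "g \<in> D" "h \<in> L2 M" for f g h a b
  proof (rule L2_norm_cong_AE)
    show "AE x in M. T0 (\<lambda>x. a * f x + b * g x) x - h x = a * T0 f x + b * T0 g x - h x"
      using T0_lin[OF that(1,2)] by (rule AE_mp) auto
  qed (intro L2_measurable L2_diff L2_lincomb T0_L2 lincomb that)+
  have T0_diff: "L2_norm M (\<lambda>x. T0 f x - T0 g x) \<le> L2_norm M (\<lambda>x. f x - g x)"
    if "f \<in> D" "g \<in> D" for f g
    using T0_lin_norm[OF that L2_zero, of 1 "-1"] T0_bound[OF lincomb[OF that, of 1 "-1"]] by simp
  \<comment> \<open>quantifying over all approximating sequences makes the limit independent of the sequence, which linearity uses\<close>
  define lim where "lim f h \<longleftrightarrow> h \<in> L2 M \<and>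
      (\<forall>s. (\<forall>n. s n \<in> D) \<longrightarrow> (\<lambda>n. L2_norm M (\<lambda>x. s n x - f x)) \<longlonglongrightarrow> 0 \<longrightarrow>
        (\<lambda>n. L2_norm M (\<lambda>x. T0 (s n) x - h x)) \<longlonglongrightarrow> 0)" for f h
  have lim_ex: "\<exists>h. lim f h" if f: "f \<in> L2 M" for f
  proof -
    obtain s where s: "\<And>n. s n \<in> D" "(\<lambda>n. L2_norm M (\<lambda>x. s n x - f x)) \<longlonglongrightarrow> 0"
      using L2_dense_sequence[OF dense f] by blast
    have "\<exists>N. \<forall>i\<ge>N. \<forall>j\<ge>N. L2_norm M (\<lambda>x. T0 (s i) x - T0 (s j) x) < e" if "e > 0" for e
    proof -
      have "\<forall>\<^sub>F n in sequentially. L2_norm M (\<lambda>x. s n x - f x) < e / 2"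
        using that by (intro order_tendstoD(2)[OF s(2)]) simp
      then obtain N where N: "\<And>n. n \<ge> N \<Longrightarrow> L2_norm M (\<lambda>x. s n x - f x) < e / 2"
        by (auto simp: eventually_sequentially)
      have "L2_norm M (\<lambda>x. T0 (s i) x - T0 (s j) x) < e" if "i \<ge> N" "j \<ge> N" for i j
        using T0_diff[OF s(1) s(1), of i j] L2_norm_triangle_diff[OF D[OF s(1)] f D[OF s(1)], of i j]
          N[OF that(1)] N[OF that(2)] L2_norm_minus_commute[of M f "s j"] by simp
      then show ?thesis
        by blast
    qed
    then obtain h where h: "h \<in> L2 M" "(\<lambda>n. L2_norm M (\<lambda>x. T0 (s n) x - h x)) \<longlonglongrightarrow> 0"
      using L2_complete[of "\<lambda>n. T0 (s n)" M] T0_L2[OF s(1)] by blast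
    have "(\<lambda>n. L2_norm M (\<lambda>x. T0 (t n) x - h x)) \<longlonglongrightarrow> 0"
      if t: "\<And>n. t n \<in> D" "(\<lambda>n. L2_norm M (\<lambda>x. t n x - f x)) \<longlonglongrightarrow> 0" for t
    proof (rule tendsto_sandwich[OF _ _ tendsto_const])
      show "\<forall>\<^sub>F n in sequentially. L2_norm M (\<lambda>x. T0 (t n) x - h x) \<le>
          (L2_norm M (\<lambda>x. t n x - f x) + L2_norm M (\<lambda>x. s n x - f x)) + L2_norm M (\<lambda>x. T0 (s n) x - h x)"
      proof (intro always_eventually allI)
        fix n
        show "L2_norm M (\<lambda>x. T0 (t n) x - h x) \<le>
            (L2_norm M (\<lambda>x. t n x - f x) + L2_norm M (\<lambda>x. s n x - f x)) + L2_norm M (\<lambda>x. T0 (s n) x - h x)"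
          using L2_norm_triangle_diff[OF T0_L2[OF t(1)] T0_L2[OF s(1)] h(1), of n n] T0_diff[OF t(1) s(1), of n n]
            L2_norm_triangle_diff[OF D[OF t(1)] f D[OF s(1)], of n n] L2_norm_minus_commute[of M f "s n"] by simp
      qed
      show "(\<lambda>n. (L2_norm M (\<lambda>x. t n x - f x) + L2_norm M (\<lambda>x. s n x - f x)) + L2_norm M (\<lambda>x. T0 (s n) x - h x)) \<longlonglongrightarrow> 0"
        using tendsto_add[OF tendsto_add[OF t(2) s(2)] h(2)] by simp
    qed simp
    with h(1) show ?thesis
      by (auto simp: lim_def)
  qed
  define T where "T f = (SOME h. lim f h)" for f
  have T: "lim f (T f)" if "f \<in> L2 M" for f
    unfolding T_def using lim_ex[OF that] by (rule someI_ex)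
  have T_L2: "T f \<in> L2 M" if "f \<in> L2 M" for f
    using T[OF that] by (simp add: lim_def)
  have T_tendsto: "(\<lambda>n. L2_norm M (\<lambda>x. T0 (s n) x - T f x)) \<longlonglongrightarrow> 0"
    if "f \<in> L2 M" "\<And>n. s n \<in> D" "(\<lambda>n. L2_norm M (\<lambda>x. s n x - f x)) \<longlonglongrightarrow> 0" for f s
    using T[OF that(1)] that by (simp add: lim_def)
  have bound: "L2_norm M (T f) \<le> 1 * L2_norm M f" if f: "f \<in> L2 M" for f
  proof -
    obtain s where s: "\<And>n. s n \<in> D" "(\<lambda>n. L2_norm M (\<lambda>x. s n x - f x)) \<longlonglongrightarrow> 0"
      using L2_dense_sequence[OF dense f] by blast
    note lim = T_tendsto[OF f s]
    have "L2_norm M (T f) \<le> (L2_norm M f + L2_norm M (\<lambda>x. s n x - f x)) + L2_norm M (\<lambda>x. T0 (s n) x - T f x)" for n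
      using L2_norm_le_add_diff[OF T_L2[OF f] T0_L2[OF s(1)], of n] T0_bound[OF s(1), of n]
        L2_norm_le_add_diff[OF D[OF s(1)] f, of n] L2_norm_minus_commute[of M "T f" "T0 (s n)"] by simp
    moreover have "(\<lambda>n. (L2_norm M f + L2_norm M (\<lambda>x. s n x - f x)) + L2_norm M (\<lambda>x. T0 (s n) x - T f x))
        \<longlonglongrightarrow> (L2_norm M f + 0) + 0"
      by (intro tendsto_intros s lim)
    ultimately show ?thesis
      by (intro LIMSEQ_le_const[where X = "\<lambda>n. (L2_norm M f + L2_norm M (\<lambda>x. s n x - f x)) + L2_norm M (\<lambda>x. T0 (s n) x - T f x)"]) auto
  qed
  have lin: "AE x in M. T (\<lambda>y. a * f y + b * g y) x = a * T f x + b * T g x"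
    if f: "f \<in> L2 M" and g: "g \<in> L2 M" for f g a b
  proof (rule L2_AE_eqI)
    let ?k = "\<lambda>y. a * f y + b * g y"
    have k: "?k \<in> L2 M"
      by (rule L2_lincomb[OF f g])
    show "T ?k \<in> L2 M" "(\<lambda>x. a * T f x + b * T g x) \<in> L2 M"
      by (intro T_L2 L2_lincomb f g)+
    obtain s where s: "\<And>n. s n \<in> D" "(\<lambda>n. L2_norm M (\<lambda>x. s n x - f x)) \<longlonglongrightarrow> 0"
      using L2_dense_sequence[OF dense f] by blast
    obtain t where t: "\<And>n. t n \<in> D" "(\<lambda>n. L2_norm M (\<lambda>x. t n x - g x)) \<longlonglongrightarrow> 0"
      using L2_dense_sequence[OF dense g] by blast
    have lincomb_tendsto: "(\<lambda>n. L2_norm M (\<lambda>x. (a * u n x + b * v n x) - (a * u' x + b * v' x))) \<longlonglongrightarrow> 0"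
      if "\<And>n. u n \<in> L2 M" "\<And>n. v n \<in> L2 M" "u' \<in> L2 M" "v' \<in> L2 M"
        "(\<lambda>n. L2_norm M (\<lambda>x. u n x - u' x)) \<longlonglongrightarrow> 0" "(\<lambda>n. L2_norm M (\<lambda>x. v n x - v' x)) \<longlonglongrightarrow> 0" for u v u' v'
    proof (rule tendsto_sandwich[OF _ _ tendsto_const])
      show "\<forall>\<^sub>F n in sequentially. L2_norm M (\<lambda>x. (a * u n x + b * v n x) - (a * u' x + b * v' x))
          \<le> cmod a * L2_norm M (\<lambda>x. u n x - u' x) + cmod b * L2_norm M (\<lambda>x. v n x - v' x)"
      proof (intro always_eventually allI)
        fix n
        have "(\<lambda>x. (a * u n x + b * v n x) - (a * u' x + b * v' x)) = (\<lambda>x. a * (u n x - u' x) + b * (v n x - v' x))"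
          by (auto simp: algebra_simps)
        then show "L2_norm M (\<lambda>x. (a * u n x + b * v n x) - (a * u' x + b * v' x))
            \<le> cmod a * L2_norm M (\<lambda>x. u n x - u' x) + cmod b * L2_norm M (\<lambda>x. v n x - v' x)"
          using L2_norm_triangle[OF L2_cmult[OF L2_diff[OF that(1,3)], of a] L2_cmult[OF L2_diff[OF that(2,4)], of b], of n n]
          by (simp only: L2_norm_cmult)
      qed
      show "(\<lambda>n. cmod a * L2_norm M (\<lambda>x. u n x - u' x) + cmod b * L2_norm M (\<lambda>x. v n x - v' x)) \<longlonglongrightarrow> 0"
        using tendsto_add[OF tendsto_mult_left[OF that(5), of "cmod a"] tendsto_mult_left[OF that(6), of "cmod b"]]
        by simp
    qed simp
    define w where "w n = (\<lambda>x. a * s n x + b * t n x)" for n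
    have w: "w n \<in> D" for n
      unfolding w_def by (intro lincomb s t)
    have "(\<lambda>n. L2_norm M (\<lambda>x. w n x - ?k x)) \<longlonglongrightarrow> 0"
      unfolding w_def by (intro lincomb_tendsto D s t f g)
    then have lim1: "(\<lambda>n. L2_norm M (\<lambda>x. T0 (w n) x - T ?k x)) \<longlonglongrightarrow> 0"
      by (intro T_tendsto k w)
    let ?l = "\<lambda>x. a * T f x + b * T g x"
    have l: "?l \<in> L2 M"
      by (intro L2_lincomb T_L2 f g)
    have "(\<lambda>n. L2_norm M (\<lambda>x. (a * T0 (s n) x + b * T0 (t n) x) - ?l x)) \<longlonglongrightarrow> 0"
      by (intro lincomb_tendsto T0_L2 T_L2 s t f g T_tendsto)
    then have lim2: "(\<lambda>n. L2_norm M (\<lambda>x. T0 (w n) x - ?l x)) \<longlonglongrightarrow> 0"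
      unfolding w_def by (simp add: T0_lin_norm[OF s(1) t(1) l])
    have "L2_norm M (\<lambda>x. T ?k x - ?l x) \<le> L2_norm M (\<lambda>x. T0 (w n) x - T ?k x) + L2_norm M (\<lambda>x. T0 (w n) x - ?l x)" for n
      using L2_norm_triangle_diff[OF T_L2[OF k] T0_L2[OF w] l, of n] L2_norm_minus_commute[of M "T ?k" "T0 (w n)"] by simp
    then have "L2_norm M (\<lambda>x. T ?k x - ?l x) \<le> 0 + 0"
      by (intro LIMSEQ_le_const[OF tendsto_add[OF lim1 lim2]]) auto
    then show "L2_norm M (\<lambda>x. T ?k x - ?l x) = 0"
      using L2_norm_nonneg[of M "\<lambda>x. T ?k x - ?l x"] by simp
  qed
  have "T \<in> L2_operators M"
    using T_L2 lin bound unfolding L2_operators_def by blast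
  moreover have "AE x in M. T f x = T0 f x" if f: "f \<in> D" for f
  proof (rule L2_AE_eqI)
    have "(\<lambda>n. L2_norm M (\<lambda>x. T0 f x - T f x)) \<longlonglongrightarrow> 0"
      by (rule T_tendsto) (use f D in auto)
    then show "L2_norm M (\<lambda>x. T f x - T0 f x) = 0"
      by (simp add: LIMSEQ_const_iff L2_norm_minus_commute[of M "T f"])
  qed (use f D T_L2 T0_L2 in auto)
  ultimately show ?thesis
    by (rule that)
qed

lemma L2_operator_L2: "T \<in> L2_operators M \<Longrightarrow> f \<in> L2 M \<Longrightarrow> T f \<in> L2 M"
  by (simp add: L2_operators_def)

lemma L2_operator_linear:
  "T \<in> L2_operators M \<Longrightarrow> f \<in> L2 M \<Longrightarrow> g \<in> L2 M \<Longrightarrow>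
    AE x in M. T (\<lambda>y. a * f y + b * g y) x = a * T f x + b * T g x"
  by (simp add: L2_operators_def)

lemma L2_operator_bounded:
  assumes "T \<in> L2_operators M"
  obtains C where "0 \<le> C" "\<And>f. f \<in> L2 M \<Longrightarrow> L2_norm M (T f) \<le> C * L2_norm M f"
proof -
  obtain C where C: "\<And>f. f \<in> L2 M \<Longrightarrow> L2_norm M (T f) \<le> C * L2_norm M f"
    using assms unfolding L2_operators_def by blast
  have "L2_norm M (T f) \<le> \<bar>C\<bar> * L2_norm M f" if "f \<in> L2 M" for f
    using C[OF that] mult_right_mono[OF abs_ge_self[of C] L2_norm_nonneg[of M f]] by linarith
  then show ?thesis
    using that[of "\<bar>C\<bar>"] by simp
qed

lemma L2_operator_diff_norm:
  assumes T: "T \<in> L2_operators M" and f: "f \<in> L2 M" and g: "g \<in> L2 M"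
  shows "L2_norm M (\<lambda>x. T f x - T g x) = L2_norm M (T (\<lambda>x. f x - g x))"
proof (rule L2_norm_cong_AE)
  show "AE x in M. T f x - T g x = T (\<lambda>x. f x - g x) x"
    using L2_operator_linear[OF T f g, of 1 "-1"] by (rule AE_mp) auto
qed (intro L2_measurable L2_diff L2_operator_L2[OF T] f g)+

lemma L2_operator_cong_AE:
  assumes T: "T \<in> L2_operators M" and f: "f \<in> L2 M" and g: "g \<in> L2 M"
    and eq: "AE x in M. f x = g x"
  shows "AE x in M. T f x = T g x"
proof (rule L2_AE_eqI[OF L2_operator_L2[OF T f] L2_operator_L2[OF T g]])
  obtain C where C: "0 \<le> C" "\<And>f. f \<in> L2 M \<Longrightarrow> L2_norm M (T f) \<le> C * L2_norm M f"
    using L2_operator_bounded[OF T] by blast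
  have "AE x in M. f x - g x = 0"
    using eq by (rule AE_mp) auto
  then have "L2_norm M (\<lambda>x. f x - g x) = 0"
    using L2_norm_eq_0_iff[OF L2_diff[OF f g]] by simp
  then show "L2_norm M (\<lambda>x. T f x - T g x) = 0"
    using C(2)[OF L2_diff[OF f g]] L2_operator_diff_norm[OF T f g] L2_norm_nonneg[of M "T (\<lambda>x. f x - g x)"] by simp
qed

text \<open>
  A bounded operator that is merely known on a dense set, such as one obtained by a choice, inherits
  the norm bound valid on that set.
\<close>

lemma L2_operator_contractive:
  assumes T: "T \<in> L2_operators M" and dense: "L2_dense M D"
    and D: "\<And>f. f \<in> D \<Longrightarrow> L2_norm M (T f) \<le> L2_norm M f"
    and f: "f \<in> L2 M"
  shows "L2_norm M (T f) \<le> L2_norm M f"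
proof -
  obtain C where C: "0 \<le> C" "\<And>f. f \<in> L2 M \<Longrightarrow> L2_norm M (T f) \<le> C * L2_norm M f"
    using L2_operator_bounded[OF T] by blast
  obtain s where s: "\<And>n. s n \<in> D" and lim: "(\<lambda>n. L2_norm M (\<lambda>x. s n x - f x)) \<longlonglongrightarrow> 0"
    using L2_dense_sequence[OF dense f] by blast
  have sL2: "s n \<in> L2 M" for n
    using s dense by (auto simp: L2_dense_def)
  have "L2_norm M (T f) \<le> L2_norm M f + (1 + C) * L2_norm M (\<lambda>x. s n x - f x)" for n
  proof -
    have "L2_norm M (T f) \<le> L2_norm M (T (s n)) + L2_norm M (\<lambda>x. T f x - T (s n) x)"
      by (intro L2_norm_le_add_diff L2_operator_L2[OF T] f sL2)
    also have "\<dots> \<le> L2_norm M (s n) + C * L2_norm M (\<lambda>x. f x - s n x)"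
      using D[OF s[of n]] C(2)[OF L2_diff[OF f sL2[of n]]] by (simp add: L2_operator_diff_norm[OF T f sL2])
    also have "L2_norm M (s n) \<le> L2_norm M f + L2_norm M (\<lambda>x. s n x - f x)"
      by (intro L2_norm_le_add_diff f sL2)
    finally show ?thesis
      by (simp add: L2_norm_minus_commute[of M f] algebra_simps)
  qed
  moreover have "(\<lambda>n. L2_norm M f + (1 + C) * L2_norm M (\<lambda>x. s n x - f x)) \<longlonglongrightarrow> L2_norm M f + (1 + C) * 0"
    by (intro tendsto_intros lim)
  ultimately have "L2_norm M (T f) \<le> L2_norm M f + (1 + C) * 0"
    by (intro LIMSEQ_le_const[where X = "\<lambda>n. L2_norm M f + (1 + C) * L2_norm M (\<lambda>x. s n x - f x)"]) auto
  then show ?thesis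
    by simp
qed

section \<open>Compactly supported continuous functions\<close>

lemma Cc_iff:
  "f \<in> Cc euclidean \<longleftrightarrow> continuous_on UNIV f \<and> (\<exists>K. compact K \<and> (\<forall>x. x \<notin> K \<longrightarrow> f x = 0))"
  by (auto simp: Cc_def)

lemma Cc_continuous: "f \<in> Cc euclidean \<Longrightarrow> continuous_on UNIV f"
  by (simp add: Cc_iff)

lemma Cc_support:
  assumes "f \<in> Cc euclidean"
  obtains K where "compact K" "\<And>x. x \<notin> K \<Longrightarrow> f x = 0"
  using assms by (auto simp: Cc_iff)

lemma CcI:
  "continuous_on UNIV f \<Longrightarrow> compact K \<Longrightarrow> (\<And>x. x \<notin> K \<Longrightarrow> f x = 0) \<Longrightarrow> f \<in> Cc euclidean"
  by (auto simp: Cc_iff)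

lemma Cc_mult_continuous:
  assumes "f \<in> Cc euclidean" "continuous_on UNIV g"
  shows "(\<lambda>x. f x * g x) \<in> Cc euclidean"
proof -
  obtain K where "compact K" "\<And>x. x \<notin> K \<Longrightarrow> f x = 0"
    using Cc_support[OF assms(1)] by blast
  then show ?thesis
    using assms Cc_continuous[OF assms(1)] by (intro CcI[of _ K] continuous_on_mult) auto
qed

lemma Cc_mult: "f \<in> Cc euclidean \<Longrightarrow> g \<in> Cc euclidean \<Longrightarrow> (\<lambda>x. f x * g x) \<in> Cc euclidean"
  by (intro Cc_mult_continuous Cc_continuous)

lemma Cc_lincomb:
  assumes "f \<in> Cc euclidean" "g \<in> Cc euclidean"
  shows "(\<lambda>x. a * f x + b * g x) \<in> Cc euclidean"
proof -
  obtain K L where "compact K" "\<And>x. x \<notin> K \<Longrightarrow> f x = 0" "compact L" "\<And>x. x \<notin> L \<Longrightarrow> g x = 0"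
    using Cc_support[OF assms(1)] Cc_support[OF assms(2)] by metis
  then show ?thesis
    using Cc_continuous[OF assms(1)] Cc_continuous[OF assms(2)]
    by (intro CcI[of _ "K \<union> L"] continuous_on_add continuous_on_mult continuous_on_const) auto
qed

lemma Cc_zero: "(\<lambda>x. 0) \<in> Cc euclidean"
  by (rule CcI[of _ "{}"]) auto

lemma Cc_cmult: "f \<in> Cc euclidean \<Longrightarrow> (\<lambda>x. a * f x) \<in> Cc euclidean"
  using Cc_lincomb[OF _ Cc_zero, of f a 0] by simp

lemma Cc_add: "f \<in> Cc euclidean \<Longrightarrow> g \<in> Cc euclidean \<Longrightarrow> (\<lambda>x. f x + g x) \<in> Cc euclidean"
  using Cc_lincomb[of f g 1 1] by simp

lemma Cc_diff: "f \<in> Cc euclidean \<Longrightarrow> g \<in> Cc euclidean \<Longrightarrow> (\<lambda>x. f x - g x) \<in> Cc euclidean"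
  using Cc_lincomb[of f g 1 "-1"] by simp

lemma Cc_sum:
  "finite I \<Longrightarrow> (\<And>i. i \<in> I \<Longrightarrow> f i \<in> Cc euclidean) \<Longrightarrow> (\<lambda>x. \<Sum>i\<in>I. f i x) \<in> Cc euclidean"
  by (induction I rule: finite_induct) (auto intro: Cc_zero Cc_add)

lemma Cc_compose:
  assumes "f \<in> Cc euclidean" "continuous_on UNIV h" "h 0 = 0"
  shows "(\<lambda>x. h (f x)) \<in> Cc euclidean"
proof -
  obtain K where "compact K" "\<And>x. x \<notin> K \<Longrightarrow> f x = 0"
    using Cc_support[OF assms(1)] by blast
  then show ?thesis
    using assms by (intro CcI[of _ K] continuous_on_compose2[OF assms(2) Cc_continuous[OF assms(1)]]) auto
qed

lemma Cc_cnj: "f \<in> Cc euclidean \<Longrightarrow> (\<lambda>x. cnj (f x)) \<in> Cc euclidean"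
  by (rule Cc_compose) (auto intro: continuous_intros)

lemma Cc_bounded:
  assumes "f \<in> Cc euclidean"
  obtains B where "B > 0" "\<And>x. cmod (f x) \<le> B"
proof -
  obtain K where K: "compact K" "\<And>x. x \<notin> K \<Longrightarrow> f x = 0"
    using Cc_support[OF assms] by blast
  have "bounded (f ` K)"
    using K(1) Cc_continuous[OF assms] by (intro compact_imp_bounded compact_continuous_image) (auto intro: continuous_on_subset)
  then obtain B where B: "B > 0" "\<And>x. x \<in> K \<Longrightarrow> cmod (f x) \<le> B"
    by (auto simp: bounded_pos)
  then have "cmod (f x) \<le> B" for x
    using K(2) by (cases "x \<in> K") auto
  with B(1) show ?thesis
    by (rule that)
qed

text \<open>
  Urysohn's lemma yields a function \<open>f\<close> with values in \<open>[0, 1]\<close>, zero on \<open>K\<close> and one off a relatively compact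
  neighbourhood inside \<open>V\<close>. Truncating it at \<open>1 / 2\<close> makes the bump vanish off the set where
  \<open>f \<le> 1 / 2\<close>, which is closed and thus a compact subset of \<open>V\<close>.
\<close>

lemma compact_bump:
  fixes K V :: "'a::t2_space set"
  assumes lc: "locally_compact_space (euclidean :: 'a topology)"
    and "compact K" "open V" "K \<subseteq> V"
  obtains g :: "'a \<Rightarrow> real" and C where "continuous_on UNIV g" "\<And>x. 0 \<le> g x" "\<And>x. g x \<le> 1"
    "\<And>x. x \<in> K \<Longrightarrow> g x = 1" "compact C" "C \<subseteq> V" "\<And>x. x \<notin> C \<Longrightarrow> g x = 0"
proof -
  have Hausdorff: "Hausdorff_space (euclidean :: 'a topology)"
    by (auto simp: Hausdorff_space_def disjnt_def separation_t2)
  obtain U L where UL: "open U" "compact L" "K \<subseteq> U" "U \<subseteq> L"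
    using locally_compact_space_compact_closed_compact[of "euclidean :: 'a topology"] lc Hausdorff \<open>compact K\<close>
    by auto
  have cr: "completely_regular_space (euclidean :: 'a topology)"
    using locally_compact_regular_imp_completely_regular_space[OF lc] Hausdorff by blast
  have "closedin euclidean (- (U \<inter> V))" "compactin euclidean K" "disjnt (- (U \<inter> V)) K"
    using \<open>open U\<close> \<open>open V\<close> \<open>compact K\<close> \<open>K \<subseteq> V\<close> \<open>K \<subseteq> U\<close> by (auto simp: disjnt_def closed_Compl)
  then obtain f :: "'a \<Rightarrow> real" where
    f: "continuous_map euclidean (top_of_set {0..1}) f" "f ` K \<subseteq> {0}" "f ` (- (U \<inter> V)) \<subseteq> {1}"
    by (rule Urysohn_completely_regular_closed_compact[of 0 1, OF zero_le_one cr])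
  then have cont: "continuous_on UNIV f" and range: "\<And>x. 0 \<le> f x \<and> f x \<le> 1"
    by (auto simp: continuous_map_in_subtopology)
  let ?g = "\<lambda>x. max 0 (1 - 2 * f x)" and ?C = "{x. f x \<le> 1 / 2}"
  have C: "closed ?C"
    by (intro closed_Collect_le cont continuous_on_const)
  moreover have "?C \<subseteq> U \<inter> V"
    using f(3) by force
  ultimately have "compact ?C"
    using UL compact_Int_closed[of L ?C] by (metis Int_absorb1 Int_subset_iff order_trans)
  then show ?thesis
    using \<open>?C \<subseteq> U \<inter> V\<close> f(2) range
    by (intro that[of ?g ?C]) (auto intro!: continuous_intros cont)
qed

text \<open>
  The tube lemma for curried functions.
\<close>

lemma continuous_uniform_on_compact:
  fixes k :: "'a::topological_space \<Rightarrow> 'b::topological_space \<Rightarrow> 'c::metric_space"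
  assumes "continuous_on UNIV (\<lambda>(s, t). k s t)" "compact C" "e > 0"
  shows "\<exists>X. x \<in> X \<and> open X \<and> (\<forall>s\<in>X. \<forall>t\<in>C. dist (k s t) (k x t) \<le> e)"
proof (rule continuous_on_prod_compactE[OF continuous_on_subset[OF assms(1)] assms(2) _ assms(3), of UNIV x])
  fix X assume "x \<in> X" "open X"
    "\<forall>s\<in>X \<inter> UNIV. \<forall>t\<in>C. dist (case (s, t) of (s, t) \<Rightarrow> k s t) (case (x, t) of (s, t) \<Rightarrow> k s t) \<le> e"
  then show ?thesis
    by auto
qed auto

section \<open>Positive functionals and their supports\<close>

locale positive_functional =
  fixes \<nu> :: "('a::t2_space \<Rightarrow> complex) \<Rightarrow> complex"
  assumes lc: "locally_compact_space (euclidean :: 'a topology)"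
    and lin: "\<And>f g a b. f \<in> Cc euclidean \<Longrightarrow> g \<in> Cc euclidean \<Longrightarrow>
          \<nu> (\<lambda>x. a * f x + b * g x) = a * \<nu> f + b * \<nu> g"
    and nonneg: "\<And>f. f \<in> Cc euclidean \<Longrightarrow> (\<And>y. f y \<in> \<real>\<^sub>\<ge>\<^sub>0) \<Longrightarrow> \<nu> f \<in> \<real>\<^sub>\<ge>\<^sub>0"
begin

lemma zero: "\<nu> (\<lambda>x. 0) = 0"
  using lin[OF Cc_zero Cc_zero, of 0 0] by simp

lemma add: "f \<in> Cc euclidean \<Longrightarrow> g \<in> Cc euclidean \<Longrightarrow> \<nu> (\<lambda>x. f x + g x) = \<nu> f + \<nu> g"
  using lin[of f g 1 1] by simp

lemma diff: "f \<in> Cc euclidean \<Longrightarrow> g \<in> Cc euclidean \<Longrightarrow> \<nu> (\<lambda>x. f x - g x) = \<nu> f - \<nu> g"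
  using lin[of f g 1 "-1"] by simp

lemma cmult: "f \<in> Cc euclidean \<Longrightarrow> \<nu> (\<lambda>x. a * f x) = a * \<nu> f"
  using lin[of f f a 0] by simp

lemma sum:
  "finite I \<Longrightarrow> (\<And>i. i \<in> I \<Longrightarrow> f i \<in> Cc euclidean) \<Longrightarrow> \<nu> (\<lambda>x. \<Sum>i\<in>I. f i x) = (\<Sum>i\<in>I. \<nu> (f i))"
  by (induction I rule: finite_induct) (auto simp: zero add Cc_sum)

lemma nonneg_of_real:
  assumes "(\<lambda>x. complex_of_real (g x)) \<in> Cc euclidean" "\<And>x. 0 \<le> g x"
  shows "Re (\<nu> (\<lambda>x. complex_of_real (g x))) \<ge> 0" "Im (\<nu> (\<lambda>x. complex_of_real (g x))) = 0"
  using nonneg[OF assms(1)] assms(2) by (auto simp: complex_nonneg_Reals_iff)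

text \<open>
  The modulus of \<open>\<nu> f\<close> is the value of \<open>\<nu>\<close> at the real part of \<open>c f\<close>, for a suitable \<open>c\<close> of modulus one; and on
  real functions \<open>\<nu>\<close> is monotone.
\<close>

lemma dominated:
  assumes f: "f \<in> Cc euclidean" and g: "(\<lambda>x. complex_of_real (g x)) \<in> Cc euclidean"
    and le: "\<And>x. cmod (f x) \<le> g x"
  shows "cmod (\<nu> f) \<le> Re (\<nu> (\<lambda>x. complex_of_real (g x)))"
proof -
  let ?g = "\<lambda>x. complex_of_real (g x)"
  have real: "Im (\<nu> (\<lambda>x. complex_of_real (h x))) = 0 \<and> Re (\<nu> (\<lambda>x. complex_of_real (h x))) \<le> Re (\<nu> ?g)"
    if h: "(\<lambda>x. complex_of_real (h x)) \<in> Cc euclidean" and "\<And>x. \<bar>h x\<bar> \<le> g x" for h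
  proof -
    have hg: "- h x \<le> g x" "h x \<le> g x" for x
      using that(2)[of x] by auto
    have "\<nu> (\<lambda>x. ?g x - complex_of_real (h x)) \<in> \<real>\<^sub>\<ge>\<^sub>0"
      by (rule nonneg[OF Cc_diff[OF g h]]) (use hg in \<open>simp add: complex_nonneg_Reals_iff\<close>)
    moreover have "\<nu> (\<lambda>x. ?g x + complex_of_real (h x)) \<in> \<real>\<^sub>\<ge>\<^sub>0"
    proof (rule nonneg[OF Cc_add[OF g h]])
      show "?g x + complex_of_real (h x) \<in> \<real>\<^sub>\<ge>\<^sub>0" for x
        using hg(1)[of x] by (simp add: complex_nonneg_Reals_iff)
    qed
    ultimately show ?thesis
      by (simp add: diff add g h complex_nonneg_Reals_iff)
  qed
  obtain c where c: "cmod c = 1" "c * \<nu> f = complex_of_real (cmod (\<nu> f))"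
  proof (cases "\<nu> f = 0")
    case True
    then show ?thesis
      using that[of 1] by simp
  next
    case False
    then have "(cnj (\<nu> f) / cmod (\<nu> f)) * \<nu> f = complex_of_real (cmod (\<nu> f))"
      using complex_norm_square[of "\<nu> f"] by (simp add: field_simps power2_eq_square)
    then show ?thesis
      using False by (intro that[of "cnj (\<nu> f) / cmod (\<nu> f)"]) (simp_all add: norm_divide)
  qed
  let ?R = "\<lambda>x. Re (c * f x)" and ?I = "\<lambda>x. Im (c * f x)"
  have cf: "(\<lambda>x. c * f x) \<in> Cc euclidean"
    by (rule Cc_cmult[OF f])
  have RI: "(\<lambda>x. complex_of_real (?R x)) \<in> Cc euclidean" "(\<lambda>x. complex_of_real (?I x)) \<in> Cc euclidean"
    by (rule Cc_compose[OF cf]; auto intro: continuous_intros)+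
  have "\<nu> (\<lambda>x. c * f x) = \<nu> (\<lambda>x. complex_of_real (?R x)) + \<i> * \<nu> (\<lambda>x. complex_of_real (?I x))"
  proof -
    have "(\<lambda>x. c * f x) = (\<lambda>x. 1 * complex_of_real (?R x) + \<i> * complex_of_real (?I x))"
      by (rule ext) (simp add: complex_eq_iff)
    then show ?thesis
      using lin[OF RI, of 1 \<i>] by simp
  qed
  moreover have "\<bar>?R x\<bar> \<le> g x" "\<bar>?I x\<bar> \<le> g x" for x
    using le[of x] abs_Re_le_cmod[of "c * f x"] abs_Im_le_cmod[of "c * f x"] c(1)
    by (simp_all only: norm_mult mult_1)
  ultimately show ?thesis
    using real[OF RI(1)] real[OF RI(2)] c(2) cmult[OF f, of c] by (simp add: complex_eq_iff)
qed

lemma real_valued: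
  assumes "(\<lambda>x. complex_of_real (h x)) \<in> Cc euclidean"
  shows "Im (\<nu> (\<lambda>x. complex_of_real (h x))) = 0"
proof -
  have 1: "(\<lambda>x. complex_of_real (max 0 (h x))) \<in> Cc euclidean"
    using Cc_compose[OF assms, of "\<lambda>z. complex_of_real (max 0 (Re z))"] by (simp add: continuous_intros)
  have 2: "(\<lambda>x. complex_of_real (max 0 (- h x))) \<in> Cc euclidean"
    using Cc_compose[OF assms, of "\<lambda>z. complex_of_real (max 0 (- Re z))"] by (simp add: continuous_intros)
  have "(\<lambda>x. complex_of_real (h x)) = (\<lambda>x. complex_of_real (max 0 (h x)) - complex_of_real (max 0 (- h x)))"
    by (auto simp: max_def)
  then show ?thesis
    using diff[OF 1 2] nonneg_of_real(2)[OF 1] nonneg_of_real(2)[OF 2] by simp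
qed

lemma cnj:
  assumes f: "f \<in> Cc euclidean"
  shows "\<nu> (\<lambda>x. cnj (f x)) = cnj (\<nu> f)"
proof -
  let ?R = "\<lambda>x. complex_of_real (Re (f x))" and ?I = "\<lambda>x. complex_of_real (Im (f x))"
  have R: "?R \<in> Cc euclidean" and I: "?I \<in> Cc euclidean"
    by (rule Cc_compose[OF f]; auto intro: continuous_intros)+
  have "f = (\<lambda>x. 1 * ?R x + \<i> * ?I x)" "(\<lambda>x. cnj (f x)) = (\<lambda>x. 1 * ?R x + (- \<i>) * ?I x)"
    by (auto simp: complex_eq_iff)
  then have "\<nu> f = \<nu> ?R + \<i> * \<nu> ?I" "\<nu> (\<lambda>x. cnj (f x)) = \<nu> ?R - \<i> * \<nu> ?I"
    using lin[OF R I, of 1 \<i>] lin[OF R I, of 1 "- \<i>"] by simp_all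
  then show ?thesis
    using real_valued[OF R] real_valued[OF I] by (simp add: complex_eq_iff)
qed

abbreviation support :: "'a set" where
  "support \<equiv> radon_support \<nu>"

text \<open>
  The union of the open null sets is again null. Since only an upper bound is needed, a finite sum
  of bumps that dominates the given function can take the place of a partition of unity.
\<close>

lemma null_majorant:
  assumes "compact C" "C \<inter> support = {}"
  obtains g :: "'a \<Rightarrow> real" where "(\<lambda>x. complex_of_real (g x)) \<in> Cc euclidean" "\<And>x. 0 \<le> g x"
    "\<And>x. x \<in> C \<Longrightarrow> 1 \<le> g x" "\<nu> (\<lambda>x. complex_of_real (g x)) = 0"
proof -
  have "\<exists>g::'a \<Rightarrow> real. (\<lambda>x. complex_of_real (g x)) \<in> Cc euclidean \<and> (\<forall>x. 0 \<le> g x) \<and> g y = 1 \<and>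
      \<nu> (\<lambda>x. complex_of_real (g x)) = 0" if "y \<in> C" for y
  proof -
    have "y \<notin> support"
      using assms(2) that by blast
    then obtain U where U: "open U" "y \<in> U"
      "\<And>f. f \<in> Cc euclidean \<Longrightarrow> closure {x. f x \<noteq> 0} \<subseteq> U \<Longrightarrow> \<nu> f = 0"
      unfolding radon_support_def by blast
    obtain g :: "'a \<Rightarrow> real" and D where g: "continuous_on UNIV g" "\<And>x. 0 \<le> g x" "\<And>x. g x \<le> 1"
      "\<And>x. x \<in> {y} \<Longrightarrow> g x = 1" "compact D" "D \<subseteq> U" "\<And>x. x \<notin> D \<Longrightarrow> g x = 0"
      using compact_bump[OF lc, of "{y}" U] U by (metis compact_sing empty_subsetI insert_subset)
    have Cc: "(\<lambda>x. complex_of_real (g x)) \<in> Cc euclidean"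
      using g by (intro CcI[of _ D] continuous_intros) auto
    have "closure {x. complex_of_real (g x) \<noteq> 0} \<subseteq> D"
      using g by (intro closure_minimal compact_imp_closed) auto
    with Cc g U(3) show ?thesis
      by (intro exI[of _ g]) auto
  qed
  then obtain h :: "'a \<Rightarrow> 'a \<Rightarrow> real" where
    h: "\<And>y. y \<in> C \<Longrightarrow> (\<lambda>x. complex_of_real (h y x)) \<in> Cc euclidean" "\<And>y x. y \<in> C \<Longrightarrow> 0 \<le> h y x"
      "\<And>y. y \<in> C \<Longrightarrow> h y y = 1" "\<And>y. y \<in> C \<Longrightarrow> \<nu> (\<lambda>x. complex_of_real (h y x)) = 0"
    by metis
  have "open {x. h y x > 1 / 2}" if "y \<in> C" for y
    using continuous_on_Re[OF Cc_continuous[OF h(1)[OF that]]]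
    by (intro open_Collect_less) (auto intro: continuous_intros)
  moreover have "C \<subseteq> (\<Union>y\<in>C. {x. h y x > 1 / 2})"
    using h(3) by fastforce
  ultimately obtain I where I: "I \<subseteq> C" "finite I" "C \<subseteq> (\<Union>y\<in>I. {x. h y x > 1 / 2})"
    using compactE_image[OF assms(1), of C "\<lambda>y. {x. h y x > 1 / 2}"] by blast
  define g where "g x = (\<Sum>y\<in>I. 2 * h y x)" for x
  have Cc: "(\<lambda>x. 2 * complex_of_real (h y x)) \<in> Cc euclidean" if "y \<in> I" for y
    using that I h by (intro Cc_cmult) auto
  show ?thesis
  proof (rule that[of g])
    have g: "(\<lambda>x. complex_of_real (g x)) = (\<lambda>x. \<Sum>y\<in>I. 2 * complex_of_real (h y x))"
      by (simp add: g_def)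
    show "(\<lambda>x. complex_of_real (g x)) \<in> Cc euclidean"
      unfolding g by (intro Cc_sum I Cc)
    show "0 \<le> g x" for x
      unfolding g_def using h I by (intro sum_nonneg) auto
    show "1 \<le> g x" if x: "x \<in> C" for x
    proof -
      obtain y where y: "y \<in> I" "h y x > 1 / 2"
        using x I by blast
      have "2 * h y x \<le> g x"
        unfolding g_def using h I y by (intro member_le_sum) auto
      with y show ?thesis
        by simp
    qed
    have "\<nu> (\<lambda>x. 2 * complex_of_real (h y x)) = 0" if "y \<in> I" for y
      using that I h cmult by (metis mult_zero_right subsetD)
    then show "\<nu> (\<lambda>x. complex_of_real (g x)) = 0"
      unfolding g using sum[OF I(2) Cc] by simp
  qed
qed

text \<open>
  The part of \<open>f\<close> that is not small lives on a compact set disjoint from the support, where it is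
  dominated by a function of integral zero.
\<close>

lemma bound_near_support:
  assumes f: "f \<in> Cc euclidean" and "\<And>x. x \<in> support \<Longrightarrow> cmod (f x) < e" and "e > 0"
    and k: "(\<lambda>x. complex_of_real (k x)) \<in> Cc euclidean" "\<And>x. 0 \<le> k x" "\<And>x. f x \<noteq> 0 \<Longrightarrow> 1 \<le> k x"
  shows "cmod (\<nu> f) \<le> e * Re (\<nu> (\<lambda>x. complex_of_real (k x)))"
proof -
  obtain K where K: "compact K" "\<And>x. x \<notin> K \<Longrightarrow> f x = 0"
    using Cc_support[OF f] by blast
  obtain B where B: "B > 0" "\<And>x. cmod (f x) \<le> B"
    using Cc_bounded[OF f] by blast
  let ?C = "K \<inter> {x. e \<le> cmod (f x)}"
  have "closed {x. e \<le> cmod (f x)}"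
    by (intro closed_Collect_le continuous_intros Cc_continuous f)
  then have "compact ?C"
    using K(1) by (rule compact_Int_closed[rotated])
  moreover have "?C \<inter> support = {}"
    using assms(2) by force
  ultimately obtain g where g: "(\<lambda>x. complex_of_real (g x)) \<in> Cc euclidean" "\<And>x. 0 \<le> g x"
    "\<And>x. x \<in> ?C \<Longrightarrow> 1 \<le> g x" "\<nu> (\<lambda>x. complex_of_real (g x)) = 0"
    by (rule null_majorant) blast
  have "cmod (f x) \<le> e * k x + B * g x" for x
  proof (cases "e \<le> cmod (f x)")
    case True
    then have "x \<in> ?C"
      using K(2)[of x] \<open>e > 0\<close> by fastforce
    then have "B \<le> B * g x"
      using g(3) B(1) by simp
    then show ?thesis
      using B(2)[of x] mult_nonneg_nonneg[OF less_imp_le[OF \<open>e > 0\<close>] k(2)[of x]] by linarith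
  next
    case False
    have "0 \<le> B * g x" "0 \<le> e * k x"
      using B g k \<open>e > 0\<close> by simp_all
    moreover have "e \<le> e * k x" if "f x \<noteq> 0"
      using k(3)[OF that] \<open>e > 0\<close> by simp
    ultimately show ?thesis
      using False by (cases "f x = 0") (simp, linarith)
  qed
  moreover have eq: "(\<lambda>x. complex_of_real (e * k x + B * g x))
      = (\<lambda>x. complex_of_real e * complex_of_real (k x) + complex_of_real B * complex_of_real (g x))"
    by simp
  moreover have "\<dots> \<in> Cc euclidean"
    by (intro Cc_lincomb k g)
  ultimately have "cmod (\<nu> f) \<le> Re (\<nu> (\<lambda>x. complex_of_real (e * k x + B * g x)))"
    by (intro dominated f) auto
  also have "\<dots> = e * Re (\<nu> (\<lambda>x. complex_of_real (k x)))"
    unfolding eq lin[OF k(1) g(1)] by (simp add: g(4))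
  finally show ?thesis .
qed

lemma cutoff:
  assumes "compact (K :: 'a set)"
  obtains k :: "'a \<Rightarrow> real" where "(\<lambda>x. complex_of_real (k x)) \<in> Cc euclidean" "\<And>x. 0 \<le> k x"
    "\<And>x. x \<in> K \<Longrightarrow> k x = 1"
proof -
  obtain k :: "'a \<Rightarrow> real" and C where "continuous_on UNIV k" "\<And>x. 0 \<le> k x"
    "\<And>x. x \<in> K \<Longrightarrow> k x = 1" "compact C" "\<And>x. x \<notin> C \<Longrightarrow> k x = 0"
    using compact_bump[OF lc assms open_UNIV subset_UNIV] by metis
  then show ?thesis
    by (intro that[of k] CcI[of _ C] continuous_intros) auto
qed

lemma vanishes_off_support:
  assumes f: "f \<in> Cc euclidean" and "\<And>x. x \<in> support \<Longrightarrow> f x = 0"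
  shows "\<nu> f = 0"
proof -
  obtain K where K: "compact K" "\<And>x. x \<notin> K \<Longrightarrow> f x = 0"
    using Cc_support[OF f] by blast
  obtain k where k: "(\<lambda>x. complex_of_real (k x)) \<in> Cc euclidean" "\<And>x. 0 \<le> k x"
    "\<And>x. x \<in> K \<Longrightarrow> k x = 1"
    using cutoff[OF K(1)] by metis
  have le: "cmod (\<nu> f) \<le> e * Re (\<nu> (\<lambda>x. complex_of_real (k x)))" if "e > 0" for e
    using assms that K k by (intro bound_near_support) (auto, metis order_refl)
  have "((\<lambda>e. e * Re (\<nu> (\<lambda>x. complex_of_real (k x)))) \<longlongrightarrow> 0 * Re (\<nu> (\<lambda>x. complex_of_real (k x)))) (at_right 0)"
    by (intro tendsto_intros)
  then have "cmod (\<nu> f) \<le> 0 * Re (\<nu> (\<lambda>x. complex_of_real (k x)))"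
    by (rule tendsto_lowerbound) (auto simp: eventually_at_right_less intro!: eventually_mono[OF eventually_at_right_less] le)
  then show ?thesis
    by simp
qed

lemma cong_support:
  assumes "f \<in> Cc euclidean" "g \<in> Cc euclidean" "\<And>x. x \<in> support \<Longrightarrow> f x = g x"
  shows "\<nu> f = \<nu> g"
  using vanishes_off_support[OF Cc_diff[OF assms(1,2)]] assms by (simp add: diff)

text \<open>
  Near \<open>y\<close> the function \<open>f\<close> is bounded below, so it dominates a multiple of any function supported there;
  and some such function has non-zero integral because \<open>y\<close> belongs to the support.
\<close>

lemma positive_on_support:
  assumes f: "f \<in> Cc euclidean" "\<And>x. f x \<in> \<real>\<^sub>\<ge>\<^sub>0" and y: "y \<in> support" "f y \<noteq> 0"
  shows "\<nu> f \<noteq> 0"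
proof -
  have nn: "0 \<le> Re (f x)" "f x = complex_of_real (Re (f x))" for x
    using f(2)[of x] by (auto simp: complex_nonneg_Reals_iff complex_eq_iff)
  define c where "c = Re (f y) / 2"
  have "c > 0"
    using nn[of y] y(2) by (metis c_def half_gt_zero less_eq_real_def of_real_0)
  let ?U = "{x. Re (f x) > c}"
  have "open ?U"
    by (intro open_Collect_less continuous_intros Cc_continuous f)
  moreover have "y \<in> ?U"
    using \<open>c > 0\<close> by (simp add: c_def)
  ultimately obtain h where h: "h \<in> Cc euclidean" "closure {x. h x \<noteq> 0} \<subseteq> ?U" "\<nu> h \<noteq> 0"
    using y(1) unfolding radon_support_def by blast
  obtain B where B: "B > 0" "\<And>x. cmod (h x) \<le> B"
    using Cc_bounded[OF h(1)] by blast
  have le: "cmod (h x) \<le> B / c * Re (f x)" for x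
  proof (cases "h x = 0")
    case False
    then have "x \<in> ?U"
      using h(2) closure_subset[of "{x. h x \<noteq> 0}"] by blast
    then have "B / c * c \<le> B / c * Re (f x)"
      using B \<open>c > 0\<close> by (intro mult_left_mono) auto
    then show ?thesis
      using B(2)[of x] \<open>c > 0\<close> by simp
  qed (use nn B \<open>c > 0\<close> in simp)
  have eq: "(\<lambda>x. complex_of_real (B / c * Re (f x))) = (\<lambda>x. complex_of_real (B / c) * f x)"
    using nn(2) by (metis of_real_mult)
  have "cmod (\<nu> h) \<le> Re (\<nu> (\<lambda>x. complex_of_real (B / c) * f x))"
    using dominated[OF h(1), of "\<lambda>x. B / c * Re (f x)"] le Cc_cmult[OF f(1)] unfolding eq by blast
  then show ?thesis
    using h(3) by (auto simp only: cmult[OF f(1)] mult_zero_right zero_complex.sel norm_le_zero_iff)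
qed

end

text \<open>
  The constant function 1 need not be compactly supported, so total mass one is expressed by means of
  cutoff functions.
\<close>

locale probability_functional = positive_functional +
  assumes compact_support: "compact support"
    and mass: "\<And>k. k \<in> Cc euclidean \<Longrightarrow> (\<And>x. x \<in> support \<Longrightarrow> k x = 1) \<Longrightarrow> \<nu> k = 1"
begin

lemma const_on_support:
  assumes "f \<in> Cc euclidean" "\<And>x. x \<in> support \<Longrightarrow> f x = c"
  shows "\<nu> f = c"
proof -
  obtain k :: "'a \<Rightarrow> real" where k: "(\<lambda>x. complex_of_real (k x)) \<in> Cc euclidean" "\<And>x. 0 \<le> k x"
    "\<And>x. x \<in> support \<Longrightarrow> k x = 1"
    using cutoff[OF compact_support] by metis
  have "\<nu> f = \<nu> (\<lambda>x. c * complex_of_real (k x))"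
    by (rule cong_support[OF assms(1) Cc_cmult[OF k(1)]]) (simp add: assms(2) k(3))
  then show ?thesis
    using mass[OF k(1)] k by (simp add: cmult)
qed

text \<open>
  Only the size of \<open>f\<close> on the support matters: if \<open>\<bar>f\<bar> < e'\<close> there, then up to a null function \<open>f\<close> is
  dominated by \<open>e'\<close> times a cutoff function of integral one.
\<close>

lemma bound:
  assumes f: "f \<in> Cc euclidean" and le: "\<And>x. x \<in> support \<Longrightarrow> cmod (f x) \<le> e" and "0 \<le> e"
  shows "cmod (\<nu> f) \<le> e"
proof (rule dense_ge)
  fix e' assume "e < e'"
  obtain K where K: "compact K" "\<And>x. x \<notin> K \<Longrightarrow> f x = 0"
    using Cc_support[OF f] by blast
  obtain k where k: "(\<lambda>x. complex_of_real (k x)) \<in> Cc euclidean" "\<And>x. 0 \<le> k x"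
    "\<And>x. x \<in> K \<union> support \<Longrightarrow> k x = 1"
    using cutoff[OF compact_Un[OF K(1) compact_support]] by metis
  have "cmod (\<nu> f) \<le> e' * Re (\<nu> (\<lambda>x. complex_of_real (k x)))"
  proof (rule bound_near_support[OF f _ _ k(1,2)])
    show "cmod (f x) < e'" if "x \<in> support" for x
      using le[OF that] \<open>e < e'\<close> by simp
    show "1 \<le> k x" if "f x \<noteq> 0" for x
      using k(3)[of x] K(2)[of x] that by fastforce
  qed (use \<open>0 \<le> e\<close> \<open>e < e'\<close> in simp)
  also have "\<nu> (\<lambda>x. complex_of_real (k x)) = 1"
    using k by (intro mass) auto
  finally show "cmod (\<nu> f) \<le> e'"
    by simp
qed

text \<open>
  An average of functions \<open>k s\<close> is a uniform limit of convex combinations of them. Here a partition of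
  unity \<open>\<phi>\<close> on the support is needed; dividing by the maximum of 1 and the sum of the bumps keeps the
  quotients continuous everywhere.
\<close>

lemma convex_approximation:
  fixes k :: "'a \<Rightarrow> 'b::topological_space \<Rightarrow> complex"
  assumes cont: "continuous_on UNIV (\<lambda>(s, t). k s t)" and Cc: "\<And>t. (\<lambda>s. k s t) \<in> Cc euclidean"
    and C: "compact C" and "e > 0"
  obtains I :: "'a set" and c :: "'a \<Rightarrow> real" where "finite I" "I \<subseteq> support" "\<And>i. i \<in> I \<Longrightarrow> 0 \<le> c i" "(\<Sum>i\<in>I. c i) = 1"
    "\<And>t. t \<in> C \<Longrightarrow> cmod (\<nu> (\<lambda>s. k s t) - (\<Sum>i\<in>I. complex_of_real (c i) * k i t)) \<le> e"
proof -
  have "\<exists>g::'a \<Rightarrow> real. continuous_on UNIV g \<and> (\<lambda>x. complex_of_real (g x)) \<in> Cc euclidean \<and> (\<forall>x. 0 \<le> g x) \<and> g y = 1 \<and>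
      (\<forall>s. g s \<noteq> 0 \<longrightarrow> (\<forall>t\<in>C. cmod (k s t - k y t) \<le> e))" for y
  proof -
    obtain X where X: "y \<in> X" "open X" "\<forall>s\<in>X. \<forall>t\<in>C. dist (k s t) (k y t) \<le> e"
      using continuous_uniform_on_compact[OF cont C \<open>e > 0\<close>] by blast
    obtain g :: "'a \<Rightarrow> real" and D where g: "continuous_on UNIV g" "\<And>x. 0 \<le> g x" "\<And>x. g x \<le> 1"
      "\<And>x. x \<in> {y} \<Longrightarrow> g x = 1" "compact D" "D \<subseteq> X" "\<And>x. x \<notin> D \<Longrightarrow> g x = 0"
      using compact_bump[OF lc, of "{y}" X] X by (metis compact_sing empty_subsetI insert_subset)
    moreover have "(\<lambda>x. complex_of_real (g x)) \<in> Cc euclidean"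
      using g by (intro CcI[of _ D] continuous_intros) auto
    moreover have "\<forall>t\<in>C. cmod (k s t - k y t) \<le> e" if "g s \<noteq> 0" for s
    proof -
      have "s \<in> X"
        using that g(6,7) by blast
      with X(3) show ?thesis
        by (simp add: dist_norm)
    qed
    ultimately show ?thesis
      by (intro exI[of _ g]) auto
  qed
  then obtain h :: "'a \<Rightarrow> 'a \<Rightarrow> real" where
    h: "\<And>y. continuous_on UNIV (h y)" "\<And>y. (\<lambda>x. complex_of_real (h y x)) \<in> Cc euclidean" "\<And>y x. 0 \<le> h y x"
      "\<And>y. h y y = 1" "\<And>y s t. h y s \<noteq> 0 \<Longrightarrow> t \<in> C \<Longrightarrow> cmod (k s t - k y t) \<le> e"
    by metis
  have op: "open {x. h y x > 1 / 2}" if "y \<in> support" for y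
    by (intro open_Collect_less continuous_intros h)
  have cover: "support \<subseteq> (\<Union>y\<in>support. {x. h y x > 1 / 2})"
    by (rule subsetI, rule UN_I) (assumption, simp add: h(4))
  obtain I where I: "I \<subseteq> support" "finite I" "support \<subseteq> (\<Union>y\<in>I. {x. h y x > 1 / 2})"
    by (rule compactE_image[OF compact_support, of support "\<lambda>y. {x. h y x > 1 / 2}", OF op cover])
  define G where "G x = (\<Sum>y\<in>I. 2 * h y x)" for x
  define \<phi> where "\<phi> y x = 2 * h y x / max 1 (G x)" for y x
  have G1: "1 \<le> G x" if x: "x \<in> support" for x
  proof -
    obtain y where y: "y \<in> I" "h y x > 1 / 2"
      using x I by blast
    have "2 * h y x \<le> G x"
      unfolding G_def using h I y by (intro member_le_sum) auto
    with y show ?thesis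
      by simp
  qed
  have contG: "continuous_on UNIV G"
    unfolding G_def by (intro continuous_intros h)
  have \<phi>_Cc: "(\<lambda>x. complex_of_real (\<phi> y x)) \<in> Cc euclidean" for y
  proof -
    have "(\<lambda>x. complex_of_real (h y x) * complex_of_real (2 / max 1 (G x))) \<in> Cc euclidean"
      by (intro Cc_mult_continuous h continuous_intros contG) auto
    then show ?thesis
      by (simp add: \<phi>_def mult.commute)
  qed
  have \<phi>_nonneg: "0 \<le> \<phi> y x" for y x
    using h(3) by (simp add: \<phi>_def)
  have \<phi>_sum: "(\<Sum>y\<in>I. \<phi> y x) = 1" if "x \<in> support" for x
  proof -
    have "(\<Sum>y\<in>I. \<phi> y x) = G x / max 1 (G x)"
      by (simp add: \<phi>_def G_def sum_divide_distrib)
    then show ?thesis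
      using G1[OF that] by simp
  qed
  define c where "c y = Re (\<nu> (\<lambda>x. complex_of_real (\<phi> y x)))" for y
  have c: "\<nu> (\<lambda>x. complex_of_real (\<phi> y x)) = complex_of_real (c y)" "0 \<le> c y" for y
    using nonneg_of_real[OF \<phi>_Cc \<phi>_nonneg, of y] by (auto simp: c_def complex_eq_iff)
  show ?thesis
  proof (rule that[of I c])
    have "complex_of_real (\<Sum>i\<in>I. c i) = \<nu> (\<lambda>x. \<Sum>i\<in>I. complex_of_real (\<phi> i x))"
      by (simp add: sum[OF I(2) \<phi>_Cc] c)
    also have "\<dots> = 1"
    proof (rule mass[OF Cc_sum[OF I(2) \<phi>_Cc]])
      show "(\<Sum>i\<in>I. complex_of_real (\<phi> i x)) = 1" if "x \<in> support" for x
        using \<phi>_sum[OF that] by (metis of_real_1 of_real_sum)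
    qed
    finally show "(\<Sum>i\<in>I. c i) = 1"
      using of_real_eq_1_iff by blast
    fix t assume "t \<in> C"
    let ?d = "\<lambda>s. k s t - (\<Sum>i\<in>I. k i t * complex_of_real (\<phi> i s))"
    have sum_Cc: "(\<lambda>s. \<Sum>i\<in>I. k i t * complex_of_real (\<phi> i s)) \<in> Cc euclidean"
      by (intro Cc_sum I Cc_cmult \<phi>_Cc)
    have "\<nu> ?d = \<nu> (\<lambda>s. k s t) - (\<Sum>i\<in>I. complex_of_real (c i) * k i t)"
      using diff[OF Cc sum_Cc] sum[OF I(2) Cc_cmult[OF \<phi>_Cc], of "\<lambda>i. k i t"]
      by (simp add: cmult[OF \<phi>_Cc] c mult.commute)
    moreover have "cmod (\<nu> ?d) \<le> e"
    proof (rule bound[OF Cc_diff[OF Cc sum_Cc]])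
      fix s assume s: "s \<in> support"
      have "(\<Sum>i\<in>I. complex_of_real (\<phi> i s)) = 1"
        using \<phi>_sum[OF s] by (metis of_real_1 of_real_sum)
      then have "(\<Sum>i\<in>I. complex_of_real (\<phi> i s) * k s t) = k s t"
        by (simp flip: sum_distrib_right)
      then have "?d s = (\<Sum>i\<in>I. complex_of_real (\<phi> i s) * (k s t - k i t))"
        by (simp add: sum_subtractf right_diff_distrib mult.commute)
      also have "cmod \<dots> \<le> (\<Sum>i\<in>I. \<phi> i s * e)"
      proof (rule sum_norm_le)
        fix i
        have "cmod (k s t - k i t) \<le> e" if "\<phi> i s \<noteq> 0"
          using h(5)[of i s t] that \<open>t \<in> C\<close> by (auto simp: \<phi>_def)
        then show "cmod (complex_of_real (\<phi> i s) * (k s t - k i t)) \<le> \<phi> i s * e"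
          using \<phi>_nonneg[of i s] by (cases "\<phi> i s = 0") (auto simp: norm_mult intro: mult_left_mono)
      qed
      also have "\<dots> = e"
        using \<phi>_sum[OF s] by (simp flip: sum_distrib_right)
      finally show "cmod (?d s) \<le> e" .
    qed (use \<open>e > 0\<close> in simp)
    ultimately show "cmod (\<nu> (\<lambda>s. k s t) - (\<Sum>i\<in>I. complex_of_real (c i) * k i t)) \<le> e"
      by simp
  qed (use I c in auto)
qed

end

section \<open>Haar measure\<close>

locale haar_measure =
  fixes \<mu> :: "'a::{topological_group_add,t2_space} measure"
  assumes lc: "locally_compact_space (euclidean :: 'a topology)"
    and haar: "left_haar_measure \<mu>"
begin

lemma sets_haar [measurable_cong]: "sets \<mu> = sets borel"
  using haar by (simp add: left_haar_measure_def radon_measure_def)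

lemma space_haar [simp]: "space \<mu> = UNIV"
  using sets_eq_imp_space_eq[OF sets_haar] by simp

lemma compact_finite_measure: "compact K \<Longrightarrow> emeasure \<mu> K < \<infinity>"
  using haar by (simp add: left_haar_measure_def radon_measure_def)

lemma compact_sets: "compact (K :: 'a set) \<Longrightarrow> K \<in> sets \<mu>"
  by (simp add: sets_haar borel_compact)

lemma haar_image: "A \<in> sets borel \<Longrightarrow> emeasure \<mu> ((+) x ` A) = emeasure \<mu> A"
  using haar by (simp add: left_haar_measure_def)

lemma continuous_translate: "continuous_on A (\<lambda>t. s + t)" "continuous_on A (\<lambda>t. t + s)" for s :: 'a
  by (intro continuous_intros)+

lemma vimage_translate: "(+) s -` A = (+) (- s) ` A" for s :: 'a
proof
  show "(+) s -` A \<subseteq> (+) (- s) ` A"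
  proof
    fix x assume "x \<in> (+) s -` A"
    then show "x \<in> (+) (- s) ` A"
      by (intro image_eqI[of _ _ "s + x"]) (auto simp flip: add.assoc)
  qed
qed (auto simp flip: add.assoc)

lemma distr_translate: "distr \<mu> \<mu> ((+) s) = \<mu>"
proof (rule measure_eqI)
  have meas: "(+) s \<in> measurable \<mu> \<mu>"
    by (simp add: measurable_cong_sets[OF sets_haar sets_haar] borel_measurable_continuous_onI continuous_translate)
  fix A assume "A \<in> sets (distr \<mu> \<mu> ((+) s))"
  then have A: "A \<in> sets \<mu>"
    by simp
  show "emeasure (distr \<mu> \<mu> ((+) s)) A = emeasure \<mu> A"
    using A haar_image[of A "- s"] by (simp add: emeasure_distr[OF meas] sets_haar vimage_translate)
qed simp

lemma L2_norm_translate: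
  assumes "f \<in> borel_measurable \<mu>"
  shows "L2_norm \<mu> (\<lambda>t. f (s + t)) = L2_norm \<mu> f"
proof -
  have [measurable]: "f \<in> borel_measurable \<mu>"
    by fact
  have meas: "(+) s \<in> measurable \<mu> \<mu>"
    by (simp add: measurable_cong_sets[OF sets_haar sets_haar] borel_measurable_continuous_onI continuous_translate)
  have "(\<integral>t. (cmod (f (s + t)))\<^sup>2 \<partial>\<mu>) = (\<integral>t. (cmod (f t))\<^sup>2 \<partial>distr \<mu> \<mu> ((+) s))"
    by (rule integral_distr[symmetric]) (use meas in auto)
  then show ?thesis
    by (simp add: distr_translate L2_norm_def)
qed

lemma Cc_measurable: "f \<in> Cc euclidean \<Longrightarrow> f \<in> borel_measurable \<mu>"
  by (simp add: measurable_cong_sets[OF sets_haar refl] borel_measurable_continuous_onI Cc_continuous)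

lemma Cc_integrable:
  assumes f: "f \<in> Cc euclidean"
  shows "integrable \<mu> f"
proof -
  obtain K where K: "compact K" "\<And>x. x \<notin> K \<Longrightarrow> f x = 0"
    using Cc_support[OF f] by blast
  obtain B where B: "B > 0" "\<And>x. cmod (f x) \<le> B"
    using Cc_bounded[OF f] by blast
  have "integrable \<mu> (\<lambda>x. B * indicator K x)"
    using compact_finite_measure[OF K(1)] compact_sets[OF K(1)] by (intro integrable_mult_right) auto
  then show ?thesis
  proof (rule Bochner_Integration.integrable_bound[OF _ Cc_measurable[OF f]], intro AE_I2)
    show "norm (f x) \<le> norm (B * indicator K x)" for x
      using B K(2)[of x] by (cases "x \<in> K") auto
  qed
qed

lemma Cc_L2:
  assumes f: "f \<in> Cc euclidean"
  shows "f \<in> L2 \<mu>"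
proof -
  have "integrable \<mu> (\<lambda>x. complex_of_real ((cmod (f x))\<^sup>2))"
    unfolding complex_norm_square by (intro Cc_integrable Cc_mult Cc_cnj f)
  then have "integrable \<mu> (\<lambda>x. (cmod (f x))\<^sup>2)"
    using complex_of_real_integrable_eq by blast
  then show ?thesis
    by (simp add: L2_def Cc_measurable[OF f])
qed

text \<open>
  Finitely many translates of \<open>U\<close> cover any given compact set, so all compact sets would be null if \<open>U\<close>
  were; by inner regularity the whole group would be null.
\<close>

lemma open_positive_measure:
  assumes "open U" "U \<noteq> {}"
  shows "emeasure \<mu> U \<noteq> 0"
proof
  assume "emeasure \<mu> U = 0"
  obtain u where u: "u \<in> U"
    using assms by blast
  have null: "(\<lambda>t. s + t) -` U \<in> null_sets \<mu>" for s
  proof -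
    have "open ((\<lambda>t. s + t) -` U)"
      by (intro open_vimage assms continuous_translate)
    then have "(\<lambda>t. s + t) -` U \<in> sets \<mu>"
      by (simp add: sets_haar)
    moreover have "emeasure \<mu> ((\<lambda>t. s + t) -` U) = 0"
      using haar_image[of U "- s"] assms(1) \<open>emeasure \<mu> U = 0\<close> vimage_translate[of s U] by simp
    ultimately show ?thesis
      by (simp add: null_setsI)
  qed
  have "emeasure \<mu> K = 0" if K: "compact K" for K
  proof -
    have "K \<subseteq> (\<Union>x\<in>K. (\<lambda>t. (u - x) + t) -` U)"
      using u by auto
    then obtain I where I: "I \<subseteq> K" "finite I" "K \<subseteq> (\<Union>x\<in>I. (\<lambda>t. (u - x) + t) -` U)"
      using compactE_image[OF K, of K "\<lambda>x. (\<lambda>t. (u - x) + t) -` U"] open_vimage[OF assms(1) continuous_translate(1)]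
      by metis
    have "(\<Union>x\<in>I. (\<lambda>t. (u - x) + t) -` U) \<in> null_sets \<mu>"
      using I(2) null by (intro null_sets_UN') (auto simp: countable_finite)
    then have "K \<in> null_sets \<mu>"
      by (rule null_sets_subset) (use I(3) compact_sets[OF K] in auto)
    then show ?thesis
      by auto
  qed
  then have "(SUP K \<in> {K. compact K \<and> K \<subseteq> (UNIV :: 'a set)}. emeasure \<mu> K) \<le> 0"
    by (intro SUP_least) simp
  moreover have "emeasure \<mu> UNIV = (SUP K \<in> {K. compact K \<and> K \<subseteq> UNIV}. emeasure \<mu> K)"
    using haar open_UNIV unfolding left_haar_measure_def radon_measure_def by blast
  ultimately have "emeasure \<mu> UNIV \<le> 0"
    by simp
  then show False
    using haar by (simp add: left_haar_measure_def)
qed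

lemma Cc_integral_positive:
  assumes f: "f \<in> Cc euclidean" and nonneg: "\<And>x. f x \<in> \<real>\<^sub>\<ge>\<^sub>0" and x: "f x \<noteq> 0"
  shows "(\<integral>x. f x \<partial>\<mu>) \<noteq> 0"
proof
  assume 0: "(\<integral>x. f x \<partial>\<mu>) = 0"
  have "(\<integral>x. Re (f x) \<partial>\<mu>) = 0"
    using integral_Re[OF Cc_integrable[OF f]] 0 by simp
  moreover have "integrable \<mu> (\<lambda>x. Re (f x))"
    by (intro integrable_Re Cc_integrable f)
  moreover have re: "0 \<le> Re (f x)" "f x = complex_of_real (Re (f x))" for x
    using nonneg[of x] by (auto simp: complex_nonneg_Reals_iff complex_eq_iff)
  ultimately have "AE x in \<mu>. Re (f x) = 0"
    by (subst (asm) integral_nonneg_eq_0_iff_AE) auto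
  then have ae: "AE x in \<mu>. x \<notin> {x. Re (f x) > 0}"
    by (rule AE_mp) auto
  have op: "open {x. Re (f x) > 0}"
    by (intro open_Collect_less continuous_intros Cc_continuous f)
  then have "{x. Re (f x) > 0} \<in> sets \<mu>"
    by (simp add: sets_haar)
  then have "emeasure \<mu> {x. Re (f x) > 0} = 0"
    using ae by (subst (asm) AE_iff_measurable[of "{x. Re (f x) > 0}"]) auto
  moreover have "x \<in> {x. Re (f x) > 0}"
    using re[of x] x by (metis less_eq_real_def mem_Collect_eq of_real_0)
  ultimately show False
    using open_positive_measure[OF op] by blast
qed

lemma Cc_right_translate:
  assumes "f \<in> Cc euclidean"
  shows "(\<lambda>s::'a. f (s + t)) \<in> Cc euclidean"
proof -
  obtain K where K: "compact K" "\<And>x. x \<notin> K \<Longrightarrow> f x = 0"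
    using Cc_support[OF assms] by blast
  show ?thesis
  proof (rule CcI)
    show "continuous_on UNIV (\<lambda>s. f (s + t))"
      by (rule continuous_on_compose2[OF Cc_continuous[OF assms]]) (auto intro: continuous_intros)
    show "compact ((\<lambda>s. s + - t) ` K)"
      by (intro compact_continuous_image continuous_translate K)
    show "f (s + t) = 0" if "s \<notin> (\<lambda>s. s + - t) ` K" for s
    proof (rule K(2), rule notI)
      assume "s + t \<in> K"
      then have "(s + t) + - t \<in> (\<lambda>s. s + - t) ` K"
        by (rule imageI)
      with that show False
        by (simp add: add.assoc)
    qed
  qed
qed

lemma Cc_left_translate:
  assumes "f \<in> Cc euclidean"
  shows "(\<lambda>t::'a. f (s + t)) \<in> Cc euclidean"
proof -
  obtain K where K: "compact K" "\<And>x. x \<notin> K \<Longrightarrow> f x = 0"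
    using Cc_support[OF assms] by blast
  show ?thesis
  proof (rule CcI)
    show "continuous_on UNIV (\<lambda>t. f (s + t))"
      by (rule continuous_on_compose2[OF Cc_continuous[OF assms]]) (auto intro: continuous_intros)
    show "compact ((\<lambda>t. - s + t) ` K)"
      by (intro compact_continuous_image continuous_translate K)
    show "f (s + t) = 0" if "t \<notin> (\<lambda>t. - s + t) ` K" for t
    proof (rule K(2), rule notI)
      assume "s + t \<in> K"
      then have "- s + (s + t) \<in> (\<lambda>t. - s + t) ` K"
        by (rule imageI)
      with that show False
        by (simp flip: add.assoc)
    qed
  qed
qed

end

section \<open>Orbits of a spherical projector\<close>

locale lc_spherical_projector = spherical_projector \<mu> \<pi> + haar_measure \<mu>
  for \<mu> :: "'a::{topological_group_add,t2_space} measure"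
    and \<pi> :: "('a \<Rightarrow> complex) \<Rightarrow> 'a \<Rightarrow> complex"
begin

sublocale nu: positive_functional "pi_star \<pi> x" for x
proof
  show "locally_compact_space (euclidean :: 'a topology)"
    by (rule lc)
qed (simp_all add: pi_star_def linear pos)

lemma orbit_compact: "compact (orbit \<pi> x)" and orbit_nonempty: "orbit \<pi> x \<noteq> {}"
proof -
  have "orbit \<pi> x \<in> topspace michael_topology"
    using orbit_cont by (auto simp: continuous_map_def)
  then show "compact (orbit \<pi> x)" "orbit \<pi> x \<noteq> {}"
    by (auto simp: michael_topology_def)
qed

lemma open_orbit_hits_within:
  assumes "open U" "open V"
  shows "open {x. orbit \<pi> x \<inter> U \<noteq> {} \<and> orbit \<pi> x \<subseteq> V}"
proof -
  have "openin michael_topology {K. compact K \<and> K \<noteq> {} \<and> K \<inter> U \<noteq> {} \<and> K \<subseteq> V}"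
    unfolding michael_topology_def by (rule topology_generated_by_Basis) (use assms in blast)
  then have "openin euclidean {x \<in> topspace euclidean. orbit \<pi> x \<in> {K. compact K \<and> K \<noteq> {} \<and> K \<inter> U \<noteq> {} \<and> K \<subseteq> V}}"
    by (rule openin_continuous_map_preimage[OF orbit_cont])
  then show ?thesis
    by (simp add: orbit_compact orbit_nonempty)
qed

lemma open_orbit_hits: "open U \<Longrightarrow> open {x. orbit \<pi> x \<inter> U \<noteq> {}}"
  using open_orbit_hits_within[of U UNIV] by simp

lemma open_orbit_within: "open V \<Longrightarrow> open {x. orbit \<pi> x \<subseteq> V}"
  using open_orbit_hits_within[of UNIV V] by (simp add: orbit_nonempty)

lemma pi_nonzero:
  assumes "f \<in> Cc euclidean" "\<And>z. f z \<in> \<real>\<^sub>\<ge>\<^sub>0" "y \<in> orbit \<pi> x" "f y \<noteq> 0"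
  shows "\<pi> f x \<noteq> 0"
  using nu.positive_on_support[of f y x] assms by (simp add: pi_star_def orbit_def)

lemma pi_cong_orbit:
  assumes "f \<in> Cc euclidean" "g \<in> Cc euclidean" "\<And>z. z \<in> orbit \<pi> x \<Longrightarrow> f z = g z"
  shows "\<pi> f x = \<pi> g x"
  using nu.cong_support[of f g x] assms by (simp add: pi_star_def orbit_def)

lemma bump_at:
  fixes y :: 'a
  assumes "open V" "y \<in> V"
  obtains g :: "'a \<Rightarrow> complex" where "g \<in> Cc euclidean" "\<And>z. g z \<in> \<real>\<^sub>\<ge>\<^sub>0" "g y = 1" "\<And>z. z \<notin> V \<Longrightarrow> g z = 0"
proof -
  obtain g :: "'a \<Rightarrow> real" and C where g: "continuous_on UNIV g" "\<And>x. 0 \<le> g x" "\<And>x. g x \<le> 1"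
    "\<And>x. x \<in> {y} \<Longrightarrow> g x = 1" "compact C" "C \<subseteq> V" "\<And>x. x \<notin> C \<Longrightarrow> g x = 0"
    using compact_bump[OF lc, of "{y}" V] assms by (metis compact_sing empty_subsetI insert_subset)
  have "(\<lambda>x. complex_of_real (g x)) \<in> Cc euclidean"
    using g by (intro CcI[of _ C] continuous_intros) auto
  then show ?thesis
    using g by (intro that[of "\<lambda>x. complex_of_real (g x)"]) auto
qed

text \<open>
  By the averaging identity the variance of \<open>\<pi> f\<close> with respect to \<open>\<pi>\<^sup>*(\<delta>\<^sub>x)\<close> vanishes, so \<open>\<pi> f\<close> is constant on
  the support of this measure.
\<close>

lemma pi_const_on_orbit:
  assumes f: "f \<in> Cc euclidean" and y: "y \<in> orbit \<pi> x"
  shows "\<pi> f y = \<pi> f x"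
proof (rule ccontr)
  assume ne: "\<pi> f y \<noteq> \<pi> f x"
  obtain b where b: "b \<in> Cc euclidean" "\<And>z. b z \<in> \<real>\<^sub>\<ge>\<^sub>0" "b y = 1"
    using bump_at[OF open_UNIV, of y] by auto
  define d where "d z = \<pi> f z - \<pi> f x" for z
  define h where "h z = b z * cnj (d z)" for z
  have pf: "\<pi> f \<in> Cc euclidean"
    by (rule maps_Cc[OF f])
  have contd: "continuous_on UNIV d"
    unfolding d_def by (intro continuous_intros Cc_continuous pf)
  have h: "h \<in> Cc euclidean"
    unfolding h_def by (intro Cc_mult_continuous b continuous_intros contd)
  have fh: "(\<lambda>z. \<pi> f z * h z) \<in> Cc euclidean"
    by (rule Cc_mult[OF pf h])
  have dh: "(\<lambda>z. d z * h z) = (\<lambda>z. 1 * (\<pi> f z * h z) + (- \<pi> f x) * h z)"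
    by (simp add: d_def algebra_simps)
  have "\<pi> (\<lambda>z. d z * h z) x = 0"
    unfolding dh linear[OF fh h] averaging[OF f h] by simp
  moreover have "\<pi> (\<lambda>z. d z * h z) x \<noteq> 0"
  proof (rule pi_nonzero[OF _ _ y])
    show "(\<lambda>z. d z * h z) \<in> Cc euclidean"
      unfolding dh by (rule Cc_lincomb[OF fh h])
    have eq: "d z * h z = complex_of_real ((cmod (d z))\<^sup>2) * b z" for z
      by (simp only: h_def complex_norm_square mult_ac)
    show "d z * h z \<in> \<real>\<^sub>\<ge>\<^sub>0" for z
      unfolding eq by (intro nonneg_Reals_mult_I b) auto
    show "d y * h y \<noteq> 0"
      using ne b(3) by (simp add: h_def d_def)
  qed
  ultimately show False
    by contradiction
qed

text \<open>
  By idempotence the average of \<open>\<pi> g\<close> over the orbit of \<open>x\<close> is \<open>\<pi> g x\<close>, which is also the constant value of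
  \<open>\<pi> g\<close> on this orbit; so averaging preserves constants.
\<close>

lemma pi_mass:
  assumes k: "k \<in> Cc euclidean" "\<And>z. z \<in> orbit \<pi> x \<Longrightarrow> k z = 1"
  shows "\<pi> k x = 1"
proof -
  obtain y where y: "y \<in> orbit \<pi> x"
    using orbit_nonempty by blast
  obtain g where g: "g \<in> Cc euclidean" "\<And>z. g z \<in> \<real>\<^sub>\<ge>\<^sub>0" "g y = 1"
    using bump_at[OF open_UNIV, of y] by auto
  have ne: "\<pi> g x \<noteq> 0"
    using g y by (intro pi_nonzero) auto
  have "\<pi> g x = \<pi> (\<pi> g) x"
    by (simp add: idem g)
  also have "\<dots> = \<pi> (\<lambda>z. \<pi> g x * k z) x"
    using k pi_const_on_orbit[OF g(1)] by (intro pi_cong_orbit maps_Cc Cc_cmult g) auto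
  also have "\<dots> = \<pi> g x * \<pi> k x"
    using nu.cmult[OF k(1), of x "\<pi> g x"] by (simp add: pi_star_def)
  finally show ?thesis
    using ne by simp
qed

sublocale nu: probability_functional "pi_star \<pi> x" for x
proof
  show "compact (radon_support (pi_star \<pi> x))"
    using orbit_compact[of x] by (simp add: orbit_def)
  show "pi_star \<pi> x k = 1" if "k \<in> Cc euclidean" "\<And>z. z \<in> radon_support (pi_star \<pi> x) \<Longrightarrow> k z = 1" for k
    using pi_mass[of k x] that by (simp add: pi_star_def orbit_def)
qed

lemma pi_const:
  assumes "f \<in> Cc euclidean" "\<And>z. z \<in> orbit \<pi> x \<Longrightarrow> f z = c"
  shows "\<pi> f x = c"
  using nu.const_on_support[of f x c] assms by (simp add: pi_star_def orbit_def)

lemma pi_bound: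
  assumes "f \<in> Cc euclidean" "\<And>z. z \<in> orbit \<pi> x \<Longrightarrow> cmod (f z) \<le> e" "0 \<le> e"
  shows "cmod (\<pi> f x) \<le> e"
  using nu.bound[of f x e] assms by (simp add: pi_star_def orbit_def)

lemma pi_eq_0: "f \<in> Cc euclidean \<Longrightarrow> (\<And>z. z \<in> orbit \<pi> x \<Longrightarrow> f z = 0) \<Longrightarrow> \<pi> f x = 0"
  by (rule pi_const)

lemma pi_cnj: "f \<in> Cc euclidean \<Longrightarrow> \<pi> (\<lambda>z. cnj (f z)) x = cnj (\<pi> f x)"
  using nu.cnj[of f x] by (simp add: pi_star_def)

lemma pi_diff:
  "f \<in> Cc euclidean \<Longrightarrow> g \<in> Cc euclidean \<Longrightarrow> \<pi> (\<lambda>z. f z - g z) x = \<pi> f x - \<pi> g x"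
  using nu.diff[of f g x] by (simp add: pi_star_def)

text \<open>
  Suppose that \<open>x\<close> does not lie in its orbit. By continuity there is a neighbourhood \<open>U\<close> of \<open>x\<close> such that
  the orbits of its points miss \<open>U\<close>. A bump \<open>f\<close> inside \<open>U\<close> has \<open>\<integral> \<pi> f * g = \<integral> f * \<pi> g \<noteq> 0\<close> for suitable \<open>g\<close>, so
  \<open>\<pi> f w \<noteq> 0\<close> for some \<open>w\<close>, and the orbit of \<open>w\<close> contains some \<open>z\<close> in \<open>U\<close>. But \<open>\<pi> f z = \<pi> f w\<close>, whereas \<open>\<pi> f\<close>
  vanishes on \<open>U\<close>.
\<close>

lemma self_in_orbit: "x \<in> orbit \<pi> x"
proof (rule ccontr)
  assume x: "x \<notin> orbit \<pi> x"
  obtain q :: "'a \<Rightarrow> real" and C where q: "continuous_on UNIV q" "\<And>z. 0 \<le> q z" "\<And>z. q z \<le> 1"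
    "\<And>z. z \<in> orbit \<pi> x \<Longrightarrow> q z = 1" "compact C" "C \<subseteq> - {x}" "\<And>z. z \<notin> C \<Longrightarrow> q z = 0"
    using compact_bump[OF lc orbit_compact, of "- {x}" x] x by (metis (no_types, lifting) ComplI open_Compl closed_singleton singletonD subsetI)
  define V where "V = {z. q z > 1 / 2}"
  define U where "U = {z. q z < 1 / 2} \<inter> {z. orbit \<pi> z \<subseteq> V}"
  have "open V"
    unfolding V_def by (intro open_Collect_less continuous_intros q)
  then have "open U"
    unfolding U_def by (intro open_Int open_orbit_within open_Collect_less continuous_intros q)
  have "q x = 0"
    using q(6,7) by blast
  then have "x \<in> U"
    using q(4) by (auto simp: U_def V_def)
  have UV: "U \<inter> V = {}"
    by (auto simp: U_def V_def)
  obtain f where f: "f \<in> Cc euclidean" "\<And>z. f z \<in> \<real>\<^sub>\<ge>\<^sub>0" "f x = 1" "\<And>z. z \<notin> U \<Longrightarrow> f z = 0"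
    using bump_at[OF \<open>open U\<close> \<open>x \<in> U\<close>] by metis
  obtain y where y: "y \<in> orbit \<pi> x"
    using orbit_nonempty by blast
  obtain g where g: "g \<in> Cc euclidean" "\<And>z. g z \<in> \<real>\<^sub>\<ge>\<^sub>0" "g y = 1"
    using bump_at[OF open_UNIV, of y] by auto
  have "\<pi> g x \<noteq> 0"
    using g y by (intro pi_nonzero) auto
  then have "(\<integral>z. f z * \<pi> g z \<partial>\<mu>) \<noteq> 0"
    using f by (intro Cc_integral_positive[where x = x] Cc_mult maps_Cc g nonneg_Reals_mult_I pos) auto
  then have "(\<integral>z. \<pi> f z * g z \<partial>\<mu>) \<noteq> 0"
    by (simp add: symmetric f g)
  then obtain w where w: "\<pi> f w \<noteq> 0"
    by (metis (no_types, lifting) Bochner_Integration.integral_cong integral_zero mult_zero_left)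
  then obtain z where z: "z \<in> orbit \<pi> w" "f z \<noteq> 0"
    using pi_eq_0[OF f(1)] by blast
  then have "z \<in> U"
    using f(4) by blast
  then have "\<pi> f z = 0"
    using UV f(4) by (intro pi_eq_0 f) (auto simp: U_def)
  then show False
    using w pi_const_on_orbit[OF f(1) z(1)] by simp
qed

lemma mem_orbit_iff: "y \<in> orbit \<pi> x \<longleftrightarrow> orbit \<pi> y = orbit \<pi> x"
  using orbit_partition[of y x] self_in_orbit[of y] by auto

lemma pi_radial: "f \<in> Cc euclidean \<Longrightarrow> orbit \<pi> x = orbit \<pi> y \<Longrightarrow> \<pi> f x = \<pi> f y"
  by (rule pi_const_on_orbit) (simp_all add: mem_orbit_iff)

lemma pi_fixes_radial:
  assumes "f \<in> Cc euclidean" "\<And>x y. orbit \<pi> x = orbit \<pi> y \<Longrightarrow> f x = f y"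
  shows "\<pi> f = f"
proof (rule ext, rule pi_const[OF assms(1)])
  show "f z = f x" if "z \<in> orbit \<pi> x" for x z
    using assms(2)[of z x] that by (simp add: mem_orbit_iff)
qed

lemma orbit_uminus_cong: "orbit \<pi> x = orbit \<pi> y \<Longrightarrow> orbit \<pi> (- x) = orbit \<pi> (- y)"
  using orbit_uminus[of x y] by (simp add: mem_orbit_iff)

lemma orbit_add_zero_right:
  assumes "k \<in> orbit \<pi> 0"
  shows "orbit \<pi> (x + k) = orbit \<pi> x"
proof -
  have "orbit \<pi> (- x + (x + k)) = orbit \<pi> 0"
    using assms by (simp add: mem_orbit_iff flip: add.assoc)
  from orbit_add[OF this] show ?thesis
    by simp
qed

section \<open>Averages of translates\<close>

text \<open>The average of the left translates of \<open>f\<close> over the orbit of \<open>x\<close>.\<close>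

definition orbit_average :: "'a \<Rightarrow> ('a \<Rightarrow> complex) \<Rightarrow> 'a \<Rightarrow> complex" where
  "orbit_average x f t = \<pi> (\<lambda>s. f (s + t)) x"

lemma orbit_average_cong: "f \<in> Cc euclidean \<Longrightarrow> orbit \<pi> x = orbit \<pi> y \<Longrightarrow> orbit_average x f = orbit_average y f"
  unfolding orbit_average_def by (intro ext pi_radial Cc_right_translate)

lemma continuous_translates:
  assumes "f \<in> Cc euclidean"
  shows "continuous_on UNIV (\<lambda>(s::'a, t). f (s + t))" "continuous_on UNIV (\<lambda>(t::'a, s). f (s + t))"
  unfolding split_beta
  by (rule continuous_on_compose2[OF Cc_continuous[OF assms]]; auto intro!: continuous_intros)+

text \<open>
  For \<open>t\<close> near \<open>t0\<close> the translates \<open>f (s + t)\<close> and \<open>f (s + t0)\<close> are uniformly close for \<open>s\<close> in a compact set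
  containing all orbits of points near \<open>y0\<close>; and for fixed \<open>t0\<close> the average is \<open>\<pi>\<close> of a fixed function.
\<close>

lemma orbit_average_jointly_continuous:
  assumes f: "f \<in> Cc euclidean"
  shows "continuous_on UNIV (\<lambda>(y, t). orbit_average y f t)"
proof -
  have "((\<lambda>(y, t). orbit_average y f t) \<longlongrightarrow> orbit_average y0 f t0) (at (y0, t0))" for y0 t0
  proof (rule tendstoI)
    fix e :: real assume "e > 0"
    obtain V L where V: "open V" "compact L" "orbit \<pi> y0 \<subseteq> V" "V \<subseteq> L"
    proof -
      obtain g :: "'a \<Rightarrow> real" and C where g: "continuous_on UNIV g" "\<And>z. 0 \<le> g z" "\<And>z. g z \<le> 1"
        "\<And>z. z \<in> orbit \<pi> y0 \<Longrightarrow> g z = 1" "compact C" "C \<subseteq> UNIV" "\<And>z. z \<notin> C \<Longrightarrow> g z = 0"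
        using compact_bump[OF lc orbit_compact open_UNIV subset_UNIV] by metis
      have "open {z. g z > 1 / 2}"
        by (intro open_Collect_less continuous_intros g)
      moreover have "orbit \<pi> y0 \<subseteq> {z. g z > 1 / 2}"
        by (auto simp: g(4))
      moreover have "{z. g z > 1 / 2} \<subseteq> C"
        using g(7) by force
      ultimately show ?thesis
        using that \<open>compact C\<close> by blast
    qed
    have "e / 3 > 0"
      using \<open>e > 0\<close> by simp
    then obtain X where X: "t0 \<in> X" "open X" "\<forall>t\<in>X. \<forall>s\<in>L. dist (f (s + t)) (f (s + t0)) \<le> e / 3"
      using continuous_uniform_on_compact[OF continuous_translates(2)[OF f] V(2)] by blast
    let ?W = "{y. orbit \<pi> y \<subseteq> V} \<inter> {y. dist (orbit_average y f t0) (orbit_average y0 f t0) < e / 3}"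
    have "continuous_on UNIV (\<lambda>y. orbit_average y f t0)"
      unfolding orbit_average_def by (intro Cc_continuous maps_Cc Cc_right_translate f)
    then have "open ?W"
      by (intro open_Int open_orbit_within V open_Collect_less continuous_intros)
    moreover have "y0 \<in> ?W"
      using V \<open>e > 0\<close> by simp
    moreover have "dist (orbit_average y f t) (orbit_average y0 f t0) < e" if "y \<in> ?W" "t \<in> X" for y t
    proof -
      have "cmod (\<pi> (\<lambda>s. f (s + t) - f (s + t0)) y) \<le> e / 3"
      proof (rule pi_bound)
        show "(\<lambda>s. f (s + t) - f (s + t0)) \<in> Cc euclidean"
          by (intro Cc_diff Cc_right_translate f)
        show "cmod (f (s + t) - f (s + t0)) \<le> e / 3" if "s \<in> orbit \<pi> y" for s
          using X(3) \<open>y \<in> ?W\<close> \<open>t \<in> X\<close> that V(4) by (auto simp: dist_norm)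
      qed (use \<open>e > 0\<close> in simp)
      then have "dist (orbit_average y f t) (orbit_average y f t0) \<le> e / 3"
        by (simp add: orbit_average_def dist_norm pi_diff Cc_right_translate f)
      then show ?thesis
        using that(1) dist_triangle[of "orbit_average y f t" "orbit_average y0 f t0" "orbit_average y f t0"] \<open>e > 0\<close>
        by simp
    qed
    ultimately show "\<forall>\<^sub>F p in at (y0, t0). dist (case p of (y, t) \<Rightarrow> orbit_average y f t) (orbit_average y0 f t0) < e"
      using X(1,2) unfolding eventually_at_topological
      by (intro exI[of _ "?W \<times> X"] conjI open_Times) auto
  qed
  then show ?thesis
    by (auto simp: continuous_on_def)
qed

lemma translate_support_compact:
  assumes "compact A" "compact K"
  shows "compact ((\<lambda>(s, k). - s + k :: 'a) ` (A \<times> K))"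
  by (intro compact_continuous_image compact_Times assms) (auto simp: split_beta intro!: continuous_intros)

lemma mem_translate_support: "s \<in> A \<Longrightarrow> s + t \<in> K \<Longrightarrow> (t :: 'a) \<in> (\<lambda>(s, k). - s + k) ` (A \<times> K)"
  by (intro image_eqI[of _ _ "(s, s + t)"]) (auto simp flip: add.assoc)

lemma orbit_average_eq_0:
  "f \<in> Cc euclidean \<Longrightarrow> (\<And>s. s \<in> orbit \<pi> x \<Longrightarrow> f (s + t) = 0) \<Longrightarrow> orbit_average x f t = 0"
  unfolding orbit_average_def by (rule pi_eq_0[OF Cc_right_translate])

lemma orbit_average_Cc:
  assumes f: "f \<in> Cc euclidean"
  shows "orbit_average x f \<in> Cc euclidean"
proof -
  obtain K where K: "compact K" "\<And>x. x \<notin> K \<Longrightarrow> f x = 0"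
    using Cc_support[OF f] by blast
  show ?thesis
  proof (rule CcI[OF _ translate_support_compact[OF orbit_compact K(1)]])
    have "continuous_on UNIV (\<lambda>t::'a. (x, t))"
      by (intro continuous_intros)
    then show "continuous_on UNIV (orbit_average x f)"
      using continuous_on_compose2[OF orbit_average_jointly_continuous[OF f], of UNIV "\<lambda>t. (x, t)"] by simp
    show "orbit_average x f t = 0" if "t \<notin> (\<lambda>(s, k). - s + k) ` (orbit \<pi> x \<times> K)" for t
      by (rule orbit_average_eq_0[OF f], rule K(2), rule notI) (use that mem_translate_support[of _ "orbit \<pi> x" t K] in blast)
  qed
qed

text \<open>
  On a compact set off which everything vanishes, the average is uniformly close to a convex
  combination of left translates of \<open>f\<close>, and left translation preserves the \<open>L\<^sup>2\<close> norm.
\<close>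

lemma orbit_average_contractive:
  assumes f: "f \<in> Cc euclidean"
  shows "L2_norm \<mu> (orbit_average x f) \<le> L2_norm \<mu> f"
proof -
  obtain K where K: "compact K" "\<And>x. x \<notin> K \<Longrightarrow> f x = 0"
    using Cc_support[OF f] by blast
  let ?C = "(\<lambda>(s, k). - s + k) ` (orbit \<pi> x \<times> K)"
  have C: "compact ?C"
    by (rule translate_support_compact[OF orbit_compact K(1)])
  have le: "L2_norm \<mu> (orbit_average x f) \<le> L2_norm \<mu> f + e * sqrt (measure \<mu> ?C)" if e: "e > 0" for e
  proof -
    obtain I c where I: "finite I" "I \<subseteq> orbit \<pi> x" "\<And>i. i \<in> I \<Longrightarrow> 0 \<le> c i" "(\<Sum>i\<in>I. c i) = 1"
      and approx: "\<And>t. t \<in> ?C \<Longrightarrow> cmod (orbit_average x f t - (\<Sum>i\<in>I. complex_of_real (c i) * f (i + t))) \<le> e"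
    proof (rule nu.convex_approximation[OF continuous_translates(1)[OF f] Cc_right_translate[OF f] C e, of x])
      fix I :: "'a set" and c :: "'a \<Rightarrow> real"
      assume *: "finite I" "I \<subseteq> nu.support x" "\<And>i. i \<in> I \<Longrightarrow> 0 \<le> c i" "(\<Sum>i\<in>I. c i) = 1"
        "\<And>t. t \<in> ?C \<Longrightarrow> cmod (pi_star \<pi> x (\<lambda>s. f (s + t)) - (\<Sum>i\<in>I. complex_of_real (c i) * f (i + t))) \<le> e"
      show thesis
        by (rule that[of I c]; use * in \<open>simp add: orbit_average_def pi_star_def orbit_def\<close>)
    qed
    define q where "q t = (\<Sum>i\<in>I. complex_of_real (c i) * f (i + t))" for t
    have cf: "(\<lambda>t. complex_of_real (c i) * f (i + t)) \<in> L2 \<mu>" for i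
      by (intro Cc_L2 Cc_cmult Cc_left_translate f)
    have q: "q \<in> L2 \<mu>"
      unfolding q_def by (intro L2_sum I cf)
    have P: "orbit_average x f \<in> L2 \<mu>"
      by (intro Cc_L2 orbit_average_Cc f)
    have "L2_norm \<mu> q \<le> (\<Sum>i\<in>I. L2_norm \<mu> (\<lambda>t. complex_of_real (c i) * f (i + t)))"
      unfolding q_def by (intro L2_norm_sum_le I cf)
    also have "\<dots> = (\<Sum>i\<in>I. c i * L2_norm \<mu> f)"
      using I(3) by (intro sum.cong refl) (simp add: L2_norm_cmult L2_norm_translate Cc_measurable f)
    also have "\<dots> = L2_norm \<mu> f"
      using I(4) by (simp flip: sum_distrib_right)
    finally have q_le: "L2_norm \<mu> q \<le> L2_norm \<mu> f" .
    have "(L2_norm \<mu> (\<lambda>t. orbit_average x f t - q t))\<^sup>2 \<le> (\<integral>t. e\<^sup>2 * indicator ?C t \<partial>\<mu>)"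
      unfolding L2_norm_power2
    proof (rule integral_mono)
      show "integrable \<mu> (\<lambda>t. (cmod (orbit_average x f t - q t))\<^sup>2)"
        by (intro L2_integrable L2_diff P q)
      show "integrable \<mu> (\<lambda>t. e\<^sup>2 * indicator ?C t)"
        using compact_finite_measure[OF C] compact_sets[OF C] by (intro integrable_mult_right) auto
      show "(cmod (orbit_average x f t - q t))\<^sup>2 \<le> e\<^sup>2 * indicator ?C t" for t
      proof (cases "t \<in> ?C")
        case True
        then show ?thesis
          using power_mono[OF approx[OF True], of 2] by (simp add: q_def)
      next
        case False
        have "orbit_average x f t = 0"
          by (rule orbit_average_eq_0[OF f], rule K(2), rule notI) (use False mem_translate_support[of _ "orbit \<pi> x" t K] in blast)
        moreover have "f (i + t) = 0" if "i \<in> I" for i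
          using mem_translate_support[of i "orbit \<pi> x" t K] K(2)[of "i + t"] False that I(2) by blast
        ultimately show ?thesis
          by (simp add: q_def)
      qed
    qed
    also have "\<dots> = (e * sqrt (measure \<mu> ?C))\<^sup>2"
      by (simp add: power_mult_distrib)
    finally have "L2_norm \<mu> (\<lambda>t. orbit_average x f t - q t) \<le> e * sqrt (measure \<mu> ?C)"
      by (rule power2_le_imp_le) (use e in simp)
    then show ?thesis
      using L2_norm_le_add_diff[OF P q] q_le by linarith
  qed
  have "((\<lambda>e. L2_norm \<mu> f + e * sqrt (measure \<mu> ?C)) \<longlongrightarrow> L2_norm \<mu> f + 0 * sqrt (measure \<mu> ?C)) (at_right 0)"
    by (intro tendsto_intros)
  then have "L2_norm \<mu> (orbit_average x f) \<le> L2_norm \<mu> f + 0 * sqrt (measure \<mu> ?C)"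
    by (rule tendsto_lowerbound) (auto intro!: eventually_mono[OF eventually_at_right_less] le)
  then show ?thesis
    by simp
qed

text \<open>
  A symmetric idempotent satisfies \<open>\<parallel>\<pi> f\<parallel>\<^sup>2 = \<langle>f, \<pi> f\<rangle>\<close>; the Cauchy-Schwarz inequality finishes the argument.
  Symmetry is stated for the bilinear pairing, so that compatibility of \<open>\<pi>\<close> with complex conjugation
  enters.
\<close>

lemma pi_contractive:
  assumes f: "f \<in> Cc euclidean"
  shows "L2_norm \<mu> (\<pi> f) \<le> L2_norm \<mu> f"
proof -
  note pf = maps_Cc[OF f]
  have "complex_of_real ((L2_norm \<mu> (\<pi> f))\<^sup>2) = L2_inner \<mu> (\<pi> f) (\<pi> f)"
    by (simp only: L2_inner_self)
  also have "\<dots> = (\<integral>x. \<pi> f x * \<pi> (\<lambda>z. cnj (f z)) x \<partial>\<mu>)"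
    by (simp only: L2_inner_def pi_cnj[OF f])
  also have "\<dots> = (\<integral>x. f x * \<pi> (\<pi> (\<lambda>z. cnj (f z))) x \<partial>\<mu>)"
    by (intro symmetric f maps_Cc Cc_cnj)
  also have "\<dots> = L2_inner \<mu> f (\<pi> f)"
    by (simp add: L2_inner_def idem Cc_cnj f pi_cnj)
  finally have "(L2_norm \<mu> (\<pi> f))\<^sup>2 = cmod (L2_inner \<mu> f (\<pi> f))"
    by (metis abs_of_nonneg norm_of_real zero_le_power2)
  also have "\<dots> \<le> L2_norm \<mu> f * L2_norm \<mu> (\<pi> f)"
    by (intro L2_Cauchy_Schwarz Cc_L2 f pf)
  finally have "L2_norm \<mu> (\<pi> f) * L2_norm \<mu> (\<pi> f) \<le> L2_norm \<mu> f * L2_norm \<mu> (\<pi> f)"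
    by (simp add: power2_eq_square)
  then show ?thesis
    using L2_norm_nonneg[of \<mu> f] L2_norm_nonneg[of \<mu> "\<pi> f"]
    by (cases "L2_norm \<mu> (\<pi> f) = 0") (auto simp: mult_le_cancel_right order.strict_iff_order)
qed

end

section \<open>Regularity of Haar measure\<close>

context haar_measure
begin

lemma outer_regular:
  assumes A: "A \<in> sets borel" "emeasure \<mu> A < \<infinity>" and "e > 0"
  obtains U where "open U" "A \<subseteq> U" "emeasure \<mu> U < \<infinity>" "measure \<mu> U < measure \<mu> A + e"
proof -
  have m: "emeasure \<mu> A = ennreal (measure \<mu> A)"
    using A(2) by (intro emeasure_eq_ennreal_measure) auto
  have "(INF U \<in> {U. open U \<and> A \<subseteq> U}. emeasure \<mu> U) = emeasure \<mu> A"
    using haar A(1) by (simp add: left_haar_measure_def radon_measure_def)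
  also have "\<dots> < ennreal (measure \<mu> A + e)"
    using \<open>e > 0\<close> by (simp add: m ennreal_less_iff)
  finally obtain U where U: "open U" "A \<subseteq> U" "emeasure \<mu> U < ennreal (measure \<mu> A + e)"
    by (auto simp: INF_less_iff)
  then have fin: "emeasure \<mu> U < \<infinity>"
    using less_trans[OF U(3) ennreal_less_top] by simp
  then have "emeasure \<mu> U = ennreal (measure \<mu> U)"
    by (intro emeasure_eq_ennreal_measure) auto
  then have "measure \<mu> U < measure \<mu> A + e"
    using U(3) by (simp add: ennreal_less_iff)
  with U fin show ?thesis
    by (intro that)
qed

lemma inner_regular_open:
  assumes U: "open U" "emeasure \<mu> U < \<infinity>" and "e > 0"
  obtains K where "compact K" "K \<subseteq> U" "measure \<mu> U < measure \<mu> K + e"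
proof (cases "measure \<mu> U = 0")
  case True
  then show ?thesis
    using that[of "{}"] \<open>e > 0\<close> by simp
next
  case False
  then have "measure \<mu> U > 0"
    by (simp add: zero_less_measure_iff)
  have m: "emeasure \<mu> U = ennreal (measure \<mu> U)"
    using U(2) by (intro emeasure_eq_ennreal_measure) auto
  have "ennreal (measure \<mu> U - e) < emeasure \<mu> U"
    unfolding m using \<open>e > 0\<close> \<open>measure \<mu> U > 0\<close> by (intro ennreal_lessI) auto
  also have "emeasure \<mu> U = (SUP K \<in> {K. compact K \<and> K \<subseteq> U}. emeasure \<mu> K)"
    using haar U(1) unfolding left_haar_measure_def radon_measure_def by blast
  finally obtain K where K: "compact K" "K \<subseteq> U" "ennreal (measure \<mu> U - e) < emeasure \<mu> K"
    by (auto simp: less_SUP_iff)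
  have "emeasure \<mu> K = ennreal (measure \<mu> K)"
    using compact_finite_measure[OF K(1)] by (intro emeasure_eq_ennreal_measure) auto
  then have "measure \<mu> U - e < measure \<mu> K"
    using K(3) by (metis ennreal_less_iff ennreal_neg linorder_not_le measure_nonneg not_less_zero order_less_le_trans)
  with K show ?thesis
    by (intro that[of K]) auto
qed

text \<open>
  Take an open \<open>U\<close> around \<open>A\<close>, a compact \<open>C\<close> filling most of \<open>U\<close>, and an open \<open>V\<close> of small measure around
  \<open>U - A\<close>. Then \<open>C - V\<close> is a compact subset of \<open>A\<close> of almost full measure.
\<close>

lemma inner_regular:
  assumes A: "A \<in> sets borel" "emeasure \<mu> A < \<infinity>" and "e > 0"
  obtains K where "compact K" "K \<subseteq> A" "measure \<mu> A < measure \<mu> K + e"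
proof -
  have e4: "e / 4 > 0"
    using \<open>e > 0\<close> by simp
  obtain U where U: "open U" "A \<subseteq> U" "emeasure \<mu> U < \<infinity>" "measure \<mu> U < measure \<mu> A + e / 4"
    by (rule outer_regular[OF A e4])
  obtain C where C: "compact C" "C \<subseteq> U" "measure \<mu> U < measure \<mu> C + e / 4"
    by (rule inner_regular_open[OF U(1,3) e4])
  have fmU: "U \<in> fmeasurable \<mu>" and fmA: "A \<in> fmeasurable \<mu>" and fmC: "C \<in> fmeasurable \<mu>"
    using U A compact_finite_measure[OF C(1)] compact_sets[OF C(1)]
    by (auto simp: fmeasurable_def sets_haar)
  have UA: "U - A \<in> sets borel" "emeasure \<mu> (U - A) < \<infinity>"
    using U A fmeasurable_Diff[OF fmU, of A] by (auto simp: fmeasurable_def sets_haar)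
  obtain V where V: "open V" "U - A \<subseteq> V" "emeasure \<mu> V < \<infinity>" "measure \<mu> V < measure \<mu> (U - A) + e / 4"
    by (rule outer_regular[OF UA e4])
  have fmV: "V \<in> fmeasurable \<mu>"
    using V by (auto simp: fmeasurable_def sets_haar)
  have "measure \<mu> (U - A) = measure \<mu> U - measure \<mu> A"
    using U by (intro measurable_measure_Diff fmU) (use fmA in \<open>auto simp: fmeasurable_def\<close>)
  then have mV: "measure \<mu> V < e / 2"
    using V(4) U(4) by simp
  have K: "compact (C - V)"
    using C(1) V(1) by (rule compact_diff)
  have fmK: "C - V \<in> fmeasurable \<mu>"
    using compact_finite_measure[OF K] compact_sets[OF K] by (auto simp: fmeasurable_def)
  have "measure \<mu> C \<le> measure \<mu> ((C - V) \<union> V)"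
    by (rule measure_mono_fmeasurable) (use fmC fmK fmV in \<open>auto intro: fmeasurable.Un simp del: Un_Diff_cancel2\<close>)
  also have "\<dots> \<le> measure \<mu> (C - V) + measure \<mu> V"
    by (rule measure_Un_le) (use fmK fmV in \<open>auto simp: fmeasurable_def\<close>)
  finally have "measure \<mu> C \<le> measure \<mu> (C - V) + measure \<mu> V" .
  moreover have "measure \<mu> A \<le> measure \<mu> U"
    by (rule measure_mono_fmeasurable) (use U fmA fmU in \<open>auto simp: fmeasurable_def\<close>)
  ultimately have "measure \<mu> A < measure \<mu> (C - V) + e"
    using C(3) mV \<open>e > 0\<close> by linarith
  with K show ?thesis
    using C(2) V(2) by (intro that[of "C - V"]) auto
qed

end

section \<open>Functions on the space of orbits\<close>

context lc_spherical_projector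
begin

abbreviation HT :: "'a set topology" where "HT \<equiv> hyp_topology \<pi>"
abbreviation HM :: "'a set measure" where "HM \<equiv> hyp_haar \<mu> \<pi>"

lemma orbit_in_hyp_space [simp]: "orbit \<pi> x \<in> hyp_space \<pi>"
  by (simp add: hyp_space_def)

lemma orbit_hyp_rep: "h \<in> hyp_space \<pi> \<Longrightarrow> orbit \<pi> (hyp_rep \<pi> h) = h"
  unfolding hyp_space_def hyp_rep_def by (rule someI_ex) auto

lemma hyp_inv_orbit: "hyp_inv \<pi> (orbit \<pi> x) = orbit \<pi> (- x)"
  unfolding hyp_inv_def by (intro orbit_uminus_cong orbit_hyp_rep) simp

lemma orbit_vimage_image: "orbit \<pi> -` (orbit \<pi> ` A) = {x. orbit \<pi> x \<inter> A \<noteq> {}}"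
proof -
  have "orbit \<pi> x \<in> orbit \<pi> ` A \<longleftrightarrow> (\<exists>a. a \<in> orbit \<pi> x \<and> a \<in> A)" for x
    unfolding image_iff mem_orbit_iff by metis
  then show ?thesis
    by auto
qed

lemma openin_orbit_image: "open U \<Longrightarrow> openin HT (orbit \<pi> ` U)"
  by (auto simp: openin_hyp_topology orbit_vimage_image open_orbit_hits hyp_space_def)

text \<open>
  The orbits are compact and depend upper semicontinuously on the point, so the union of the orbits
  that meet a compact set is compact. Consequently the orbit map is proper.
\<close>

lemma compact_saturation:
  assumes K: "compact K"
  shows "compact (\<Union>x\<in>K. orbit \<pi> x)"
proof (rule compactI)
  fix \<C> assume op: "\<forall>B\<in>\<C>. open B" and cover: "(\<Union>x\<in>K. orbit \<pi> x) \<subseteq> \<Union>\<C>"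
  have "\<exists>\<D>\<subseteq>\<C>. finite \<D> \<and> orbit \<pi> x \<subseteq> \<Union>\<D>" if "x \<in> K" for x
    using compactE[OF orbit_compact[of x], of \<C>] cover op that by (metis UN_subset_iff)
  then obtain \<D> where \<D>: "\<And>x. x \<in> K \<Longrightarrow> \<D> x \<subseteq> \<C>" "\<And>x. x \<in> K \<Longrightarrow> finite (\<D> x)"
    "\<And>x. x \<in> K \<Longrightarrow> orbit \<pi> x \<subseteq> \<Union>(\<D> x)"
    by metis
  have "open {y. orbit \<pi> y \<subseteq> \<Union>(\<D> x)}" if "x \<in> K" for x
    using op \<D>(1)[OF that] by (intro open_orbit_within open_Union) auto
  moreover have "K \<subseteq> (\<Union>x\<in>K. {y. orbit \<pi> y \<subseteq> \<Union>(\<D> x)})"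
    using \<D>(3) by blast
  ultimately obtain I where I: "I \<subseteq> K" "finite I" "K \<subseteq> (\<Union>x\<in>I. {y. orbit \<pi> y \<subseteq> \<Union>(\<D> x)})"
    using compactE_image[OF K, of K "\<lambda>x. {y. orbit \<pi> y \<subseteq> \<Union>(\<D> x)}"] by metis
  show "\<exists>\<C>'\<subseteq>\<C>. finite \<C>' \<and> (\<Union>x\<in>K. orbit \<pi> x) \<subseteq> \<Union>\<C>'"
  proof (intro exI[of _ "\<Union>x\<in>I. \<D> x"] conjI)
    show "(\<Union>x\<in>I. \<D> x) \<subseteq> \<C>" "finite (\<Union>x\<in>I. \<D> x)"
      using I(1,2) \<D>(1,2) by (blast, auto)
    show "(\<Union>x\<in>K. orbit \<pi> x) \<subseteq> \<Union>(\<Union>x\<in>I. \<D> x)"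
    proof (rule UN_least)
      fix y assume "y \<in> K"
      then obtain x where "x \<in> I" "orbit \<pi> y \<subseteq> \<Union>(\<D> x)"
        using I(3) by blast
      then show "orbit \<pi> y \<subseteq> \<Union>(\<Union>x\<in>I. \<D> x)"
        by blast
    qed
  qed
qed

lemma compactin_pullback:
  assumes D: "compactin HT D"
  obtains K where "compact K" "\<And>x. orbit \<pi> x \<in> D \<Longrightarrow> x \<in> K"
proof -
  have "\<exists>U L. open U \<and> compact L \<and> x \<in> U \<and> U \<subseteq> L" for x :: 'a
    using lc unfolding locally_compact_space_def by auto
  then obtain U L where UL: "\<And>x::'a. open (U x)" "\<And>x. compact (L x)" "\<And>x. x \<in> U x" "\<And>x. U x \<subseteq> L x"
    by metis
  have "D \<subseteq> hyp_space \<pi>"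
    using compactin_subset_topspace[OF D] by (simp add: topspace_hyp_topology)
  then have "D \<subseteq> \<Union>(range (\<lambda>x. orbit \<pi> ` U x))"
    using UL(3) by (fastforce simp: hyp_space_def)
  moreover have "\<And>V. V \<in> range (\<lambda>x. orbit \<pi> ` U x) \<Longrightarrow> openin HT V"
    using openin_orbit_image UL(1) by auto
  ultimately obtain \<F> where \<F>: "finite \<F>" "\<F> \<subseteq> range (\<lambda>x. orbit \<pi> ` U x)" "D \<subseteq> \<Union>\<F>"
    using D unfolding compactin_def by meson
  then obtain I where I: "finite I" "\<F> = (\<lambda>x. orbit \<pi> ` U x) ` I"
    by (metis finite_subset_image subset_UNIV)
  show ?thesis
  proof (rule that)
    show "compact (\<Union>x\<in>(\<Union>i\<in>I. L i). orbit \<pi> x)"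
      by (intro compact_saturation compact_UN I UL)
    fix x assume "orbit \<pi> x \<in> D"
    then obtain i y where "i \<in> I" "y \<in> U i" "orbit \<pi> x = orbit \<pi> y"
      using \<F>(3) I(2) by blast
    then show "x \<in> (\<Union>x\<in>(\<Union>i\<in>I. L i). orbit \<pi> x)"
      using UL(4) self_in_orbit[of x] by blast
  qed
qed

lemma Cc_hyp_iff: "f \<in> Cc HT \<longleftrightarrow> (\<lambda>x. f (orbit \<pi> x)) \<in> Cc euclidean"
proof
  assume f: "f \<in> Cc HT"
  then obtain D where D: "compactin HT D" "\<And>h. h \<in> hyp_space \<pi> \<Longrightarrow> h \<notin> D \<Longrightarrow> f h = 0"
    by (auto simp: Cc_def topspace_hyp_topology)
  obtain K where "compact K" "\<And>x. orbit \<pi> x \<in> D \<Longrightarrow> x \<in> K"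
    using compactin_pullback[OF D(1)] by metis
  moreover have "continuous_map euclidean euclidean (f \<circ> orbit \<pi>)"
    by (rule continuous_map_compose[OF quotient_imp_continuous_map[OF quotient_map_orbit]])
      (use f in \<open>simp add: Cc_def\<close>)
  moreover have "f (orbit \<pi> x) = 0" if "x \<notin> K" for x
    using D(2)[OF orbit_in_hyp_space] that \<open>\<And>x. orbit \<pi> x \<in> D \<Longrightarrow> x \<in> K\<close> by blast
  ultimately show "(\<lambda>x. f (orbit \<pi> x)) \<in> Cc euclidean"
    by (intro CcI[of _ K]) (simp_all add: comp_def)
next
  assume f: "(\<lambda>x. f (orbit \<pi> x)) \<in> Cc euclidean"
  obtain K where K: "compact K" "\<And>x. x \<notin> K \<Longrightarrow> f (orbit \<pi> x) = 0"
    using Cc_support[OF f] by blast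
  have "continuous_map HT euclidean f"
    by (rule continuous_compose_quotient_map[OF quotient_map_orbit])
      (use Cc_continuous[OF f] in \<open>simp add: comp_def\<close>)
  moreover have "compactin HT (orbit \<pi> ` K)"
    using K(1) quotient_imp_continuous_map[OF quotient_map_orbit] by (intro image_compactin[of euclidean]) auto
  moreover have "f h = 0" if "h \<in> hyp_space \<pi>" "h \<notin> orbit \<pi> ` K" for h
    using that K(2) by (auto simp: hyp_space_def)
  ultimately show "f \<in> Cc HT"
    by (auto simp: Cc_def topspace_hyp_topology)
qed

lemma Cc_hyp_lincomb: "f \<in> Cc HT \<Longrightarrow> g \<in> Cc HT \<Longrightarrow> (\<lambda>h. a * f h + b * g h) \<in> Cc HT"
  unfolding Cc_hyp_iff by (rule Cc_lincomb)

text \<open>A radial function on the group, read as a function on the space of orbits.\<close>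

definition descend :: "('a \<Rightarrow> complex) \<Rightarrow> 'a set \<Rightarrow> complex" where
  "descend F h = F (hyp_rep \<pi> h)"

lemma descend_orbit:
  assumes "\<And>x y. orbit \<pi> x = orbit \<pi> y \<Longrightarrow> F x = F y"
  shows "descend F (orbit \<pi> x) = F x"
  unfolding descend_def by (intro assms orbit_hyp_rep) simp

lemma descend_pi_orbit: "f \<in> Cc euclidean \<Longrightarrow> descend (\<pi> f) (orbit \<pi> x) = \<pi> f x"
  by (rule descend_orbit) (rule pi_radial)

lemma descend_pi_Cc: "f \<in> Cc euclidean \<Longrightarrow> descend (\<pi> f) \<in> Cc HT"
  by (simp add: Cc_hyp_iff descend_pi_orbit maps_Cc)

lemma space_hyp_haar: "space HM = hyp_space \<pi>"
  unfolding hyp_haar_def by (simp add: space_measure_of_conv)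

lemma sets_hyp_haar: "sets HM = sigma_sets (hyp_space \<pi>) {U. openin HT U}"
  unfolding hyp_haar_def
  by (simp add: sets_measure_of_conv) (use openin_subset topspace_hyp_topology in blast)

lemma openin_hyp_sets: "openin HT U \<Longrightarrow> U \<in> sets HM"
  by (simp add: sets_hyp_haar sigma_sets.Basic)

lemma orbit_measurable_sigma: "orbit \<pi> \<in> measurable \<mu> (sigma (hyp_space \<pi>) {U. openin HT U})"
proof (rule measurable_measure_of)
  show "{U. openin HT U} \<subseteq> Pow (hyp_space \<pi>)"
    using openin_subset topspace_hyp_topology by blast
  show "orbit \<pi> -` U \<inter> space \<mu> \<in> sets \<mu>" if "U \<in> {U. openin HT U}" for U
    using that by (simp add: openin_hyp_topology sets_haar)
qed simp

lemma orbit_measurable: "orbit \<pi> \<in> measurable \<mu> HM"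
  using orbit_measurable_sigma unfolding hyp_haar_def by simp

lemma hyp_haar_distr: "HM = distr \<mu> HM (orbit \<pi>)"
  unfolding hyp_haar_def by (simp cong: distr_cong)

lemma pullback_measurable: "f \<in> borel_measurable HM \<Longrightarrow> (\<lambda>x. f (orbit \<pi> x)) \<in> borel_measurable \<mu>"
  using measurable_compose[OF orbit_measurable] .

lemma integral_hyp_haar:
  fixes f :: "'a set \<Rightarrow> 'b::{banach, second_countable_topology}"
  assumes "f \<in> borel_measurable HM"
  shows "(\<integral>h. f h \<partial>HM) = (\<integral>x. f (orbit \<pi> x) \<partial>\<mu>)"
  by (subst hyp_haar_distr, rule integral_distr[OF orbit_measurable assms])

lemma integrable_hyp_haar:
  fixes f :: "'a set \<Rightarrow> 'b::{banach, second_countable_topology}"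
  assumes "f \<in> borel_measurable HM"
  shows "integrable HM f \<longleftrightarrow> integrable \<mu> (\<lambda>x. f (orbit \<pi> x))"
  by (subst hyp_haar_distr, rule integrable_distr_eq[OF orbit_measurable assms])

lemma L2_hyp_iff: "f \<in> borel_measurable HM \<Longrightarrow> f \<in> L2 HM \<longleftrightarrow> (\<lambda>x. f (orbit \<pi> x)) \<in> L2 \<mu>"
  by (simp add: L2_def integrable_hyp_haar pullback_measurable)

lemma L2_norm_hyp: "f \<in> borel_measurable HM \<Longrightarrow> L2_norm HM f = L2_norm \<mu> (\<lambda>x. f (orbit \<pi> x))"
  by (simp add: L2_norm_def integral_hyp_haar)

lemma L2_inner_hyp:
  "f \<in> borel_measurable HM \<Longrightarrow> g \<in> borel_measurable HM \<Longrightarrow>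
    L2_inner HM f g = L2_inner \<mu> (\<lambda>x. f (orbit \<pi> x)) (\<lambda>x. g (orbit \<pi> x))"
  by (simp add: L2_inner_def integral_hyp_haar)

lemma Cc_hyp_measurable:
  assumes "f \<in> Cc HT"
  shows "f \<in> borel_measurable HM"
proof (rule borel_measurableI)
  fix S :: "complex set" assume "open S"
  then have "openin HT {h \<in> topspace HT. f h \<in> S}"
    using assms by (intro openin_continuous_map_preimage[where Y = euclidean]) (auto simp: Cc_def)
  moreover have "{h \<in> topspace HT. f h \<in> S} = f -` S \<inter> space HM"
    by (auto simp: space_hyp_haar topspace_hyp_topology)
  ultimately show "f -` S \<inter> space HM \<in> sets HM"
    using openin_hyp_sets by simp
qed

lemma Cc_hyp_L2: "f \<in> Cc HT \<Longrightarrow> f \<in> L2 HM"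
  by (simp add: L2_hyp_iff Cc_hyp_measurable Cc_L2 Cc_hyp_iff[symmetric])

text \<open>
  If \<open>K \<subseteq> B \<subseteq> V\<close> with \<open>B\<close> saturated, \<open>K\<close> compact and \<open>V\<close> open, then a bump that is 1 on the saturation of \<open>K\<close> and
  vanishes off \<open>V\<close> can be averaged: this does not change the value 1 on \<open>K\<close>, and the \<open>L\<^sup>2\<close> norm does not
  grow. So the average is close to the indicator of \<open>B\<close> as soon as the measures of \<open>K\<close> and \<open>V\<close> are close.
\<close>

lemma Cc_hyp_dense: "L2_dense HM (Cc HT)"
proof (rule L2_dense_indicatorI)
  show "Cc HT \<subseteq> L2 HM"
    using Cc_hyp_L2 by blast
  show "(\<lambda>h. a * f h + b * g h) \<in> Cc HT" if "f \<in> Cc HT" "g \<in> Cc HT" for f g a b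
    by (rule Cc_hyp_lincomb[OF that])
  show "(\<lambda>x. 0) \<in> Cc HT"
    by (simp add: Cc_hyp_iff Cc_zero)
  fix A and e :: real assume A: "A \<in> sets HM" "emeasure HM A < \<infinity>" and "e > 0"
  let ?B = "orbit \<pi> -` A"
  have B: "?B \<in> sets borel"
    using measurable_sets[OF orbit_measurable A(1)] by (simp add: sets_haar)
  have "emeasure \<mu> ?B = emeasure HM A"
    by (subst hyp_haar_distr, subst emeasure_distr[OF orbit_measurable A(1)]) simp
  then have Bfin: "emeasure \<mu> ?B < \<infinity>"
    using A(2) by simp
  define d where "d = e\<^sup>2 / 4"
  have "d > 0"
    using \<open>e > 0\<close> by (simp add: d_def)
  obtain V where V: "open V" "?B \<subseteq> V" "emeasure \<mu> V < \<infinity>" "measure \<mu> V < measure \<mu> ?B + d"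
    using outer_regular[OF B Bfin \<open>d > 0\<close>] by blast
  obtain K where K: "compact K" "K \<subseteq> ?B" "measure \<mu> ?B < measure \<mu> K + d"
    using inner_regular[OF B Bfin \<open>d > 0\<close>] by blast
  let ?S = "\<Union>x\<in>K. orbit \<pi> x"
  have "?S \<subseteq> ?B"
    using K(2) by (auto simp: mem_orbit_iff)
  then have "?S \<subseteq> V"
    using V(2) by blast
  then obtain g :: "'a \<Rightarrow> real" and C where g: "continuous_on UNIV g" "\<And>z. 0 \<le> g z" "\<And>z. g z \<le> 1"
    "\<And>z. z \<in> ?S \<Longrightarrow> g z = 1" "compact C" "C \<subseteq> V" "\<And>z. z \<notin> C \<Longrightarrow> g z = 0"
    using compact_bump[OF lc compact_saturation[OF K(1)] V(1)] by metis
  let ?g = "\<lambda>x. complex_of_real (g x)"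
  have gCc: "?g \<in> Cc euclidean"
    using g by (intro CcI[of _ C] continuous_intros) auto
  have pgCc: "\<pi> ?g \<in> Cc euclidean"
    by (rule maps_Cc[OF gCc])
  have pg_nonneg: "\<pi> ?g x \<in> \<real>\<^sub>\<ge>\<^sub>0" for x
    using g(2) by (intro pos gCc) simp
  have pg_K: "\<pi> ?g x = 1" if "x \<in> K" for x
    using that g(4) by (intro pi_const gCc) auto
  have fmV: "V \<in> sets \<mu>" and fmB: "?B \<in> sets \<mu>" and fmK: "K \<in> sets \<mu>"
    using V B compact_sets[OF K(1)] by (auto simp: sets_haar)
  have indB: "(indicator ?B :: 'a \<Rightarrow> complex) \<in> L2 \<mu>"
  proof -
    have "(\<lambda>x. (cmod (indicator ?B x))\<^sup>2) = (\<lambda>x. indicator ?B x :: real)"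
      by (auto simp: indicator_def)
    then show ?thesis
      using fmB Bfin by (simp add: L2_def del: sets_haar)
  qed
  have norm_g: "(L2_norm \<mu> ?g)\<^sup>2 \<le> measure \<mu> V"
  proof -
    have "(L2_norm \<mu> ?g)\<^sup>2 \<le> (\<integral>x. indicator V x \<partial>\<mu>)"
      unfolding L2_norm_power2
    proof (rule integral_mono)
      show "integrable \<mu> (\<lambda>x. (cmod (?g x))\<^sup>2)"
        by (intro L2_integrable Cc_L2 gCc)
      show "integrable \<mu> (indicator V :: 'a \<Rightarrow> real)"
        using fmV V(3) by simp
      show "(cmod (?g x))\<^sup>2 \<le> indicator V x" for x
        using g(2)[of x] g(3)[of x] g(6) g(7)[of x] by (cases "x \<in> V") (auto simp: power_le_one)
    qed
    then show ?thesis
      by simp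
  qed
  have diff: "(L2_norm \<mu> (\<lambda>x. \<pi> ?g x - indicator ?B x))\<^sup>2 < e\<^sup>2"
  proof -
    have int: "integrable \<mu> (\<lambda>x. (cmod (\<pi> ?g x))\<^sup>2)"
      by (intro L2_integrable Cc_L2 pgCc)
    have intK: "integrable \<mu> (indicator K :: 'a \<Rightarrow> real)" and intB: "integrable \<mu> (indicator ?B :: 'a \<Rightarrow> real)"
      using fmK compact_finite_measure[OF K(1)] fmB Bfin by simp_all
    have "(L2_norm \<mu> (\<lambda>x. \<pi> ?g x - indicator ?B x))\<^sup>2
        \<le> (\<integral>x. ((cmod (\<pi> ?g x))\<^sup>2 + indicator ?B x) - 2 * indicator K x \<partial>\<mu>)"
      unfolding L2_norm_power2
    proof (rule integral_mono)
      show "integrable \<mu> (\<lambda>x. (cmod (\<pi> ?g x - indicator ?B x))\<^sup>2)"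
        by (intro L2_integrable L2_diff Cc_L2 pgCc indB)
      show "integrable \<mu> (\<lambda>x. ((cmod (\<pi> ?g x))\<^sup>2 + indicator ?B x) - 2 * indicator K x :: real)"
        by (intro Bochner_Integration.integrable_diff Bochner_Integration.integrable_add integrable_mult_right int intK intB)
      fix x
      have re: "\<pi> ?g x = complex_of_real (Re (\<pi> ?g x))" "0 \<le> Re (\<pi> ?g x)"
        using pg_nonneg[of x] by (auto simp: complex_nonneg_Reals_iff complex_eq_iff)
      have "(cmod (complex_of_real r - 1))\<^sup>2 \<le> (cmod (complex_of_real r))\<^sup>2 + 1" if "0 \<le> r" for r
      proof -
        have "cmod (complex_of_real r - 1) = \<bar>r - 1\<bar>"
          by (metis norm_of_real of_real_1 of_real_diff)
        then show ?thesis
          using that by (simp add: power2_diff)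
      qed
      from this[OF re(2)] show "(cmod (\<pi> ?g x - indicator ?B x))\<^sup>2
          \<le> ((cmod (\<pi> ?g x))\<^sup>2 + indicator ?B x) - 2 * indicator K x"
        using pg_K[of x] K(2) re(1) by (auto simp: indicator_def)
    qed
    also have "\<dots> = ((L2_norm \<mu> (\<pi> ?g))\<^sup>2 + measure \<mu> ?B) - 2 * measure \<mu> K"
      using int intK intB by (simp add: L2_norm_power2)
    also have "\<dots> \<le> (measure \<mu> V + measure \<mu> ?B) - 2 * measure \<mu> K"
      using order_trans[OF power_mono[OF pi_contractive[OF gCc] L2_norm_nonneg] norm_g] by simp
    also have "\<dots> < 3 * d"
      using V(4) K(3) by linarith
    also have "\<dots> < e\<^sup>2"
      using \<open>e > 0\<close> by (simp add: d_def)
    finally show ?thesis .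
  qed
  have "L2_norm HM (\<lambda>h. descend (\<pi> ?g) h - indicator A h) = L2_norm \<mu> (\<lambda>x. \<pi> ?g x - indicator ?B x)"
  proof -
    have "(\<lambda>h. descend (\<pi> ?g) h - indicator A h) \<in> borel_measurable HM"
      by (intro borel_measurable_diff Cc_hyp_measurable[OF descend_pi_Cc[OF gCc]] borel_measurable_indicator A)
    then show ?thesis
      by (simp add: L2_norm_hyp descend_pi_orbit gCc indicator_def)
  qed
  also have "\<dots> < e"
    by (rule power2_less_imp_less[OF diff]) (use \<open>e > 0\<close> in simp)
  finally show "\<exists>f\<in>Cc HT. L2_norm HM (\<lambda>h. f h - indicator A h) < e"
    using descend_pi_Cc[OF gCc] by blast
qed

section \<open>The left regular representation\<close>

lemma hyp_conv_orbit:
  assumes f: "f \<in> Cc HT"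
  shows "hyp_conv \<pi> (orbit \<pi> x) (orbit \<pi> y) f = \<pi> (orbit_average x (\<lambda>z. f (orbit \<pi> z))) y"
proof -
  let ?F = "\<lambda>z. f (orbit \<pi> z)"
  have F: "?F \<in> Cc euclidean"
    using f by (simp add: Cc_hyp_iff)
  have rep: "orbit \<pi> (hyp_rep \<pi> (orbit \<pi> z)) = orbit \<pi> z" for z
    by (simp add: orbit_hyp_rep)
  have "hyp_conv \<pi> (orbit \<pi> x) (orbit \<pi> y) f
      = \<pi> (orbit_average (hyp_rep \<pi> (orbit \<pi> x)) ?F) (hyp_rep \<pi> (orbit \<pi> y))"
    unfolding hyp_conv_def pi_star_def orbit_average_def ..
  also have "\<dots> = \<pi> (orbit_average x ?F) y"
    using orbit_average_cong[OF F rep] pi_radial[OF orbit_average_Cc[OF F] rep] by simp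
  finally show ?thesis .
qed

definition hyp_translate :: "'a set \<Rightarrow> ('a set \<Rightarrow> complex) \<Rightarrow> 'a set \<Rightarrow> complex" where
  "hyp_translate h f k = hyp_conv \<pi> (hyp_inv \<pi> h) k f"

lemma hyp_translate_orbit:
  "f \<in> Cc HT \<Longrightarrow> hyp_translate (orbit \<pi> x) f (orbit \<pi> y) = \<pi> (orbit_average (- x) (\<lambda>z. f (orbit \<pi> z))) y"
  by (simp add: hyp_translate_def hyp_inv_orbit hyp_conv_orbit)

lemma hyp_translate_Cc:
  assumes "h \<in> hyp_space \<pi>" "f \<in> Cc HT"
  shows "hyp_translate h f \<in> Cc HT"
proof -
  obtain x where x: "h = orbit \<pi> x"
    using assms(1) by (auto simp: hyp_space_def)
  show ?thesis
    using assms(2) maps_Cc[OF orbit_average_Cc] by (simp add: x Cc_hyp_iff hyp_translate_orbit)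
qed

lemma hyp_translate_contractive:
  assumes "h \<in> hyp_space \<pi>" "f \<in> Cc HT"
  shows "L2_norm HM (hyp_translate h f) \<le> L2_norm HM f"
proof -
  obtain x where x: "h = orbit \<pi> x"
    using assms(1) by (auto simp: hyp_space_def)
  let ?F = "\<lambda>z. f (orbit \<pi> z)"
  have F: "?F \<in> Cc euclidean"
    using assms(2) by (simp add: Cc_hyp_iff)
  have "L2_norm HM (hyp_translate h f) = L2_norm \<mu> (\<pi> (orbit_average (- x) ?F))"
    using L2_norm_hyp[OF Cc_hyp_measurable[OF hyp_translate_Cc[OF assms]]] hyp_translate_orbit[OF assms(2)]
    by (simp add: x)
  also have "\<dots> \<le> L2_norm \<mu> (orbit_average (- x) ?F)"
    by (intro pi_contractive orbit_average_Cc F)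
  also have "\<dots> \<le> L2_norm \<mu> ?F"
    by (intro orbit_average_contractive F)
  also have "\<dots> = L2_norm HM f"
    by (simp add: L2_norm_hyp Cc_hyp_measurable assms(2))
  finally show ?thesis .
qed

lemma hyp_translate_linear:
  assumes "h \<in> hyp_space \<pi>" "k \<in> hyp_space \<pi>" and f: "f \<in> Cc HT" and g: "g \<in> Cc HT"
  shows "hyp_translate h (\<lambda>k. a * f k + b * g k) k = a * hyp_translate h f k + b * hyp_translate h g k"
proof -
  obtain x y where xy: "h = orbit \<pi> x" "k = orbit \<pi> y"
    using assms(1,2) by (auto simp: hyp_space_def)
  let ?F = "\<lambda>z. f (orbit \<pi> z)" and ?G = "\<lambda>z. g (orbit \<pi> z)"
  have F: "?F \<in> Cc euclidean" and G: "?G \<in> Cc euclidean"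
    using f g by (simp_all add: Cc_hyp_iff)
  have "orbit_average (- x) (\<lambda>z. a * ?F z + b * ?G z)
      = (\<lambda>t. a * orbit_average (- x) ?F t + b * orbit_average (- x) ?G t)"
    unfolding orbit_average_def by (intro ext) (rule fun_cong[OF linear[OF Cc_right_translate[OF F] Cc_right_translate[OF G]]])
  then show ?thesis
    using f g F G by (simp add: xy hyp_translate_orbit Cc_hyp_lincomb linear orbit_average_Cc)
qed

text \<open>
  The operator \<open>\<lambda>(h)\<close> is defined by a choice; these properties hold because translation of compactly
  supported functions extends from a dense subspace by contractivity.
\<close>

lemma left_regular_props:
  assumes h: "h \<in> hyp_space \<pi>"
  shows "left_regular \<mu> \<pi> h \<in> L2_operators HM"
    and "f \<in> Cc HT \<Longrightarrow> AE k in HM. left_regular \<mu> \<pi> h f k = hyp_translate h f k"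
proof -
  obtain T where T: "T \<in> L2_operators HM" "\<And>f. f \<in> Cc HT \<Longrightarrow> AE k in HM. T f k = hyp_translate h f k"
  proof (rule L2_bounded_extension[OF Cc_hyp_dense, of "hyp_translate h"])
    show "AE k in HM. hyp_translate h (\<lambda>k. a * f k + b * g k) k = a * hyp_translate h f k + b * hyp_translate h g k"
      if "f \<in> Cc HT" "g \<in> Cc HT" for f g a b
      by (intro AE_I2 hyp_translate_linear h that) (simp add: space_hyp_haar)
  qed (auto intro: Cc_hyp_lincomb Cc_hyp_L2 hyp_translate_Cc hyp_translate_contractive h)
  then have "\<exists>T. T \<in> L2_operators HM \<and> (\<forall>f \<in> Cc HT. AE k in HM. T f k = hyp_conv \<pi> (hyp_inv \<pi> h) k f)"
    unfolding hyp_translate_def by blast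
  then have "left_regular \<mu> \<pi> h \<in> L2_operators HM \<and>
      (\<forall>f \<in> Cc HT. AE k in HM. left_regular \<mu> \<pi> h f k = hyp_conv \<pi> (hyp_inv \<pi> h) k f)"
    unfolding left_regular_def by (rule someI_ex)
  then show "left_regular \<mu> \<pi> h \<in> L2_operators HM"
    and "f \<in> Cc HT \<Longrightarrow> AE k in HM. left_regular \<mu> \<pi> h f k = hyp_translate h f k"
    unfolding hyp_translate_def by blast+
qed

lemma left_regular_L2: "h \<in> hyp_space \<pi> \<Longrightarrow> f \<in> L2 HM \<Longrightarrow> left_regular \<mu> \<pi> h f \<in> L2 HM"
  by (rule L2_operator_L2[OF left_regular_props(1)])

lemma left_regular_contractive:
  assumes h: "h \<in> hyp_space \<pi>" and f: "f \<in> L2 HM"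
  shows "L2_norm HM (left_regular \<mu> \<pi> h f) \<le> L2_norm HM f"
proof (rule L2_operator_contractive[OF left_regular_props(1)[OF h] Cc_hyp_dense _ f])
  fix g assume g: "g \<in> Cc HT"
  have "L2_norm HM (left_regular \<mu> \<pi> h g) = L2_norm HM (hyp_translate h g)"
    by (intro L2_norm_cong_AE left_regular_props(2)[OF h g] L2_measurable left_regular_L2[OF h] Cc_hyp_L2 hyp_translate_Cc h g)
  then show "L2_norm HM (left_regular \<mu> \<pi> h g) \<le> L2_norm HM g"
    using hyp_translate_contractive[OF h g] by simp
qed

lemma left_regular_inner_Cc:
  assumes h: "h \<in> hyp_space \<pi>" and f: "f \<in> Cc HT" and g: "g \<in> L2 HM"
  shows "L2_inner HM (left_regular \<mu> \<pi> h f) g = L2_inner HM (hyp_translate h f) g"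
  by (intro L2_inner_cong_AE left_regular_props(2)[OF h f] L2_measurable left_regular_L2[OF h] g Cc_hyp_L2 hyp_translate_Cc h f)

section \<open>Continuity of matrix coefficients\<close>

text \<open>
  By symmetry of \<open>\<pi>\<close> and radiality of \<open>g\<close>, the projection in the formula for \<open>\<lambda>(h) f\<close> can be dropped
  inside the inner product. What remains is the integral over a compact set of a function that is
  jointly continuous in \<open>x\<close> and the variable of integration.
\<close>

lemma hyp_translate_inner_continuous:
  assumes f: "f \<in> Cc HT" and g: "g \<in> Cc HT"
  shows "continuous_on UNIV (\<lambda>x. L2_inner HM (hyp_translate (orbit \<pi> x) f) g)"
proof -
  let ?F = "\<lambda>z. f (orbit \<pi> z)" and ?G = "\<lambda>z. g (orbit \<pi> z)"
  have F: "?F \<in> Cc euclidean" and G: "?G \<in> Cc euclidean"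
    using f g by (simp_all add: Cc_hyp_iff)
  have G': "(\<lambda>z. cnj (?G z)) \<in> Cc euclidean"
    by (rule Cc_cnj[OF G])
  obtain C where C: "compact C" "\<And>x. x \<notin> C \<Longrightarrow> ?G x = 0"
    using Cc_support[OF G] by blast
  let ?k = "\<lambda>y t. orbit_average y ?F t * cnj (?G t)"
  have k: "?k y \<in> Cc euclidean" for y
    by (intro Cc_mult orbit_average_Cc F G')
  have eq: "L2_inner HM (hyp_translate (orbit \<pi> x) f) g = (\<integral>t. ?k (- x) t \<partial>\<mu>)" for x
  proof -
    have "L2_inner HM (hyp_translate (orbit \<pi> x) f) g = (\<integral>t. \<pi> (orbit_average (- x) ?F) t * cnj (?G t) \<partial>\<mu>)"
      using L2_inner_hyp[OF Cc_hyp_measurable[OF hyp_translate_Cc[OF _ f]] Cc_hyp_measurable[OF g], of "orbit \<pi> x"]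
      by (simp add: L2_inner_def hyp_translate_orbit f)
    also have "\<dots> = (\<integral>t. orbit_average (- x) ?F t * \<pi> (\<lambda>z. cnj (?G z)) t \<partial>\<mu>)"
      by (rule symmetric[OF orbit_average_Cc[OF F] G'])
    also have "\<pi> (\<lambda>z. cnj (?G z)) = (\<lambda>z. cnj (?G z))"
      by (rule pi_fixes_radial[OF G']) simp
    finally show ?thesis .
  qed
  have contk: "continuous_on UNIV (\<lambda>(y, t). ?k y t)"
  proof -
    have "continuous_on UNIV (\<lambda>p::'a \<times> 'a. cnj (?G (snd p)))"
      by (rule continuous_on_compose2[OF Cc_continuous[OF G']]) (auto intro: continuous_intros)
    then show ?thesis
      using orbit_average_jointly_continuous[OF F] unfolding split_beta by (intro continuous_on_mult)
  qed
  have "isCont (\<lambda>y. \<integral>t. ?k y t \<partial>\<mu>) y0" for y0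
    unfolding isCont_def
  proof (rule tendstoI)
    fix e :: real assume "e > 0"
    define d where "d = e / (2 * (measure \<mu> C + 1))"
    have "d > 0"
      using \<open>e > 0\<close> by (simp add: d_def add_nonneg_pos)
    obtain X where X: "y0 \<in> X" "open X" "\<forall>y\<in>X. \<forall>t\<in>C. dist (?k y t) (?k y0 t) \<le> d"
      using continuous_uniform_on_compact[OF contk C(1) \<open>d > 0\<close>] by blast
    have "dist (\<integral>t. ?k y t \<partial>\<mu>) (\<integral>t. ?k y0 t \<partial>\<mu>) < e" if "y \<in> X" for y
    proof -
      have "cmod ((\<integral>t. ?k y t \<partial>\<mu>) - (\<integral>t. ?k y0 t \<partial>\<mu>)) = cmod (\<integral>t. ?k y t - ?k y0 t \<partial>\<mu>)"
        by (subst Bochner_Integration.integral_diff[OF Cc_integrable[OF k] Cc_integrable[OF k]]) simp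
      also have "\<dots> \<le> (\<integral>t. cmod (?k y t - ?k y0 t) \<partial>\<mu>)"
        by (rule integral_norm_bound)
      also have "\<dots> \<le> (\<integral>t. d * indicator C t \<partial>\<mu>)"
      proof (rule integral_mono)
        show "integrable \<mu> (\<lambda>t. cmod (?k y t - ?k y0 t))"
          by (intro integrable_norm Cc_integrable Cc_diff k)
        show "integrable \<mu> (\<lambda>t. d * indicator C t)"
          using compact_finite_measure[OF C(1)] compact_sets[OF C(1)] by (intro integrable_mult_right) auto
        show "cmod (?k y t - ?k y0 t) \<le> d * indicator C t" for t
          using X(3) that C(2)[of t] by (cases "t \<in> C") (auto simp: dist_norm)
      qed
      also have "\<dots> = d * measure \<mu> C"
        by simp
      also have "\<dots> \<le> d * (measure \<mu> C + 1)"
        using \<open>d > 0\<close> by simp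
      also have "\<dots> = e / 2"
        using measure_nonneg[of \<mu> C] by (simp add: d_def field_simps add_nonneg_eq_0_iff)
      also have "\<dots> < e"
        using \<open>e > 0\<close> by simp
      finally show ?thesis
        by (simp add: dist_norm)
    qed
    then show "\<forall>\<^sub>F y in at y0. dist (\<integral>t. ?k y t \<partial>\<mu>) (\<integral>t. ?k y0 t \<partial>\<mu>) < e"
      using X(1,2) unfolding eventually_at_topological by blast
  qed
  then have "continuous_on UNIV (\<lambda>y. \<integral>t. ?k y t \<partial>\<mu>)"
    by (simp add: continuous_at_imp_continuous_on)
  then have "continuous_on UNIV (\<lambda>x. \<integral>t. ?k (- x) t \<partial>\<mu>)"
    by (rule continuous_on_compose2) (auto intro: continuous_intros)
  then show ?thesis
    by (simp only: eq)
qed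

lemma left_regular_inner_continuous:
  assumes \<xi>: "\<xi> \<in> L2 HM" and \<eta>: "\<eta> \<in> L2 HM"
  shows "continuous_on UNIV (\<lambda>x. L2_inner HM (left_regular \<mu> \<pi> (orbit \<pi> x) \<xi>) \<eta>)"
proof -
  have approx: "\<exists>c. continuous_on UNIV c \<and>
      (\<forall>x. cmod (c x - L2_inner HM (left_regular \<mu> \<pi> (orbit \<pi> x) \<xi>) \<eta>) < e)" if "e > 0" for e
  proof -
    \<comment> \<open>the error is at most \<open>\<parallel>f\<parallel> d' + d \<parallel>\<eta>\<parallel>\<close>, where \<open>d'\<close> is chosen after \<open>f\<close>; the summands 1 avoid division by zero\<close>
    define d where "d = e / (2 * (L2_norm HM \<eta> + 1))"
    have "d > 0"
      using that by (simp add: d_def add_nonneg_pos)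
    obtain f where f: "f \<in> Cc HT" "L2_norm HM (\<lambda>x. f x - \<xi> x) < d"
      using L2_denseD[OF Cc_hyp_dense \<xi> \<open>d > 0\<close>] by metis
    define d' where "d' = e / (2 * (L2_norm HM f + 1))"
    have "d' > 0"
      using that by (simp add: d'_def add_nonneg_pos)
    obtain g where g: "g \<in> Cc HT" "L2_norm HM (\<lambda>x. g x - \<eta> x) < d'"
      using L2_denseD[OF Cc_hyp_dense \<eta> \<open>d' > 0\<close>] by metis
    note fL = Cc_hyp_L2[OF f(1)] and gL = Cc_hyp_L2[OF g(1)]
    have "cmod (L2_inner HM (hyp_translate (orbit \<pi> x) f) g - L2_inner HM (left_regular \<mu> \<pi> (orbit \<pi> x) \<xi>) \<eta>) < e" for x
    proof -
      let ?T = "left_regular \<mu> \<pi> (orbit \<pi> x)"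
      have T: "?T \<in> L2_operators HM"
        by (rule left_regular_props(1)) simp
      note TL = L2_operator_L2[OF T]
      have eq: "L2_inner HM (hyp_translate (orbit \<pi> x) f) g - L2_inner HM (?T \<xi>) \<eta>
          = L2_inner HM (?T f) (\<lambda>x. g x - \<eta> x) + L2_inner HM (\<lambda>x. ?T f x - ?T \<xi> x) \<eta>"
        using L2_inner_diff_right[OF gL \<eta> TL[OF fL]] L2_inner_diff_left[OF TL[OF fL] TL[OF \<xi>] \<eta>]
          left_regular_inner_Cc[OF _ f(1) gL, of "orbit \<pi> x"] by simp
      have "cmod (L2_inner HM (hyp_translate (orbit \<pi> x) f) g - L2_inner HM (?T \<xi>) \<eta>)
          \<le> L2_norm HM (?T f) * L2_norm HM (\<lambda>x. g x - \<eta> x)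
          + L2_norm HM (\<lambda>x. ?T f x - ?T \<xi> x) * L2_norm HM \<eta>"
        unfolding eq by (intro norm_triangle_le add_mono L2_Cauchy_Schwarz TL[OF fL] L2_diff TL[OF \<xi>] gL \<eta>)
      also have "\<dots> \<le> L2_norm HM f * d' + d * L2_norm HM \<eta>"
      proof (intro add_mono mult_mono)
        show "L2_norm HM (?T f) \<le> L2_norm HM f"
          by (intro left_regular_contractive fL) simp
        show "L2_norm HM (\<lambda>x. ?T f x - ?T \<xi> x) \<le> d"
          using left_regular_contractive[of "orbit \<pi> x", OF _ L2_diff[OF fL \<xi>]] f(2)
          by (simp add: L2_operator_diff_norm[OF T fL \<xi>])
      qed (use g(2) \<open>d > 0\<close> in auto)
      also have "\<dots> < (L2_norm HM f + 1) * d' + d * (L2_norm HM \<eta> + 1)"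
        using \<open>d > 0\<close> \<open>d' > 0\<close> by (simp add: algebra_simps)
      also have "\<dots> = e"
      proof -
        have "L2_norm HM f + 1 \<noteq> 0" "L2_norm HM \<eta> + 1 \<noteq> 0"
          using L2_norm_nonneg[of HM f] L2_norm_nonneg[of HM \<eta>] by linarith+
        moreover have "x * (e / (2 * x)) = e / 2" if "x \<noteq> 0" for x :: real
          using that by simp
        ultimately have "(L2_norm HM f + 1) * d' = e / 2" "(L2_norm HM \<eta> + 1) * d = e / 2"
          unfolding d_def d'_def by blast+
        then show ?thesis
          by (simp only: mult.commute[of d] field_sum_of_halves)
      qed
      finally show ?thesis .
    qed
    then show ?thesis
      using hyp_translate_inner_continuous[OF f(1) g(1)] by (intro exI[of _ "\<lambda>x. L2_inner HM (hyp_translate (orbit \<pi> x) f) g"]) simp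
  qed
  have "\<exists>c. \<forall>n. continuous_on UNIV (c n) \<and>
      (\<forall>x. cmod (c n x - L2_inner HM (left_regular \<mu> \<pi> (orbit \<pi> x) \<xi>) \<eta>) < 1 / real (Suc n))"
    by (intro choice allI approx) simp
  then obtain c where c: "\<And>n. continuous_on UNIV (c n)"
    "\<And>n x. cmod (c n x - L2_inner HM (left_regular \<mu> \<pi> (orbit \<pi> x) \<xi>) \<eta>) < 1 / real (Suc n)"
    by blast
  show ?thesis
  proof (rule uniform_limit_theorem[where f = c and F = sequentially])
    show "uniform_limit UNIV c (\<lambda>x. L2_inner HM (left_regular \<mu> \<pi> (orbit \<pi> x) \<xi>) \<eta>) sequentially"
    proof (rule uniform_limitI)
      fix e :: real assume "e > 0"
      then have "\<forall>\<^sub>F n in sequentially. 1 / real (Suc n) < e"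
        using LIMSEQ_Suc[OF lim_1_over_n] order_tendstoD(2) by blast
      then show "\<forall>\<^sub>F n in sequentially. \<forall>x\<in>UNIV. dist (c n x) (L2_inner HM (left_regular \<mu> \<pi> (orbit \<pi> x) \<xi>) \<eta>) < e"
        by eventually_elim (use c(2) in \<open>auto simp: dist_norm intro: less_trans\<close>)
    qed
  qed (auto intro!: always_eventually c)
qed

text \<open>
  Contractivity of \<open>\<lambda>(h)\<close> makes the series converge uniformly, by the Weierstrass test.
\<close>

lemma left_regular_ultraweak_continuous:
  assumes \<xi>: "\<And>n. \<xi> n \<in> L2 HM" and \<eta>: "\<And>n. \<eta> n \<in> L2 HM"
    and "summable (\<lambda>n. (L2_norm HM (\<xi> n))\<^sup>2)" "summable (\<lambda>n. (L2_norm HM (\<eta> n))\<^sup>2)"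
  shows "continuous_on UNIV (\<lambda>x. \<Sum>n. L2_inner HM (left_regular \<mu> \<pi> (orbit \<pi> x) (\<xi> n)) (\<eta> n))"
proof (rule uniform_limit_theorem)
  show "uniform_limit UNIV (\<lambda>N x. \<Sum>n<N. L2_inner HM (left_regular \<mu> \<pi> (orbit \<pi> x) (\<xi> n)) (\<eta> n))
      (\<lambda>x. \<Sum>n. L2_inner HM (left_regular \<mu> \<pi> (orbit \<pi> x) (\<xi> n)) (\<eta> n)) sequentially"
  proof (rule Weierstrass_m_test)
    show "summable (\<lambda>n. (L2_norm HM (\<xi> n))\<^sup>2 + (L2_norm HM (\<eta> n))\<^sup>2)"
      by (intro summable_add assms)
    fix n x
    have "cmod (L2_inner HM (left_regular \<mu> \<pi> (orbit \<pi> x) (\<xi> n)) (\<eta> n))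
        \<le> L2_norm HM (left_regular \<mu> \<pi> (orbit \<pi> x) (\<xi> n)) * L2_norm HM (\<eta> n)"
      by (rule L2_Cauchy_Schwarz[OF left_regular_L2[OF orbit_in_hyp_space \<xi>] \<eta>])
    also have "\<dots> \<le> L2_norm HM (\<xi> n) * L2_norm HM (\<eta> n)"
      by (intro mult_right_mono left_regular_contractive \<xi>) simp_all
    also have "\<dots> \<le> (L2_norm HM (\<xi> n))\<^sup>2 + (L2_norm HM (\<eta> n))\<^sup>2"
      using sum_squares_bound[of "L2_norm HM (\<xi> n)" "L2_norm HM (\<eta> n)"]
        mult_nonneg_nonneg[OF L2_norm_nonneg[of HM "\<xi> n"] L2_norm_nonneg[of HM "\<eta> n"]] by linarith
    finally show "cmod (L2_inner HM (left_regular \<mu> \<pi> (orbit \<pi> x) (\<xi> n)) (\<eta> n))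
        \<le> (L2_norm HM (\<xi> n))\<^sup>2 + (L2_norm HM (\<eta> n))\<^sup>2" .
  qed
qed (auto intro!: always_eventually continuous_on_sum left_regular_inner_continuous \<xi> \<eta>)

end

section \<open>Bounded operators and ultraweakly continuous functionals\<close>

lemma L2_operators_lincomb:
  assumes T: "T \<in> L2_operators M" and S: "S \<in> L2_operators M"
  shows "(\<lambda>f x. a * T f x + b * S f x) \<in> L2_operators M"
proof -
  let ?R = "\<lambda>f x. a * T f x + b * S f x"
  obtain C where C: "\<And>f. f \<in> L2 M \<Longrightarrow> L2_norm M (T f) \<le> C * L2_norm M f"
    using L2_operator_bounded[OF T] by blast
  obtain D where D: "\<And>f. f \<in> L2 M \<Longrightarrow> L2_norm M (S f) \<le> D * L2_norm M f"
    using L2_operator_bounded[OF S] by blast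
  have "L2_norm M (?R f) \<le> (cmod a * C + cmod b * D) * L2_norm M f" if f: "f \<in> L2 M" for f
  proof -
    have "L2_norm M (?R f) \<le> L2_norm M (\<lambda>x. a * T f x) + L2_norm M (\<lambda>x. b * S f x)"
      by (intro L2_norm_triangle L2_cmult L2_operator_L2[OF T] L2_operator_L2[OF S] f)
    also have "\<dots> \<le> cmod a * (C * L2_norm M f) + cmod b * (D * L2_norm M f)"
      unfolding L2_norm_cmult by (intro add_mono mult_left_mono C D f) simp_all
    finally show ?thesis
      by (simp add: algebra_simps)
  qed
  moreover have "AE x in M. ?R (\<lambda>y. c * f y + d * g y) x = c * ?R f x + d * ?R g x"
    if "f \<in> L2 M" "g \<in> L2 M" for f g c d
    using L2_operator_linear[OF T that, of c d] L2_operator_linear[OF S that, of c d]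
    by eventually_elim (simp add: algebra_simps)
  moreover have "?R f \<in> L2 M" if "f \<in> L2 M" for f
    by (intro L2_lincomb L2_operator_L2[OF T] L2_operator_L2[OF S] that)
  ultimately show ?thesis
    unfolding L2_operators_def by blast
qed

lemma L2_operators_compose:
  assumes T: "T \<in> L2_operators M" and S: "S \<in> L2_operators M"
  shows "(\<lambda>f. T (S f)) \<in> L2_operators M"
proof -
  note TL = L2_operator_L2[OF T] and SL = L2_operator_L2[OF S]
  obtain C where C: "0 \<le> C" "\<And>f. f \<in> L2 M \<Longrightarrow> L2_norm M (T f) \<le> C * L2_norm M f"
    using L2_operator_bounded[OF T] by blast
  obtain D where D: "\<And>f. f \<in> L2 M \<Longrightarrow> L2_norm M (S f) \<le> D * L2_norm M f"
    using L2_operator_bounded[OF S] by blast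
  have "L2_norm M (T (S f)) \<le> (C * D) * L2_norm M f" if f: "f \<in> L2 M" for f
    using C(2)[OF SL[OF f]] mult_left_mono[OF D[OF f] C(1)] by (simp add: mult.assoc)
  moreover have "AE x in M. T (S (\<lambda>y. c * f y + d * g y)) x = c * T (S f) x + d * T (S g) x"
    if f: "f \<in> L2 M" and g: "g \<in> L2 M" for f g c d
  proof -
    have "AE x in M. T (S (\<lambda>y. c * f y + d * g y)) x = T (\<lambda>y. c * S f y + d * S g y) x"
      by (rule L2_operator_cong_AE[OF T SL[OF L2_lincomb[OF f g]] L2_lincomb[OF SL[OF f] SL[OF g]]
            L2_operator_linear[OF S f g]])
    then show ?thesis
      using L2_operator_linear[OF T SL[OF f] SL[OF g], of c d] by eventually_elim simp
  qed
  moreover have "T (S f) \<in> L2 M" if "f \<in> L2 M" for f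
    by (intro TL SL that)
  ultimately show ?thesis
    unfolding L2_operators_def by blast
qed

lemma L2_operators_id: "(\<lambda>f. f) \<in> L2_operators M"
  unfolding L2_operators_def by (auto intro: exI[of _ 1])

text \<open>
  This bounds the von Neumann algebra generated by a set of bounded operators from above; in
  particular it then consists of bounded operators, on which matrix coefficients are linear.
\<close>

lemma L2_operators_von_neumann: "von_neumann_algebra M (L2_operators M)"
proof -
  have "topspace (weak_operator_topology M) = L2_operators M"
  proof
    have "{T \<in> L2_operators M. L2_inner M (T (\<lambda>x. 0)) (\<lambda>x. 0) \<in> UNIV}
        \<in> {{T \<in> L2_operators M. L2_inner M (T \<xi>) \<eta> \<in> U} | \<xi> \<eta> U. \<xi> \<in> L2 M \<and> \<eta> \<in> L2 M \<and> open U}"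
      using L2_zero open_UNIV by blast
    then show "L2_operators M \<subseteq> topspace (weak_operator_topology M)"
      unfolding weak_operator_topology_def topology_generated_by_topspace by blast
  qed (auto simp: weak_operator_topology_def)
  then have "closedin (weak_operator_topology M) (L2_operators M)"
    by (metis closedin_topspace)
  then show ?thesis
    unfolding von_neumann_algebra_def
    using L2_operators_id L2_operators_lincomb L2_operators_compose by blast
qed

lemma generated_von_neumann_algebra_subset:
  "S \<subseteq> L2_operators M \<Longrightarrow> generated_von_neumann_algebra M S \<subseteq> L2_operators M"
  unfolding generated_von_neumann_algebra_def using L2_operators_von_neumann by blast

lemma generator_in_von_neumann_algebra: "T \<in> S \<Longrightarrow> T \<in> generated_von_neumann_algebra M S"
  unfolding generated_von_neumann_algebra_def by blast

text \<open>
  A single matrix coefficient is an ultraweak coefficient whose vectors are zero from the second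
  place on.
\<close>

lemma matrix_coefficient_in_predual:
  assumes N: "N \<subseteq> L2_operators M" and \<xi>: "\<xi> \<in> L2 M" and \<eta>: "\<eta> \<in> L2 M"
  shows "(\<lambda>T. L2_inner M (T \<xi>) \<eta>) \<in> predual M N"
proof -
  have "L2_inner M (\<lambda>x. a * T \<xi> x + b * S \<xi> x) \<eta> = a * L2_inner M (T \<xi>) \<eta> + b * L2_inner M (S \<xi>) \<eta>"
    if "T \<in> N" "S \<in> N" for T S a b
    using that N by (intro L2_inner_lincomb_left L2_operator_L2[of T] L2_operator_L2[of S] \<xi> \<eta>) auto
  moreover have "continuous_map (subtopology (ultraweak_topology M) N) euclidean (\<lambda>T. L2_inner M (T \<xi>) \<eta>)"
  proof -
    define \<xi>' where "\<xi>' n = (if n = 0 then \<xi> else (\<lambda>x. 0))" for n :: nat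
    define \<eta>' where "\<eta>' n = (if n = 0 then \<eta> else (\<lambda>x. 0))" for n :: nat
    have series: "(\<Sum>n. L2_inner M (T (\<xi>' n)) (\<eta>' n)) = L2_inner M (T \<xi>) \<eta>" for T
    proof -
      have "(\<Sum>n. L2_inner M (T (\<xi>' n)) (\<eta>' n)) = (\<Sum>n\<in>{0}. L2_inner M (T (\<xi>' n)) (\<eta>' n))"
        by (rule suminf_finite) (auto simp: \<eta>'_def L2_inner_def)
      then show ?thesis
        by (simp add: \<xi>'_def \<eta>'_def)
    qed
    have "summable (\<lambda>n. (L2_norm M (\<xi>' n))\<^sup>2)" "summable (\<lambda>n. (L2_norm M (\<eta>' n))\<^sup>2)"
      by (rule summable_finite[of "{0}"]; simp add: \<xi>'_def \<eta>'_def)+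
    moreover have "\<forall>n. \<xi>' n \<in> L2 M \<and> \<eta>' n \<in> L2 M"
      using \<xi> \<eta> L2_zero by (auto simp: \<xi>'_def \<eta>'_def)
    ultimately have op: "openin (ultraweak_topology M) {T \<in> L2_operators M. L2_inner M (T \<xi>) \<eta> \<in> U}" if "open U" for U
      unfolding ultraweak_topology_def series[symmetric]
      by (intro topology_generated_by_Basis CollectI exI[of _ \<xi>'] exI[of _ \<eta>'] exI[of _ U]) (use that in auto)
    have top: "topspace (subtopology (ultraweak_topology M) N) = N"
      using openin_subset[OF op[OF open_UNIV]] N by auto
    show ?thesis
      unfolding continuous_map_def top
    proof (intro conjI allI impI)
      fix U :: "complex set" assume "openin euclidean U"
      then have "openin (subtopology (ultraweak_topology M) N) (N \<inter> {T \<in> L2_operators M. L2_inner M (T \<xi>) \<eta> \<in> U})"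
        by (intro openin_subtopology_Int2 op) simp
      moreover have "N \<inter> {T \<in> L2_operators M. L2_inner M (T \<xi>) \<eta> \<in> U} = {T \<in> N. L2_inner M (T \<xi>) \<eta> \<in> U}"
        using N by blast
      ultimately show "openin (subtopology (ultraweak_topology M) N) {T \<in> N. L2_inner M (T \<xi>) \<eta> \<in> U}"
        by simp
    qed simp
  qed
  ultimately show ?thesis
    unfolding predual_def by blast
qed

section \<open>The Fourier algebra\<close>

context lc_spherical_projector
begin

abbreviation AH :: "('a set \<Rightarrow> complex) set" where "AH \<equiv> fourier_algebra \<mu> \<pi>"

lemma VN_subset: "VN \<mu> \<pi> \<subseteq> L2_operators HM"
  unfolding VN_def by (rule generated_von_neumann_algebra_subset) (auto intro: left_regular_props)

lemma matrix_coefficient_in_fourier_algebra: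
  assumes "\<xi> \<in> L2 HM" "\<eta> \<in> L2 HM"
  shows "(\<lambda>h. if h \<in> hyp_space \<pi> then L2_inner HM (left_regular \<mu> \<pi> h \<xi>) \<eta> else 0) \<in> AH"
  unfolding fourier_algebra_def
  by (intro CollectI exI[of _ "\<lambda>T. L2_inner HM (T \<xi>) \<eta>"] conjI refl matrix_coefficient_in_predual[OF VN_subset assms])

lemma fourier_algebra_outside: "u \<in> AH \<Longrightarrow> h \<notin> hyp_space \<pi> \<Longrightarrow> u h = 0"
  by (auto simp: fourier_algebra_def)

lemma left_regular_continuous:
  "continuous_map HT (subtopology (ultraweak_topology HM) (VN \<mu> \<pi>)) (left_regular \<mu> \<pi>)"
proof -
  have VN: "left_regular \<mu> \<pi> h \<in> VN \<mu> \<pi>" if "h \<in> hyp_space \<pi>" for h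
    unfolding VN_def using that by (intro generator_in_von_neumann_algebra) blast
  have "continuous_map HT (ultraweak_topology HM) (left_regular \<mu> \<pi>)"
    unfolding ultraweak_topology_def
  proof (rule continuous_on_generated_topo, clarify)
    fix \<xi> \<eta> :: "nat \<Rightarrow> 'a set \<Rightarrow> complex" and U :: "complex set"
    assume *: "\<forall>n. \<xi> n \<in> L2 HM \<and> \<eta> n \<in> L2 HM" "summable (\<lambda>n. (L2_norm HM (\<xi> n))\<^sup>2)"
      "summable (\<lambda>n. (L2_norm HM (\<eta> n))\<^sup>2)" "open U"
    let ?s = "\<lambda>x. \<Sum>n. L2_inner HM (left_regular \<mu> \<pi> (orbit \<pi> x) (\<xi> n)) (\<eta> n)"
    have "open (?s -` U)"
      using * by (intro open_vimage left_regular_ultraweak_continuous) auto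
    moreover have "orbit \<pi> -` (left_regular \<mu> \<pi> -` {T \<in> L2_operators HM. (\<Sum>n. L2_inner HM (T (\<xi> n)) (\<eta> n)) \<in> U} \<inter> topspace HT) = ?s -` U"
      by (auto simp: topspace_hyp_topology left_regular_props)
    ultimately show "openin HT (left_regular \<mu> \<pi> -` {T \<in> L2_operators HM. (\<Sum>n. L2_inner HM (T (\<xi> n)) (\<eta> n)) \<in> U} \<inter> topspace HT)"
      by (simp add: openin_hyp_topology topspace_hyp_topology)
  next
    have "{T \<in> L2_operators HM. (\<Sum>n. L2_inner HM (T ((\<lambda>n x. 0) n)) ((\<lambda>n x. 0) n)) \<in> UNIV}
        \<in> {{T \<in> L2_operators HM. (\<Sum>n. L2_inner HM (T (\<xi> n)) (\<eta> n)) \<in> U} | \<xi> \<eta> U.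
          (\<forall>n::nat. \<xi> n \<in> L2 HM \<and> \<eta> n \<in> L2 HM) \<and>
          summable (\<lambda>n. (L2_norm HM (\<xi> n))\<^sup>2) \<and> summable (\<lambda>n. (L2_norm HM (\<eta> n))\<^sup>2) \<and> open U}" (is "?A \<in> ?B")
      by (intro CollectI exI[of _ "\<lambda>n x. 0"] exI[of _ UNIV]) (simp add: L2_zero)
    moreover have "left_regular \<mu> \<pi> ` topspace HT \<subseteq> ?A"
      by (auto simp: topspace_hyp_topology left_regular_props)
    ultimately show "left_regular \<mu> \<pi> ` topspace HT \<subseteq> \<Union>?B"
      by blast
  qed
  then show ?thesis
    using VN by (auto simp: continuous_map_in_subtopology topspace_hyp_topology)
qed

lemma fourier_algebra_continuous:
  assumes "u \<in> AH"
  shows "continuous_map HT euclidean u"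
proof -
  obtain \<phi> where \<phi>: "\<phi> \<in> predual HM (VN \<mu> \<pi>)" "u = (\<lambda>h. if h \<in> hyp_space \<pi> then \<phi> (left_regular \<mu> \<pi> h) else 0)"
    using assms by (auto simp: fourier_algebra_def)
  have "continuous_map HT euclidean (\<phi> \<circ> left_regular \<mu> \<pi>)"
    using \<phi>(1) by (intro continuous_map_compose[OF left_regular_continuous]) (simp add: predual_def)
  then show ?thesis
    by (rule continuous_map_eq) (simp add: \<phi>(2) topspace_hyp_topology)
qed

lemma left_regular_inner_integral:
  assumes h: "h \<in> hyp_space \<pi>" and f: "f \<in> Cc HT" and g: "g \<in> Cc HT"
  shows "L2_inner HM (left_regular \<mu> \<pi> h f) g
    = (\<integral>t. hyp_translate h f (orbit \<pi> t) * cnj (g (orbit \<pi> t)) \<partial>\<mu>)"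
  unfolding left_regular_inner_Cc[OF h f Cc_hyp_L2[OF g]]
    L2_inner_hyp[OF Cc_hyp_measurable[OF hyp_translate_Cc[OF h f]] Cc_hyp_measurable[OF g]]
  by (rule L2_inner_def)

text \<open>
  Let \<open>\<xi>\<close> be a bump near the identity of \<open>H\<close>. The translates of \<open>\<xi>\<close> by \<open>a\<close> and by \<open>b\<close> live near \<open>a\<close> and near \<open>b\<close>. If
  these supports are disjoint, the matrix coefficient of \<open>\<xi>\<close> and \<open>\<lambda>(a) \<xi>\<close> is positive at \<open>a\<close> and zero at \<open>b\<close>.
  Nearness is measured by a radial function \<open>Q\<close> that is 1 on the orbit \<open>a\<close> and 0 on the orbit \<open>b\<close>: right
  translation by points close to \<open>O\<^sub>0\<close> changes the values of \<open>Q\<close> on both orbits by at most \<open>1 / 4\<close>, because right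
  translation by points of \<open>O\<^sub>0\<close> does not change them at all.
\<close>

lemma fourier_algebra_separates:
  assumes ab: "a \<in> hyp_space \<pi>" "b \<in> hyp_space \<pi>" "a \<noteq> b"
  obtains v where "v \<in> AH" "v a \<noteq> 0" "v b = 0"
proof -
  obtain x y where xy: "a = orbit \<pi> x" "b = orbit \<pi> y"
    using ab by (auto simp: hyp_space_def)
  have disj: "orbit \<pi> x \<inter> orbit \<pi> y = {}"
    using orbit_partition[of x y] ab(3) xy by auto
  have "open (- orbit \<pi> y)" "orbit \<pi> x \<subseteq> - orbit \<pi> y"
    using compact_imp_closed[OF orbit_compact] disj by auto
  then obtain q :: "'a \<Rightarrow> real" and C where q: "continuous_on UNIV q" "\<And>z. 0 \<le> q z" "\<And>z. q z \<le> 1"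
    "\<And>z. z \<in> orbit \<pi> x \<Longrightarrow> q z = 1" "compact C" "C \<subseteq> - orbit \<pi> y" "\<And>z. z \<notin> C \<Longrightarrow> q z = 0"
    using compact_bump[OF lc orbit_compact] by metis
  have qCc: "(\<lambda>z. complex_of_real (q z)) \<in> Cc euclidean"
    using q by (intro CcI[of _ C] continuous_intros) auto
  define Q where "Q = \<pi> (\<lambda>z. complex_of_real (q z))"
  have QCc: "Q \<in> Cc euclidean"
    unfolding Q_def by (rule maps_Cc[OF qCc])
  have Q_radial: "Q z = Q w" if "orbit \<pi> z = orbit \<pi> w" for z w
    unfolding Q_def by (rule pi_radial[OF qCc that])
  have Qx: "Q x = 1"
    unfolding Q_def by (rule pi_const[OF qCc]) (simp add: q(4))
  have Qy: "Q y = 0"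
    unfolding Q_def by (rule pi_eq_0[OF qCc]) (use q(6,7) in auto)
  have "\<exists>X. v \<in> X \<and> open X \<and> (\<forall>w\<in>X. \<forall>s\<in>orbit \<pi> x \<union> orbit \<pi> y. dist (Q (s + w)) (Q (s + v)) \<le> 1 / 4)" for v
    by (intro continuous_uniform_on_compact continuous_translates QCc compact_Un orbit_compact) simp
  then obtain X where X: "\<And>v. v \<in> X v" "\<And>v. open (X v)"
    "\<And>v w s. w \<in> X v \<Longrightarrow> s \<in> orbit \<pi> x \<union> orbit \<pi> y \<Longrightarrow> dist (Q (s + w)) (Q (s + v)) \<le> 1 / 4"
    by metis
  define V where "V = (\<Union>v\<in>orbit \<pi> 0. X v)"
  have "open V"
    unfolding V_def using X(2) by blast
  have near: "dist (Q (s + w)) (Q s) \<le> 1 / 4" if w: "w \<in> V" and s: "s \<in> orbit \<pi> x \<union> orbit \<pi> y" for w s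
  proof -
    obtain v where v: "v \<in> orbit \<pi> 0" "w \<in> X v"
      using w by (auto simp: V_def)
    show ?thesis
      using X(3)[OF v(2) s] Q_radial[OF orbit_add_zero_right[OF v(1)]] by simp
  qed
  have "orbit \<pi> 0 \<subseteq> V"
    using X(1) by (auto simp: V_def)
  then obtain g where g: "g \<in> Cc euclidean" "\<And>z. g z \<in> \<real>\<^sub>\<ge>\<^sub>0" "g 0 = 1" "\<And>z. \<not> orbit \<pi> z \<subseteq> V \<Longrightarrow> g z = 0"
    using bump_at[OF open_orbit_within[OF \<open>open V\<close>], of 0] by auto
  have pg: "\<pi> g \<in> Cc euclidean"
    by (rule maps_Cc[OF g(1)])
  have pg_pos: "\<pi> g z \<in> \<real>\<^sub>\<ge>\<^sub>0" for z
    by (rule pos[OF g(1,2)])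
  have average_pos: "orbit_average y (\<pi> g) z \<in> \<real>\<^sub>\<ge>\<^sub>0" for y z
    unfolding orbit_average_def by (rule pos[OF Cc_right_translate[OF pg] pg_pos])
  have pg_V: "z \<in> V" if z: "\<pi> g z \<noteq> 0" for z
  proof -
    obtain w where w: "w \<in> orbit \<pi> z" "g w \<noteq> 0"
      using pi_eq_0[OF g(1), of z] z by blast
    have "orbit \<pi> w \<subseteq> V"
      using g(4)[of w] w(2) by blast
    then show ?thesis
      using self_in_orbit[of z] w(1) by (auto simp only: mem_orbit_iff)
  qed
  define \<xi> where "\<xi> = descend (\<pi> g)"
  have \<xi>: "\<xi> \<in> Cc HT"
    unfolding \<xi>_def by (rule descend_pi_Cc[OF g(1)])
  have \<xi>_orbit: "(\<lambda>z. \<xi> (orbit \<pi> z)) = \<pi> g"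
    unfolding \<xi>_def using descend_pi_orbit[OF g(1)] by blast
  have translate_orbit: "hyp_translate (orbit \<pi> z) \<xi> (orbit \<pi> t) = \<pi> (orbit_average (- z) (\<pi> g)) t" for z t
    using hyp_translate_orbit[OF \<xi>] by (simp add: \<xi>_orbit)
  have translate_support: "dist (Q t) (Q z) \<le> 1 / 4"
    if z: "z = x \<or> z = y" and ne: "hyp_translate (orbit \<pi> z) \<xi> (orbit \<pi> t) \<noteq> 0" for z t
  proof -
    obtain t' where t': "t' \<in> orbit \<pi> t" "orbit_average (- z) (\<pi> g) t' \<noteq> 0"
      using pi_eq_0[OF orbit_average_Cc[OF pg]] ne unfolding translate_orbit by blast
    obtain s where s: "s \<in> orbit \<pi> (- z)" "\<pi> g (s + t') \<noteq> 0"
      using orbit_average_eq_0[OF pg] t'(2) by blast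
    have s': "orbit \<pi> (- s) = orbit \<pi> z"
      using orbit_uminus_cong[of s "- z"] s(1) by (simp add: mem_orbit_iff)
    have "- s \<in> orbit \<pi> x \<union> orbit \<pi> y"
      using s' z by (auto simp: mem_orbit_iff)
    from near[OF pg_V[OF s(2)] this] have "dist (Q t') (Q (- s)) \<le> 1 / 4"
      by (simp flip: add.assoc)
    moreover have "Q t' = Q t" "Q (- s) = Q z"
      using t'(1) s' by (auto intro: Q_radial simp: mem_orbit_iff)
    ultimately show ?thesis
      by simp
  qed
  define \<eta> where "\<eta> = hyp_translate a \<xi>"
  have \<eta>: "\<eta> \<in> Cc HT"
    unfolding \<eta>_def by (rule hyp_translate_Cc[OF ab(1) \<xi>])
  define v where "v h = (if h \<in> hyp_space \<pi> then L2_inner HM (left_regular \<mu> \<pi> h \<xi>) \<eta> else 0)" for h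
  have v_eq: "v h = (\<integral>t. hyp_translate h \<xi> (orbit \<pi> t) * cnj (\<eta> (orbit \<pi> t)) \<partial>\<mu>)" if h: "h \<in> hyp_space \<pi>" for h
    using h left_regular_inner_integral[OF h \<xi> \<eta>] by (simp add: v_def)
  show ?thesis
  proof (rule that[of v])
    show "v \<in> AH"
      unfolding v_def by (intro matrix_coefficient_in_fourier_algebra Cc_hyp_L2 \<xi> \<eta>)
    have disjoint: "hyp_translate b \<xi> (orbit \<pi> t) * cnj (\<eta> (orbit \<pi> t)) = 0" for t
    proof (rule ccontr)
      assume "\<not> ?thesis"
      then have "dist (Q t) (Q x) \<le> 1 / 4" "dist (Q t) (Q y) \<le> 1 / 4"
        using translate_support[of x t] translate_support[of y t] by (auto simp: \<eta>_def xy)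
      then show False
        using dist_triangle2[of "Q x" "Q y" "Q t"] by (simp add: Qx Qy dist_commute)
    qed
    show "v b = 0"
      unfolding v_eq[OF ab(2)] disjoint by simp
    have \<eta>_x: "\<eta> (orbit \<pi> x) \<noteq> 0"
    proof -
      have "\<pi> g 0 \<noteq> 0"
        by (rule pi_nonzero[OF g(1,2) self_in_orbit]) (simp add: g(3))
      then have "orbit_average (- x) (\<pi> g) x \<noteq> 0"
        unfolding orbit_average_def
        by (intro pi_nonzero[OF Cc_right_translate[OF pg] pg_pos self_in_orbit]) simp
      then show ?thesis
        unfolding \<eta>_def xy translate_orbit
        by (rule pi_nonzero[OF orbit_average_Cc[OF pg] average_pos self_in_orbit])
    qed
    have \<eta>Cc: "(\<lambda>t. \<eta> (orbit \<pi> t)) \<in> Cc euclidean"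
      using \<eta> by (simp add: Cc_hyp_iff)
    have "(\<integral>t. \<eta> (orbit \<pi> t) * cnj (\<eta> (orbit \<pi> t)) \<partial>\<mu>) \<noteq> 0"
    proof (rule Cc_integral_positive[where x = x])
      show "(\<lambda>t. \<eta> (orbit \<pi> t) * cnj (\<eta> (orbit \<pi> t))) \<in> Cc euclidean"
        by (intro Cc_mult Cc_cnj \<eta>Cc)
      show "\<eta> (orbit \<pi> t) * cnj (\<eta> (orbit \<pi> t)) \<in> \<real>\<^sub>\<ge>\<^sub>0" for t
        by (simp add: complex_nonneg_Reals_iff)
    qed (use \<eta>_x in simp)
    then show "v a \<noteq> 0"
      by (simp add: v_eq[OF ab(1)] \<eta>_def)
  qed
qed

section \<open>Open orbits and discreteness\<close>

lemma discrete_iff: "HT = discrete_topology (hyp_space \<pi>) \<longleftrightarrow> (\<forall>x. open (orbit \<pi> x))"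
proof -
  have vimage: "orbit \<pi> -` {orbit \<pi> x} = orbit \<pi> x" for x
    using mem_orbit_iff[of _ x] by auto
  show ?thesis
  proof
    assume "HT = discrete_topology (hyp_space \<pi>)"
    then have "openin HT {orbit \<pi> x}" for x
      by simp
    then show "\<forall>x. open (orbit \<pi> x)"
      by (simp add: openin_hyp_topology vimage)
  next
    assume op: "\<forall>x. open (orbit \<pi> x)"
    have "open (orbit \<pi> -` U)" for U
    proof -
      have "orbit \<pi> -` U = (\<Union>x\<in>orbit \<pi> -` U. orbit \<pi> x)"
        using self_in_orbit mem_orbit_iff by auto
      then show ?thesis
        using op by (metis open_UN)
    qed
    then show "HT = discrete_topology (hyp_space \<pi>)"
      by (simp add: topology_eq openin_hyp_topology)
  qed
qed

text \<open>
  The convolution of the Dirac measures at \<open>O\<^sub>x\<close> and \<open>O\<^bsub>-x\<^esub>\<close> has the points \<open>O\<^bsub>s + t\<^esub>\<close> in its support. If it is the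
  Dirac measure at the identity, its value at a radial function vanishing on \<open>O\<^sub>0\<close> but not at \<open>s + t\<close> would
  have to be both zero and non-zero.
\<close>

lemma max_subgroup_orbit_add:
  assumes a: "orbit \<pi> x \<in> max_subgroup \<pi>" and s: "s \<in> orbit \<pi> x" and t: "t \<in> orbit \<pi> (- x)"
  shows "s + t \<in> orbit \<pi> 0"
proof (rule ccontr)
  assume "s + t \<notin> orbit \<pi> 0"
  then obtain g where g: "g \<in> Cc euclidean" "\<And>z. g z \<in> \<real>\<^sub>\<ge>\<^sub>0" "g (s + t) = 1" "\<And>z. z \<notin> - orbit \<pi> 0 \<Longrightarrow> g z = 0"
    using bump_at[of "- orbit \<pi> 0" "s + t"] compact_imp_closed[OF orbit_compact] by (metis ComplI open_Compl)
  have pg: "\<pi> g \<in> Cc euclidean"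
    by (rule maps_Cc[OF g(1)])
  have pg_pos: "\<pi> g z \<in> \<real>\<^sub>\<ge>\<^sub>0" for z
    by (rule pos[OF g(1,2)])
  have average_pos: "orbit_average y (\<pi> g) z \<in> \<real>\<^sub>\<ge>\<^sub>0" for y z
    unfolding orbit_average_def by (rule pos[OF Cc_right_translate[OF pg] pg_pos])
  let ?f = "descend (\<pi> g)"
  have f: "?f \<in> Cc HT"
    by (rule descend_pi_Cc[OF g(1)])
  have "hyp_conv \<pi> (orbit \<pi> x) (orbit \<pi> (- x)) ?f = ?f (orbit \<pi> 0)"
    using a f unfolding max_subgroup_def by (simp add: hyp_inv_orbit hyp_one_def)
  moreover have "(\<lambda>z. ?f (orbit \<pi> z)) = \<pi> g"
    using descend_pi_orbit[OF g(1)] by blast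
  moreover have "\<pi> g 0 = 0"
    by (rule pi_eq_0[OF g(1)]) (simp add: g(4))
  ultimately have "\<pi> (orbit_average x (\<pi> g)) (- x) = 0"
    using hyp_conv_orbit[OF f, of x "- x"] descend_pi_orbit[OF g(1), of 0] by simp
  moreover have "\<pi> g (s + t) \<noteq> 0"
    by (rule pi_nonzero[OF g(1,2) self_in_orbit]) (simp add: g(3))
  then have "orbit_average x (\<pi> g) t \<noteq> 0"
    unfolding orbit_average_def by (rule pi_nonzero[OF Cc_right_translate[OF pg] pg_pos s])
  then have "\<pi> (orbit_average x (\<pi> g)) (- x) \<noteq> 0"
    by (rule pi_nonzero[OF orbit_average_Cc[OF pg] average_pos t])
  ultimately show False
    by contradiction
qed

text \<open>
  The set \<open>O\<^sub>x - x\<close> is an open neighbourhood of \<open>0\<close> contained in \<open>O\<^sub>0\<close>. So for \<open>y\<close> in an orbit, \<open>y + (O\<^sub>x - x)\<close> is a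
  neighbourhood of \<open>y\<close> in \<open>y + O\<^sub>0\<close>, which lies in the same orbit.
\<close>

lemma open_orbits:
  assumes a: "orbit \<pi> x \<in> max_subgroup \<pi>" and op: "open (orbit \<pi> x)"
  shows "open (orbit \<pi> z)"
  unfolding open_subopen[of "orbit \<pi> z"]
proof
  fix y assume y: "y \<in> orbit \<pi> z"
  let ?W = "(\<lambda>w. (- y + w) + x) -` orbit \<pi> x"
  have "open ?W"
    by (intro open_vimage op continuous_intros)
  moreover have "y \<in> ?W"
    by (simp add: self_in_orbit)
  moreover have "?W \<subseteq> orbit \<pi> z"
  proof
    fix w assume "w \<in> ?W"
    then have "((- y + w) + x) + - x \<in> orbit \<pi> 0"
      by (intro max_subgroup_orbit_add[OF a] self_in_orbit) simp
    then have "- y + w \<in> orbit \<pi> 0"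
      by simp
    from orbit_add_zero_right[OF this, of y] show "w \<in> orbit \<pi> z"
      using y by (simp add: mem_orbit_iff flip: add.assoc)
  qed
  ultimately show "\<exists>T. open T \<and> y \<in> T \<and> T \<subseteq> orbit \<pi> z"
    by blast
qed

lemma identity_in_max_subgroup: "orbit \<pi> 0 \<in> max_subgroup \<pi>"
proof -
  have average: "\<pi> (orbit_average 0 F) 0 = F 0"
    if F: "F \<in> Cc euclidean" and radial: "\<And>z w. orbit \<pi> z = orbit \<pi> w \<Longrightarrow> F z = F w" for F
  proof (rule pi_const[OF orbit_average_Cc[OF F]])
    fix t assume t: "t \<in> orbit \<pi> 0"
    show "orbit_average 0 F t = F 0"
      unfolding orbit_average_def
    proof (rule pi_const[OF Cc_right_translate[OF F]])
      show "F (s + t) = F 0" if "s \<in> orbit \<pi> 0" for s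
        using orbit_add_zero_right[OF t, of s] that by (intro radial) (simp add: mem_orbit_iff)
    qed
  qed
  have "hyp_conv \<pi> (orbit \<pi> 0) (orbit \<pi> 0) f = f (orbit \<pi> 0)" if f: "f \<in> Cc HT" for f
    unfolding hyp_conv_orbit[OF f] by (rule average) (use f in \<open>simp_all add: Cc_hyp_iff\<close>)
  then show ?thesis
    using hyp_inv_orbit[of 0] by (simp add: max_subgroup_def hyp_one_def)
qed

text \<open>
  For \<open>t\<close> in \<open>O\<^sub>0\<close> and \<open>s\<close> in \<open>O\<^bsub>-x\<^esub>\<close> the orbit of \<open>s + t\<close> is \<open>O\<^bsub>-x\<^esub>\<close>. So the translate by \<open>O\<^sub>x\<close> of the indicator of the
  identity takes at the identity the value 1 if \<open>O\<^sub>x = O\<^sub>0\<close> and the value 0 otherwise; the measure of \<open>O\<^sub>0\<close> is the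
  normalizing factor.
\<close>

lemma idempotent_at_identity:
  assumes op: "open (orbit \<pi> 0)"
  shows "(\<lambda>h. d * indicator {orbit \<pi> 0} h) \<in> AH"
proof -
  let ?K = "orbit \<pi> 0"
  let ?\<xi> = "indicator {?K} :: 'a set \<Rightarrow> complex"
  have ind: "?\<xi> (orbit \<pi> x) = indicator ?K x" for x
    by (simp add: indicator_def mem_orbit_iff)
  have K: "compact ?K" "closed ?K"
    by (simp_all add: orbit_compact compact_imp_closed)
  have indCc: "(indicator ?K :: 'a \<Rightarrow> complex) \<in> Cc euclidean"
  proof (rule CcI[OF _ K(1)])
    have "open ((indicator ?K :: 'a \<Rightarrow> complex) -` B)" for B
    proof -
      have "(indicator ?K :: 'a \<Rightarrow> complex) -` B = (if 1 \<in> B then ?K else {}) \<union> (if 0 \<in> B then - ?K else {})"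
        by (auto simp: indicator_def of_bool_def split: if_splits)
      then show ?thesis
        using op K(2) by (auto intro: open_Un)
    qed
    then show "continuous_on UNIV (indicator ?K :: 'a \<Rightarrow> complex)"
      by (simp add: continuous_on_open_vimage)
  qed simp
  have \<xi>: "?\<xi> \<in> Cc HT"
    using indCc by (simp add: Cc_hyp_iff ind[abs_def])
  have Kfin: "emeasure \<mu> ?K < \<infinity>"
    by (rule compact_finite_measure[OF K(1)])
  define m where "m = measure \<mu> ?K"
  have "m \<noteq> 0"
    using open_positive_measure[OF op orbit_nonempty] Kfin
    unfolding m_def measure_def by (auto simp: enn2real_eq_0_iff)
  define \<eta> where "\<eta> h = cnj (d / m) * ?\<xi> h" for h
  have \<eta>: "\<eta> \<in> Cc HT"
    using Cc_hyp_lincomb[OF \<xi> \<xi>, of "cnj (d / m)" 0] by (simp add: \<eta>_def[abs_def])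
  have translate: "hyp_translate (orbit \<pi> x) ?\<xi> (orbit \<pi> t) = ?\<xi> (orbit \<pi> x)" if t: "t \<in> ?K" for x t
  proof -
    have "orbit_average (- x) (indicator ?K) t' = ?\<xi> (orbit \<pi> x)" if t': "t' \<in> ?K" for t'
      unfolding orbit_average_def
    proof (rule pi_const[OF Cc_right_translate[OF indCc]])
      fix s assume "s \<in> orbit \<pi> (- x)"
      then have "orbit \<pi> (s + t') = orbit \<pi> (- x)"
        using orbit_add_zero_right[OF t', of s] by (simp add: mem_orbit_iff)
      moreover have "orbit \<pi> (- x) = ?K \<longleftrightarrow> orbit \<pi> x = ?K"
        using orbit_uminus_cong[of "- x" 0] orbit_uminus_cong[of x 0] by auto
      ultimately show "indicator ?K (s + t') = ?\<xi> (orbit \<pi> x)"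
        by (simp add: indicator_def mem_orbit_iff)
    qed
    moreover have "t' \<in> ?K" if "t' \<in> orbit \<pi> t" for t'
      using that t by (simp add: mem_orbit_iff)
    ultimately have "\<pi> (orbit_average (- x) (indicator ?K)) t = ?\<xi> (orbit \<pi> x)"
      by (intro pi_const orbit_average_Cc indCc) auto
    then show ?thesis
      by (simp add: hyp_translate_orbit[OF \<xi>] ind[abs_def])
  qed
  have coeff: "L2_inner HM (left_regular \<mu> \<pi> h ?\<xi>) \<eta> = d * ?\<xi> h" if h: "h \<in> hyp_space \<pi>" for h
  proof -
    obtain x where x: "h = orbit \<pi> x"
      using h by (auto simp: hyp_space_def)
    have "L2_inner HM (left_regular \<mu> \<pi> h ?\<xi>) \<eta>
        = (\<integral>t. hyp_translate h ?\<xi> (orbit \<pi> t) * cnj (\<eta> (orbit \<pi> t)) \<partial>\<mu>)"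
      by (rule left_regular_inner_integral[OF h \<xi> \<eta>])
    also have "\<dots> = (\<integral>t. (?\<xi> h * (d / m)) * indicator ?K t \<partial>\<mu>)"
    proof (rule Bochner_Integration.integral_cong[OF refl])
      show "hyp_translate h ?\<xi> (orbit \<pi> t) * cnj (\<eta> (orbit \<pi> t)) = (?\<xi> h * (d / m)) * indicator ?K t" for t
        using translate[of t x] by (cases "t \<in> ?K") (simp_all add: \<eta>_def ind x)
    qed
    also have "\<dots> = (?\<xi> h * (d / m)) * (\<integral>t. indicator ?K t \<partial>\<mu>)"
      by (rule integral_mult_right_zero)
    also have "(\<integral>t. indicator ?K t \<partial>\<mu>) = (\<integral>t. complex_of_real (indicator ?K t) \<partial>\<mu>)"
      by (intro Bochner_Integration.integral_cong) (auto simp: indicator_def)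
    also have "\<dots> = complex_of_real m"
      using compact_sets[OF K(1)] Kfin by (simp only: integral_complex_of_real) (simp add: m_def)
    finally show ?thesis
      using \<open>m \<noteq> 0\<close> by simp
  qed
  have "(\<lambda>h. d * indicator {?K} h)
      = (\<lambda>h. if h \<in> hyp_space \<pi> then L2_inner HM (left_regular \<mu> \<pi> h ?\<xi>) \<eta> else 0)"
  proof
    show "d * indicator {?K} h = (if h \<in> hyp_space \<pi> then L2_inner HM (left_regular \<mu> \<pi> h ?\<xi>) \<eta> else 0)" for h
      by (cases "h \<in> hyp_space \<pi>") (auto simp: coeff indicator_def)
  qed
  then show ?thesis
    using matrix_coefficient_in_fourier_algebra[OF Cc_hyp_L2[OF \<xi>] Cc_hyp_L2[OF \<eta>]] by simp
qed

text \<open>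
  An idempotent takes only the values 0 and 1. If \<open>u\<close> were 1 at two points, an element \<open>v\<close> of the algebra
  separating them would make \<open>u v\<close> differ from every multiple of \<open>u\<close>.
\<close>

lemma minimal_idempotent_eq_indicator:
  assumes u: "minimal_idempotent AH u" and a: "a \<in> hyp_space \<pi>" "u a \<noteq> 0"
  shows "u = indicator {a}"
proof
  fix h
  have uA: "u \<in> AH" and idem: "u k * u k = u k" for k
    using u by (auto simp: minimal_idempotent_def dest: fun_cong)
  have ua: "u a = 1"
    using idem[of a] a(2) by simp
  have "u h = 0" if h: "h \<noteq> a" "h \<in> hyp_space \<pi>"
  proof (rule ccontr)
    assume uh: "u h \<noteq> 0"
    obtain v where v: "v \<in> AH" "v a \<noteq> 0" "v h = 0"
      using fourier_algebra_separates[OF a(1) h(2)] h(1) by metis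
    then have "(\<lambda>x. u x * v x) \<in> {(\<lambda>x. c * u x) | c. True}"
      using u unfolding minimal_idempotent_def by blast
    then obtain c where c: "(\<lambda>x. u x * v x) = (\<lambda>x. c * u x)"
      by blast
    show False
      using fun_cong[OF c, of a] fun_cong[OF c, of h] v uh ua by simp
  qed
  then show "u h = indicator {a} h"
    using ua fourier_algebra_outside[OF uA, of h] by (cases "h = a") (auto simp: indicator_def)
qed

lemma minimal_idempotent_imp_discrete:
  assumes u: "minimal_idempotent AH u" and a: "a \<in> max_subgroup \<pi>" "u a \<noteq> 0"
  shows "HT = discrete_topology (hyp_space \<pi>)"
proof -
  have aH: "a \<in> hyp_space \<pi>"
    using a(1) by (simp add: max_subgroup_def)
  then obtain x where x: "a = orbit \<pi> x"
    by (auto simp: hyp_space_def)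
  have "continuous_map HT euclidean u"
    using u by (intro fourier_algebra_continuous) (simp add: minimal_idempotent_def)
  then have "openin HT {h \<in> topspace HT. u h \<in> - {0}}"
    by (rule openin_continuous_map_preimage) auto
  also have "{h \<in> topspace HT. u h \<in> - {0}} = {a}"
    using aH unfolding minimal_idempotent_eq_indicator[OF u aH a(2)]
    by (auto simp: indicator_def topspace_hyp_topology split: if_splits)
  finally have "open (orbit \<pi> -` {a})"
    by (simp add: openin_hyp_topology)
  moreover have "orbit \<pi> -` {a} = orbit \<pi> x"
    unfolding x using mem_orbit_iff[of _ x] by auto
  ultimately show ?thesis
    using open_orbits[of x] a(1) unfolding discrete_iff x by simp
qed

lemma discrete_imp_minimal_idempotent:
  assumes "HT = discrete_topology (hyp_space \<pi>)"
  shows "minimal_idempotent AH (indicator {orbit \<pi> 0})"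
proof -
  let ?u = "indicator {orbit \<pi> 0} :: 'a set \<Rightarrow> complex"
  have cu: "(\<lambda>h. c * ?u h) \<in> AH" for c
    using assms by (intro idempotent_at_identity) (simp add: discrete_iff)
  have "?u \<in> AH"
    using cu[of 1] by simp
  moreover have "?u \<noteq> (\<lambda>x. 0)"
    by (auto simp: fun_eq_iff intro!: exI[of _ "orbit \<pi> 0"])
  moreover have idem: "(\<lambda>x. ?u x * ?u x) = ?u"
    by (auto simp: indicator_def)
  moreover have "{(\<lambda>x. ?u x * v x) | v. v \<in> AH} = {(\<lambda>x. c * ?u x) | c. True}"
  proof (intro equalityI subsetI)
    fix w assume "w \<in> {(\<lambda>x. ?u x * v x) | v. v \<in> AH}"
    then obtain v where "w = (\<lambda>x. ?u x * v x)"
      by blast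
    then have "w = (\<lambda>x. v (orbit \<pi> 0) * ?u x)"
      by (auto simp: indicator_def)
    then show "w \<in> {(\<lambda>x. c * ?u x) | c. True}"
      by blast
  next
    fix w assume "w \<in> {(\<lambda>x. c * ?u x) | c. True}"
    then obtain c where "w = (\<lambda>x. c * ?u x)"
      by blast
    then have "w = (\<lambda>x. ?u x * (c * ?u x))"
      by (simp add: fun_eq_iff indicator_def)
    then have "w = (\<lambda>x. ?u x * (c * ?u x)) \<and> (\<lambda>h. c * ?u h) \<in> AH"
      using cu[of c] by (rule conjI)
    then have "\<exists>v. w = (\<lambda>x. ?u x * v x) \<and> v \<in> AH"
      by (rule exI[of _ "\<lambda>h. c * ?u h"])
    then show "w \<in> {(\<lambda>x. ?u x * v x) | v. v \<in> AH}"
      by (simp only: mem_Collect_eq)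
  qed
  ultimately show ?thesis
    unfolding minimal_idempotent_def by blast
qed

end

theorem proposition3p1:
  fixes \<mu> :: "'a::{topological_group_add,t2_space} measure"
    and \<pi> :: "('a \<Rightarrow> complex) \<Rightarrow> 'a \<Rightarrow> complex"
  assumes "locally_compact_space (euclidean :: 'a topology)"
    and "left_haar_measure \<mu>"
    and "ultraspherical_projector \<mu> \<pi>"
  shows "(hyp_topology \<pi> = discrete_topology (hyp_space \<pi>) \<longleftrightarrow>
            (\<exists>u. minimal_idempotent (fourier_algebra \<mu> \<pi>) u \<and>
                 (\<exists>a \<in> max_subgroup \<pi>. u a \<noteq> 0))) \<and>
         (\<forall>u. \<forall>a \<in> max_subgroup \<pi>.
            minimal_idempotent (fourier_algebra \<mu> \<pi>) u \<and> u a \<noteq> 0 \<longrightarrow> u = indicator {a})"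
proof -
  interpret lc_spherical_projector \<mu> \<pi>
    using assms
    by (intro lc_spherical_projector.intro haar_measure.intro ultraspherical_projector.axioms(1))
  have "\<exists>u. minimal_idempotent (fourier_algebra \<mu> \<pi>) u \<and> (\<exists>a \<in> max_subgroup \<pi>. u a \<noteq> 0)"
    if "hyp_topology \<pi> = discrete_topology (hyp_space \<pi>)"
    using discrete_imp_minimal_idempotent[OF that] identity_in_max_subgroup
    by (intro exI[of _ "indicator {orbit \<pi> 0}"] conjI bexI[of _ "orbit \<pi> 0"]) auto
  moreover have "max_subgroup \<pi> \<subseteq> hyp_space \<pi>"
    by (auto simp: max_subgroup_def)
  ultimately show ?thesis
    using minimal_idempotent_imp_discrete minimal_idempotent_eq_indicator by blast
qed

end
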